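(* Suppose that $f\in L^2(I)$ is not the trace on $I$ of an $H^2$-function of modulus less than or equal to $1$ a.e. on $J$. Then $g\in H^2$ is the solution to ABEP if and only if the following two conditions hold: (i) $|g(e^{i\theta})|=1$ for a.e. $e^{i\theta}\in J$; (ii) there exists a nonnegative real function $\lambda\in L^1_{\mathbb{R}}(J)$ such that $$\langle g-f,h\rangle_I+\langle\lambda g,h\rangle_J=0\qquad\text{for all }h\in H^{2,\infty}_J .$$
   Context: $\mathbb{T}$ is the unit circle, $I\subset\mathbb{T}$ is a finite union of nonempty open arcs whose complement $J=\mathbb{T}\setminus I$ has nonempty interior (in $\mathbb{T}$). Functions are complex-valued unless indicated; $L^1_{\mathbb{R}}(J)$ is the space of real-valued integrable functions on $J$. $\|f\|_{L^2(I)}=\left(\frac1{2\pi}\int_I|f(e^{i\theta})|^2\,d\theta\right)^{1/2}$, and $\langle u,v\rangle_E=\frac1{2\pi}\int_E u(e^{i\theta})\overline{v(e^{i\theta})}\,d\theta$ for $E\subset\mathbb{T}$ measurable. $H^2$ is the Hardy space of the disk, viewed as the closed subspace of $L^2(\mathbb{T})$ of functions whose Fourier coefficients of strictly negative index vanish. $H^{2,\infty}_J=\{h\in H^2:\ \|h\|_{L^\infty(J)}<\infty\}$, where $\|h\|_{L^\infty(J)}$ is the essential supremum of $|h|$ on $J$. The trace of a function on $I$ is its restriction to $I$. Problem ABEP: given $f\in L^2(I)$, find $g_0\in H^2$ with $|g_0|\le 1$ a.e. on $J$ such that $\|f-g_0\|_{L^2(I)}=\inf\{\|f-g\|_{L^2(I)}:\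 g\in H^2,\ |g|\le 1\text{ a.e. on }J\}$. This problem has a unique solution. *)

theory Defs
  imports "HOL-Probability.Probability"
begin

(* Functions on the circle are total functions on the complex plane, of which only the values on
   the unit circle matter; elements of Lebesgue spaces are represented by measurable functions,
   identified when they agree almost everywhere. *)

abbreviation unit_circle :: "complex set" where
  "unit_circle \<equiv> sphere 0 1"

(* The image of dt / (2 pi) on [0, 2 pi) under t |-> exp(it); it is completed so that its
   measurable functions are the Lebesgue (not merely Borel) measurable ones. *)
definition circle_measure :: "complex measure" where
  "circle_measure = completion
     (distr (uniform_measure lborel {0..<2 * pi}) (restrict_space borel unit_circle) cis)"

lemma measurable_cis: "cis \<in> measurable borel (restrict_space borel unit_circle)"
  by (auto intro!: measurable_restrict_space2 borel_measurable_continuous_onI continuous_intros)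

lemma prob_space_circle_measure: "prob_space circle_measure"
proof -
  let ?M = "distr (uniform_measure lborel {0..<2 * pi}) (restrict_space borel unit_circle) cis"
  have "prob_space (uniform_measure lborel {0..<2 * pi})"
    by (rule prob_space_uniform_measure) auto
  then have "prob_space ?M"
    by (rule prob_space.prob_space_distr) (simp add: measurable_cis cong: measurable_cong_sets)
  then have "emeasure ?M (space ?M) = 1"
    by (rule prob_space.emeasure_space_1)
  moreover have "space ?M \<in> sets ?M"
    by (rule sets.top)
  ultimately have "emeasure (completion ?M) (space (completion ?M)) = 1"
    by (simp only: space_completion emeasure_completion main_part sets_completionI_sets)
  then show ?thesis
    unfolding circle_measure_def by (rule prob_spaceI)
qed

lemma integral_circle_measure:
  fixes f :: "complex \<Rightarrow> complex"
  assumes f: "f \<in> borel_measurable (restrict_space borel unit_circle)"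
  shows "(LINT z|circle_measure. f z) = (LINT t:{0..<2 * pi}|lborel. f (cis t)) /\<^sub>R (2 * pi)"
proof -
  have [measurable]: "(\<lambda>t. f (cis t)) \<in> borel_measurable borel"
    using measurable_compose[OF measurable_cis f] .
  have "(LINT z|circle_measure. f z) = (LINT t|uniform_measure lborel {0..<2 * pi}. f (cis t))"
    unfolding circle_measure_def using f measurable_cis
    by (subst integral_completion) (auto simp: integral_distr cong: measurable_cong_sets)
  also have "uniform_measure lborel {0..<2 * pi}
      = density lborel (\<lambda>t. ennreal (indicator {0..<2 * pi} t / (2 * pi)))"
    unfolding uniform_measure_def
  proof (intro density_cong)
    show "AE t in lborel. indicator {0..<2 * pi} t / emeasure lborel {0..<2 * pi}
        = ennreal (indicator {0..<2 * pi} t / (2 * pi))"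
      using divide_ennreal[of 1 "2 * pi"] by (auto simp: indicator_def)
  qed auto
  also have "(LINT t|\<dots>. f (cis t)) = (LINT t|lborel. (indicator {0..<2 * pi} t / (2 * pi)) *\<^sub>R f (cis t))"
    by (rule integral_density) auto
  also have "\<dots> = (LINT t|lborel. (1 / (2 * pi)) *\<^sub>R (indicator {0..<2 * pi} t *\<^sub>R f (cis t)))"
    by simp
  also have "\<dots> = (LINT t:{0..<2 * pi}|lborel. f (cis t)) /\<^sub>R (2 * pi)"
    unfolding set_lebesgue_integral_def integral_scaleR_right by (simp add: inverse_eq_divide)
  finally show ?thesis .
qed

definition open_arc :: "complex set \<Rightarrow> bool" where
  "open_arc A \<longleftrightarrow> (\<exists>a b. a < b \<and> b \<le> a + 2 * pi \<and> A = cis ` {a<..<b})"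

definition finite_union_of_arcs :: "complex set \<Rightarrow> bool" where
  "finite_union_of_arcs I \<longleftrightarrow>
     (\<exists>\<A>. finite \<A> \<and> \<A> \<noteq> {} \<and> (\<forall>A\<in>\<A>. open_arc A) \<and> I = \<Union>\<A>)"

definition L2_on :: "complex set \<Rightarrow> (complex \<Rightarrow> complex) set" where
  "L2_on E = {f. set_borel_measurable circle_measure E f \<and>
                 set_integrable circle_measure E (\<lambda>z. (cmod (f z))\<^sup>2)}"

definition L2_norm_on :: "complex set \<Rightarrow> (complex \<Rightarrow> complex) \<Rightarrow> real" where
  "L2_norm_on E f = sqrt (LINT z:E|circle_measure. (cmod (f z))\<^sup>2)"

definition inner_on :: "complex set \<Rightarrow> (complex \<Rightarrow> complex) \<Rightarrow> (complex \<Rightarrow> complex) \<Rightarrow> complex" where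
  "inner_on E u v = (LINT z:E|circle_measure. u z * cnj (v z))"

definition Linf_norm_on :: "complex set \<Rightarrow> (complex \<Rightarrow> complex) \<Rightarrow> ereal" where
  "Linf_norm_on E h = esssup (restrict_space circle_measure E) (\<lambda>z. ereal (cmod (h z)))"

(* On the unit circle, z powi (- n) is the conjugate of z powi n. *)
definition fourier_coeff :: "(complex \<Rightarrow> complex) \<Rightarrow> int \<Rightarrow> complex" where
  "fourier_coeff h n = (LINT z|circle_measure. h z * z powi (- n))"

definition H2 :: "(complex \<Rightarrow> complex) set" where
  "H2 = {h \<in> L2_on unit_circle. \<forall>n<0. fourier_coeff h n = 0}"

definition H2_inf :: "complex set \<Rightarrow> (complex \<Rightarrow> complex) set" where
  "H2_inf J = {h \<in> H2. Linf_norm_on J h < \<infinity>}"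

definition admissible :: "complex set \<Rightarrow> (complex \<Rightarrow> complex) set" where
  "admissible J = {g \<in> H2. AE z in circle_measure. z \<in> J \<longrightarrow> cmod (g z) \<le> 1}"

definition ABEP_solution ::
  "complex set \<Rightarrow> complex set \<Rightarrow> (complex \<Rightarrow> complex) \<Rightarrow> (complex \<Rightarrow> complex) \<Rightarrow> bool" where
  "ABEP_solution I J f g\<^sub>0 \<longleftrightarrow>
     g\<^sub>0 \<in> admissible J \<and>
     L2_norm_on I (\<lambda>z. f z - g\<^sub>0 z) = (INF g\<in>admissible J. L2_norm_on I (\<lambda>z. f z - g z))"

end

theory Submission
  imports Defs "HOL-Complex_Analysis.Complex_Analysis"
begin

text \<open>
  Sufficiency is the variational inequality for a convex problem: condition (ii) with \<open>h - g\<close> for an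
  admissible \<open>h\<close> gives \<open>Re \<langle>g - f, h - g\<rangle>\<^sub>I \<ge> 0\<close>, because \<open>\<lambda> \<ge> 0\<close> and \<open>|h| \<le> 1 = |g|\<close> on \<open>J\<close>.

  For necessity, perturb the solution \<open>g\<close> to \<open>(g + \<epsilon> h) exp (- \<epsilon> (v + i v~))\<close>, where \<open>v\<close> is supported on
  \<open>J\<close>, vanishes at the endpoints of \<open>I\<close>, has conjugate function \<open>v~\<close>, and compensates on \<open>J\<close> the change
  of modulus due to \<open>h\<close>. On \<open>I\<close> the exponential is unimodular with an explicit bounded argument, so the
  first variation and Fubini's theorem give \<open>Re \<langle>h, f - g\<rangle>\<^sub>I \<le> \<integral>\<^sub>J v \<lambda>\<close>, with \<open>\<lambda>\<close> the conjugate function of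
  \<open>Re (i g cnj (f - g))\<close> restricted to \<open>I\<close>. Suitable choices of \<open>v\<close> and \<open>h\<close> yield \<open>\<lambda> \<ge> 0\<close>, the
  integrability of \<open>\<lambda>\<close>, and (ii) for \<open>h\<close> vanishing at the endpoints, hence for all \<open>h\<close> by
  approximation. Where \<open>|g| < 1\<close>, both signs of \<open>v\<close> are allowed, so \<open>\<lambda> = 0\<close>; if this happens on a set
  of positive measure, analytic continuation across \<open>J\<close> gives \<open>\<lambda> = 0\<close> everywhere, then \<open>f - g\<close> is
  orthogonal on \<open>I\<close> to a polynomial multiple of every power of \<open>z\<close>, and continuing once more gives
  \<open>f = g\<close> on \<open>I\<close>.
\<close>

section \<open>Fourier coefficients on the circle\<close>

text \<open>The constraint on \<open>J\<close> is nonlinear, and a change of \<open>g\<close> there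
  must still come from an \<open>H2\<close> function. Multiplication by an outer function meets both
  demands: it adjusts the modulus on \<open>J\<close> at will, and on \<open>I\<close> it only
  rotates, by the conjugate function of \<open>v\<close>. To first order this rotation is linear in
  \<open>v\<close>, so moving the conjugation kernel to the other factor yields the multiplier
  explicitly, without compactness or duality. The kernel blows up like
  \<open>1 / norm (t - s)\<close>, and a point \<open>s\<close> of \<open>I\<close> comes close to a
  point \<open>t\<close> of \<open>J\<close> only near endpoints of arcs. The weight
  \<open>\<rho>\<close>, the product of the distances to these endpoints, cancels the blow-up. This
  is why variations must be dominated by \<open>\<rho>\<close>, and why integrability of the
  multiplier and orthogonality for all bounded \<open>h\<close> need separate limit arguments. An
  explicit multiplier has a second use: it is the boundary value of an analytic function which
  continues across gaps in \<open>I\<close>, so zeros on a set of positive measure can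
  spread.\<close>

lemma space_circle_measure [simp]: "space circle_measure = unit_circle"
  by (simp add: circle_measure_def space_completion space_restrict_space)

lemma measurable_circle_measureI:
  "f \<in> borel_measurable (restrict_space borel unit_circle) \<Longrightarrow> f \<in> borel_measurable circle_measure"
  unfolding circle_measure_def by (rule measurable_completion) simp

lemma borel_measurable_circle_measure:
  "f \<in> borel_measurable borel \<Longrightarrow> f \<in> borel_measurable circle_measure"
  by (intro measurable_circle_measureI measurable_restrict_space1)

lemma ident_measurable_circle_measure [measurable]: "(\<lambda>z. z) \<in> measurable circle_measure borel"
  by (rule borel_measurable_circle_measure) simp

interpretation circle: prob_space circle_measure
  by (rule prob_space_circle_measure)

lemma sets_circle_measureI: "A \<in> sets borel \<Longrightarrow> A \<subseteq> unit_circle \<Longrightarrow> A \<in> sets circle_measure"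
  using measurable_sets[OF ident_measurable_circle_measure, of A] by (simp add: Int_absorb2)

lemma AE_circle_norm: "AE z in circle_measure. norm z = 1"
  by (rule AE_I2) simp

lemma AE_circle_neq: "AE z in circle_measure. z \<noteq> p"
proof -
  \<comment> \<open>\<open>cis\<close> is injective on the half-open period, so a fibre has at most
    one point.\<close>
  have fin: "finite {t \<in> {0..<2*pi}. cis t = p}"
  proof (rule finite_subset)
    show "{t \<in> {0..<2*pi}. cis t = p} \<subseteq> {Arg2pi p}"
      using Arg2pi_unique[of 1] by (auto simp: cis_conv_exp)
  qed simp
  have "AE t in lborel. t \<notin> {t \<in> {0..<2*pi}. cis t = p}"
    using fin by (intro AE_not_in finite_imp_null_set_lborel)
  then have "AE t in uniform_measure lborel {0..<2*pi}. cis t \<noteq> p"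
    by (intro AE_uniform_measureI) auto
  then have "AE z in distr (uniform_measure lborel {0..<2*pi}) (restrict_space borel unit_circle) cis. z \<noteq> p"
    by (subst AE_distr_iff)
      (auto simp: measurable_cis sets_restrict_space measurable_cong_sets[OF sets_uniform_measure refl])
  then show ?thesis unfolding circle_measure_def by (rule AE_completion)
qed

lemma AE_circle_notin_finite: "finite P \<Longrightarrow> AE z in circle_measure. z \<notin> P"
proof (induction rule: finite_induct)
  case (insert x F)
  from insert.IH AE_circle_neq[of x] show ?case by eventually_elim auto
qed simp

lemma integral_powi_circle: "(LINT z|circle_measure. z powi n) = (if n = 0 then 1 else 0)"
proof (cases "n = 0")
  case True
  then show ?thesis using circle.prob_space by simp
next
  case False
  have m: "(\<lambda>z::complex. z powi n) \<in> borel_measurable borel"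
    unfolding power_int_def by (cases "n \<ge> 0") auto
  have cm: "(\<lambda>t. cis (of_int n * t)) \<in> borel_measurable borel"
    by (intro borel_measurable_continuous_onI continuous_intros)
  have "(LINT z|circle_measure. z powi n) = (LINT t:{0..<2 * pi}|lborel. cis (of_int n * t)) /\<^sub>R (2 * pi)"
    by (subst integral_circle_measure) (simp_all add: measurable_restrict_space1 m cis_power_int)
  \<comment> \<open>Closing the interval adds one null point and makes the fundamental theorem of
    calculus applicable.\<close>
  also have "(LINT t:{0..<2 * pi}|lborel. cis (of_int n * t))
      = (LINT t|lborel. indicator {0..2 * pi} t *\<^sub>R cis (of_int n * t))"
    unfolding set_lebesgue_integral_def
  proof (rule integral_cong_AE)
    show "AE t in lborel. indicator {0..<2 * pi} t *\<^sub>R cis (of_int n * t)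
        = indicator {0..2 * pi} t *\<^sub>R cis (of_int n * t)"
      using AE_lborel_singleton[of "2 * pi"] by eventually_elim (auto simp: indicator_def)
  qed (use cm in simp_all)
  also have "\<dots> = cis (of_int n * (2*pi)) / (\<i> * of_int n) - cis (of_int n * 0) / (\<i> * of_int n)"
  proof (rule integral_FTC_atLeastAtMost)
    fix x
    show "((\<lambda>t. cis (of_int n * t) / (\<i> * of_int n)) has_vector_derivative cis (of_int n * x)) (at x within {0..2*pi})"
    proof -
      have "((\<lambda>w. exp (\<i> * of_int n * w) / (\<i> * of_int n)) has_field_derivative exp (\<i> * of_int n * of_real x)) (at (of_real x))"
        using False by (auto intro!: derivative_eq_intros)
      from has_vector_derivative_real_field[OF this] show ?thesis by (simp add: cis_conv_exp mult.assoc)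
    qed
  qed (auto intro!: continuous_intros)
  also have "cis (of_int n * (2*pi)) = 1"
    by (metis cis_2pi cis_power_int power_int_1_left)
  finally show ?thesis using False by simp
qed

lemma powi_measurable_circle [measurable]: "(\<lambda>z. z powi n) \<in> borel_measurable circle_measure"
  unfolding power_int_def by (cases "n \<ge> 0") auto

section \<open>Uniqueness of Fourier coefficients\<close>

lemma integrable_mult_bounded:
  fixes F :: "'a \<Rightarrow> complex"
  assumes F: "integrable M F" and g[measurable]: "g \<in> borel_measurable M" and B: "AE z in M. norm (g z) \<le> B"
  shows "integrable M (\<lambda>z. F z * g z)"
proof (rule Bochner_Integration.integrable_bound)
  show "integrable M (\<lambda>z. B * norm (F z))" using F by auto
  show "(\<lambda>z. F z * g z) \<in> borel_measurable M" using F by auto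
  show "AE z in M. norm (F z * g z) \<le> norm (B * norm (F z))"
    using B
  proof eventually_elim
    case (elim z)
    then have "norm (F z) * norm (g z) \<le> norm (F z) * \<bar>B\<bar>" by (intro mult_left_mono) auto
    then show ?case by (simp add: norm_mult abs_mult mult.commute)
  qed
qed

lemma integrable_mult_powi:
  assumes "integrable circle_measure F"
  shows "integrable circle_measure (\<lambda>z. F z * z powi n)"
  using AE_circle_norm
  by (intro integrable_mult_bounded[OF assms, of _ 1]) (auto simp: norm_power_int elim: eventually_mono)

text \<open>The induction keeps \<open>F\<close> arbitrary: the conclusion restates both premises
  for \<open>F\<close> times the polynomial, so for a product the second hypothesis is applied to
  \<open>F\<close> times the first factor. Linear forms only shift the index, being combinations of
  \<open>z\<close> and its inverse on the circle.\<close>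

lemma integral_polynomial_zero:
  assumes "real_polynomial_function q"
  shows "integrable circle_measure F \<Longrightarrow> (\<And>n. (LINT z|circle_measure. F z * z powi n) = 0) \<Longrightarrow>
    integrable circle_measure (\<lambda>z. F z * of_real (q z)) \<and>
    (\<forall>n. (LINT z|circle_measure. F z * of_real (q z) * z powi n) = 0)"
  using assms
proof (induction arbitrary: F rule: real_polynomial_function.induct)
  case (linear q)
  interpret lin: bounded_linear q by fact
  \<comment> \<open>From \<open>Re z = (z + 1/z) / 2\<close> and
    \<open>Im z = (z - 1/z) / (2 * \<i>)\<close> on the circle.\<close>
  define a b where "a = (of_real (q 1) + of_real (q \<i>) / \<i>) / 2" and "b = (of_real (q 1) - of_real (q \<i>) / \<i>) / 2"
  have q: "of_real (q z) = a * z + b * z powi (-1)" if "norm z = 1" for z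
  proof -
    have "q z = q (Re z *\<^sub>R 1 + Im z *\<^sub>R \<i>)"
      by (rule arg_cong[where f = q]) (simp add: complex_eq_iff)
    then have "q z = Re z * q 1 + Im z * q \<i>"
      by (simp add: lin.add lin.scaleR)
    moreover have "z powi (-1) = cnj z"
      using that by (simp add: power_int_minus complex_div_cnj[of 1 z] inverse_eq_divide power2_eq_square)
    moreover have "of_real (Re z * q 1 + Im z * q \<i>) = a * z + b * cnj z"
      by (simp add: a_def b_def complex_eq_iff field_simps)
    ultimately show ?thesis by simp
  qed
  have eq: "AE z in circle_measure. F z * of_real (q z) * z powi n = a * (F z * z powi (n + 1)) + b * (F z * z powi (n - 1))" for n
    using AE_circle_norm
  proof eventually_elim
    case (elim z)
    then have "z \<noteq> 0" by auto
    then have "z powi (n + 1) = z * z powi n" "z powi (n - 1) = z powi (-1) * z powi n"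
      by (simp_all add: power_int_add power_int_diff power_int_minus field_simps)
    then show ?case by (simp only: q[OF elim]) (simp add: algebra_simps)
  qed
  have [measurable]: "q \<in> borel_measurable circle_measure"
    by (rule borel_measurable_circle_measure[OF borel_measurable_continuous_onI[OF linear_continuous_on[OF lin.bounded_linear_axioms]]])
  have [measurable]: "F \<in> borel_measurable circle_measure" using linear by auto
  have int: "integrable circle_measure (\<lambda>z. a * (F z * z powi (n + 1)) + b * (F z * z powi (n - 1)))" for n
    using linear by (intro Bochner_Integration.integrable_add integrable_mult_right integrable_mult_powi) auto
  have 1: "integrable circle_measure (\<lambda>z. F z * of_real (q z) * z powi n)" for n
    by (rule integrable_cong_AE_imp[OF int[of n]]) (use eq[of n] in \<open>auto elim: eventually_mono\<close>)
  have "(LINT z|circle_measure. F z * of_real (q z) * z powi n) = 0" for n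
    using linear by (subst integral_cong_AE[OF _ _ eq]) (auto simp: integrable_mult_powi)
  with 1[of 0] show ?case by simp
next
  case (const c)
  then show ?case using integral_mult_right_zero[of circle_measure "of_real c" "\<lambda>z. F z * z powi n" for n]
    by (auto simp: mult_ac)
next
  case (add f g)
  then have "integrable circle_measure (\<lambda>z. F z * of_real (f z))" "integrable circle_measure (\<lambda>z. F z * of_real (g z))"
     "(LINT z|circle_measure. F z * of_real (f z) * z powi n) = 0" "(LINT z|circle_measure. F z * of_real (g z) * z powi n) = 0" for n
    by blast+
  then show ?case by (simp add: distrib_left distrib_right integrable_mult_powi)
next
  case (mult f g)
  show ?case using mult.IH(1)[OF mult.prems] mult.IH(2)[of "\<lambda>z. F z * of_real (f z)"] by (simp add: mult.assoc)
qed

text \<open>Polynomial functions are uniformly dense on the circle by Stone-Weierstrass, and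
  integration against \<open>F\<close> is continuous for uniform convergence.\<close>

lemma integral_continuous_zero:
  assumes F: "integrable circle_measure F" "\<And>n. (LINT z|circle_measure. F z * z powi n) = 0"
    and q: "continuous_on UNIV (q :: complex \<Rightarrow> real)"
  shows "(LINT z|circle_measure. F z * of_real (q z)) = 0"
proof (rule ccontr)
  let ?I = "(LINT z|circle_measure. F z * of_real (q z))"
  let ?N = "LINT z|circle_measure. norm (F z)"
  have N: "?N + 1 > 0" by (intro add_nonneg_pos integral_nonneg_AE AE_I2) auto
  assume "?I \<noteq> 0"
  \<comment> \<open>Chosen so that \<open>e\<close> times the \<open>L1\<close> norm of
    \<open>F\<close> stays below the supposedly nonzero integral; the 1 keeps the denominator
    positive.\<close>
  define e where "e = norm ?I / (?N + 1)"
  have e: "e > 0" unfolding e_def using \<open>?I \<noteq> 0\<close> N by (intro divide_pos_pos) auto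
  have [measurable]: "F \<in> borel_measurable circle_measure" using F by auto
  have [measurable]: "q \<in> borel_measurable circle_measure"
    using q by (intro borel_measurable_circle_measure borel_measurable_continuous_onI)
  have c: "continuous_on (sphere 0 1) q" using q continuous_on_subset by blast
  obtain p where p: "real_polynomial_function p" "\<And>x. x \<in> sphere 0 1 \<Longrightarrow> \<bar>q x - p x\<bar> < e"
    using Stone_Weierstrass_real_polynomial_function[OF compact_sphere c e] by metis
  note pz = integral_polynomial_zero[OF p(1) F]
  have [measurable]: "p \<in> borel_measurable circle_measure"
    using p(1) by (intro borel_measurable_circle_measure borel_measurable_continuous_onI)
      (simp add: continuous_on_polymonial_function real_polynomial_function_eq)
  have "bounded (q ` sphere 0 1)" by (rule compact_imp_bounded[OF compact_continuous_image[OF c compact_sphere]])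
  then obtain B where B: "\<forall>z\<in>sphere 0 1. \<bar>q z\<bar> \<le> B" by (auto simp: bounded_iff)
  have iq: "integrable circle_measure (\<lambda>z. F z * of_real (q z))"
    using B AE_circle_norm by (intro integrable_mult_bounded[OF F(1), of _ B]) (auto elim!: eventually_mono)
  have "?I = (LINT z|circle_measure. F z * of_real (q z) - F z * of_real (p z))"
    using pz[THEN conjunct1] pz[THEN conjunct2, rule_format, of 0] iq by (subst Bochner_Integration.integral_diff) auto
  also have "norm \<dots> \<le> (LINT z|circle_measure. e * norm (F z))"
  proof (rule Bochner_Integration.integral_norm_bound_integral)
    fix z assume "z \<in> space circle_measure"
    then have "\<bar>q z - p z\<bar> \<le> e" using p(2) by (simp add: less_imp_le)
    then have "norm (F z) * \<bar>q z - p z\<bar> \<le> norm (F z) * e" by (intro mult_left_mono) auto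
    moreover have "F z * of_real (q z) - F z * of_real (p z) = F z * of_real (q z - p z)" by (simp add: algebra_simps)
    ultimately show "norm (F z * of_real (q z) - F z * of_real (p z)) \<le> e * norm (F z)"
      by (simp only: norm_mult norm_of_real mult.commute)
  qed (use F iq pz in auto)
  also have "\<dots> = e * ?N" by simp
  also have "\<dots> < e * (?N + 1)" using e by simp
  also have "\<dots> = norm ?I" using N by (simp add: e_def)
  finally show False by simp
qed

text \<open>The indicator of a closed set is the pointwise limit of the continuous cutoffs
  \<open>max 0 (1 - n * infdist z K)\<close>.\<close>

lemma integral_closed_zero:
  assumes F: "integrable circle_measure F" "\<And>n. (LINT z|circle_measure. F z * z powi n) = 0"
    and K: "closed K"
  shows "(LINT z|circle_measure. indicator K z *\<^sub>R F z) = 0"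
\<comment> \<open>The distance to the empty set is 0 by convention, so for it the cutoffs would be
  constantly 1.\<close>
proof (cases "K = {}")
  case False
  let ?f = "\<lambda>n z. max 0 (1 - real n * infdist z K)"
  have [measurable]: "F \<in> borel_measurable circle_measure" using F by auto
  have [measurable]: "(indicator K :: complex \<Rightarrow> real) \<in> borel_measurable circle_measure"
    using K by (intro borel_measurable_circle_measure) auto
  have c: "continuous_on UNIV (?f n)" for n by (intro continuous_intros)
  have [measurable]: "?f n \<in> borel_measurable circle_measure" for n
    by (intro borel_measurable_circle_measure borel_measurable_continuous_onI c)
  have lim: "(\<lambda>n. ?f n z) \<longlonglongrightarrow> indicator K z" for z
  proof (cases "z \<in> K")
    case True
    then show ?thesis by simp
  next
    case nz: False
    then have d: "infdist z K > 0" using K False infdist_pos_not_in_closed by blast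
    obtain N where N: "1 < real N * infdist z K" using reals_Archimedean3[OF d] by blast
    have "?f n z = 0" if "n \<ge> N" for n
    proof -
      have "real N * infdist z K \<le> real n * infdist z K" using that d by (intro mult_right_mono) auto
      with N show ?thesis by simp
    qed
    then show ?thesis using nz by (intro tendsto_eventually) (auto simp: eventually_sequentially intro: exI[of _ N])
  qed
  have "(\<lambda>n. LINT z|circle_measure. F z * of_real (?f n z)) \<longlonglongrightarrow> (LINT z|circle_measure. indicator K z *\<^sub>R F z)"
  proof (rule integral_dominated_convergence)
    show "integrable circle_measure (\<lambda>z. norm (F z))" using F by auto
    show "AE z in circle_measure. (\<lambda>n. F z * of_real (?f n z)) \<longlonglongrightarrow> indicator K z *\<^sub>R F z"
    proof (rule AE_I2)
      fix z
      have "(\<lambda>n. F z * of_real (?f n z)) \<longlonglongrightarrow> F z * of_real (indicator K z)" by (intro tendsto_intros lim)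
      then show "(\<lambda>n. F z * of_real (?f n z)) \<longlonglongrightarrow> indicator K z *\<^sub>R F z" by (simp add: scaleR_conv_of_real mult.commute)
    qed
    show "AE z in circle_measure. norm (F z * of_real (?f n z)) \<le> norm (F z)" for n
    proof (rule AE_I2)
      fix z
      have "\<bar>?f n z\<bar> \<le> 1" using infdist_nonneg[of z K] by (auto simp: max_def)
      then have "norm (F z) * \<bar>?f n z\<bar> \<le> norm (F z) * 1" by (rule mult_left_mono) simp
      then show "norm (F z * of_real (?f n z)) \<le> norm (F z)" by (simp only: norm_mult norm_of_real mult_1_right)
    qed
  qed (use K in auto)
  then show ?thesis
    using integral_continuous_zero[OF F c] by (simp add: LIMSEQ_const_iff)
qed simp

text \<open>Closed sets are stable under intersection and generate the Borel sets, while the sets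
  over which \<open>F\<close> integrates to 0 form a Dynkin system; the whole circle belongs to it
  by the premise with \<open>n = 0\<close>.\<close>

lemma integral_borel_zero:
  assumes F: "integrable circle_measure F" "\<And>n. (LINT z|circle_measure. F z * z powi n) = 0"
    and A: "A \<in> sets borel"
  shows "(LINT z|circle_measure. indicator A z *\<^sub>R F z) = 0"
proof -
  have [measurable]: "F \<in> borel_measurable circle_measure" using F by auto
  have ind: "integrable circle_measure (\<lambda>z. indicator A z *\<^sub>R F z)" if "A \<in> sets borel" for A
  proof -
    have "(indicator A :: complex \<Rightarrow> real) \<in> borel_measurable circle_measure" using that by (intro borel_measurable_circle_measure) auto
    then have "(\<lambda>z. indicator A z *\<^sub>R F z) \<in> borel_measurable circle_measure"
      by (rule borel_measurable_scaleR) fact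
    then show ?thesis
      by (rule Bochner_Integration.integrable_bound[OF F(1)]) (auto intro!: AE_I2 simp: indicator_def)
  qed
  have S: "sets borel = sigma_sets UNIV (Collect closed :: complex set set)"
    unfolding borel_eq_closed by (rule sets_measure_of) auto
  have tot: "(LINT z|circle_measure. F z) = 0" using F(2)[of 0] by simp
  have "Int_stable (Collect closed :: complex set set)" "Collect closed \<subseteq> Pow (UNIV :: complex set)"
    "A \<in> sigma_sets UNIV (Collect closed)"
    using A S by (auto simp: Int_stable_def)
  then show ?thesis
  proof (induction rule: sigma_sets_induct_disjoint)
    case empty
    show ?case by simp
  next
    case (basic K)
    then show ?case using integral_closed_zero[OF F] by auto
  next
    case (compl A)
    then have A: "A \<in> sets borel" using S by simp
    have "(LINT z|circle_measure. indicator (UNIV - A) z *\<^sub>R F z) = (LINT z|circle_measure. F z - indicator A z *\<^sub>R F z)"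
      by (intro Bochner_Integration.integral_cong) (auto simp: indicator_def)
    also have "\<dots> = 0" using compl tot F ind[OF A] by (subst Bochner_Integration.integral_diff) auto
    finally show ?case .
  next
    case (union A)
    then have A: "A i \<in> sets borel" for i using S by auto
    have "(\<lambda>n. LINT z|circle_measure. indicator (\<Union>i<n. A i) z *\<^sub>R F z) \<longlonglongrightarrow> (LINT z|circle_measure. indicator (\<Union>i. A i) z *\<^sub>R F z)"
    proof (rule integral_dominated_convergence)
      show "integrable circle_measure (\<lambda>z. norm (F z))" using F by auto
      show "AE z in circle_measure. (\<lambda>n. indicator (\<Union>i<n. A i) z *\<^sub>R F z) \<longlonglongrightarrow> indicator (\<Union>i. A i) z *\<^sub>R F z"
        by (intro AE_I2 tendsto_scaleR LIMSEQ_indicator_UN tendsto_const)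
      show "AE z in circle_measure. norm (indicator (\<Union>i<n. A i) z *\<^sub>R F z) \<le> norm (F z)" for n
        by (auto simp: indicator_def)
    next
      have U: "(\<Union>i<n. A i) \<in> sets borel" "(\<Union>i. A i) \<in> sets borel" for n
        using A by auto
      show "(\<lambda>z. indicator (\<Union>i. A i) z *\<^sub>R F z) \<in> borel_measurable circle_measure"
        "(\<lambda>z. indicator (\<Union>i<n. A i) z *\<^sub>R F z) \<in> borel_measurable circle_measure" for n
        using ind[OF U(1)] ind[OF U(2)] by (auto intro: borel_measurable_integrable)
    qed
    moreover have "(LINT z|circle_measure. indicator (\<Union>i<n. A i) z *\<^sub>R F z) = 0" for n
    proof (induction n)
      case (Suc n)
      have "(LINT z|circle_measure. indicator (\<Union>i<Suc n. A i) z *\<^sub>R F z)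
          = (LINT z|circle_measure. indicator (\<Union>i<n. A i) z *\<^sub>R F z + indicator (A n) z *\<^sub>R F z)"
      proof (intro Bochner_Integration.integral_cong refl)
        fix z
        have "A i \<inter> A n = {}" if "i < n" for i
          using union(1) that by (simp add: disjoint_family_on_def)
        then have "(\<Union>i<n. A i) \<inter> A n = {}" by blast
        moreover have "(\<Union>i<Suc n. A i) = (\<Union>i<n. A i) \<union> A n" by (auto simp: less_Suc_eq)
        ultimately show "indicator (\<Union>i<Suc n. A i) z *\<^sub>R F z = indicator (\<Union>i<n. A i) z *\<^sub>R F z + indicator (A n) z *\<^sub>R F z"
          by (auto simp: indicator_def)
      qed
      also have "\<dots> = 0" using Suc union(3) A ind by (subst Bochner_Integration.integral_add) auto
      finally show ?case .
    qed simp
    ultimately show ?case by (simp add: LIMSEQ_const_iff)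
  qed
qed

text \<open>In the completed measure a measurable set is Borel only up to a null set. After this
  replacement \<open>F\<close> integrates to 0 over every measurable set, which determines its real
  and imaginary parts almost everywhere.\<close>

lemma fourier_zero_imp_AE_zero:
  assumes F: "integrable circle_measure F" "\<And>n. (LINT z|circle_measure. F z * z powi n) = 0"
  shows "AE z in circle_measure. F z = 0"
proof -
  have meas: "F \<in> borel_measurable circle_measure" using F by auto
  have z: "(LINT z|circle_measure. indicator A z *\<^sub>R F z) = 0" if A: "A \<in> sets circle_measure" for A
  proof -
    let ?D = "distr (uniform_measure lborel {0..<2 * pi}) (restrict_space borel unit_circle) cis"
    have "A \<in> sets (completion ?D)" using A by (simp add: circle_measure_def)
    then obtain S N N' where S: "A = S \<union> N" "N \<subseteq> N'" "N' \<in> null_sets ?D" "S \<in> sets ?D" by (rule sets_completionE)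
    have "N' \<in> null_sets circle_measure" unfolding circle_measure_def using S by (intro null_sets_completionI)
    then have ae: "AE z in circle_measure. z \<notin> N'" by (rule AE_not_in)
    have Sb: "S \<in> sets borel" using S(4) by (auto simp: sets_restrict_space)
    have mi: "(indicator B :: complex \<Rightarrow> real) \<in> borel_measurable circle_measure" if "B \<in> sets circle_measure" for B
      using that by simp
    have SM: "S \<in> sets circle_measure" using S(4) unfolding circle_measure_def by (rule sets_completionI_sets)
    have "(LINT z|circle_measure. indicator A z *\<^sub>R F z) = (LINT z|circle_measure. indicator S z *\<^sub>R F z)"
    proof (intro integral_cong_AE borel_measurable_scaleR mi A SM meas)
      show "AE z in circle_measure. indicator A z *\<^sub>R F z = indicator S z *\<^sub>R F z"
        using ae by eventually_elim (use S(1,2) in \<open>auto simp: indicator_def\<close>)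
    qed
    also have "\<dots> = 0" by (rule integral_borel_zero[OF F Sb])
    finally show ?thesis .
  qed
  have ii: "integrable circle_measure (\<lambda>z. indicator A z *\<^sub>R F z)" if "A \<in> sets circle_measure" for A
    using that F by (intro integrable_mult_indicator)
  have "AE z in circle_measure. Re (F z) = 0"
  proof (rule density_unique_real)
    fix A assume A: "A \<in> sets circle_measure"
    show "(LINT z:A|circle_measure. Re (F z)) = (LINT z:A|circle_measure. 0)"
      using z[OF A] integral_Re[OF ii[OF A]] by (simp add: set_lebesgue_integral_def)
  qed (use F in auto)
  moreover have "AE z in circle_measure. Im (F z) = 0"
  proof (rule density_unique_real)
    fix A assume A: "A \<in> sets circle_measure"
    show "(LINT z:A|circle_measure. Im (F z)) = (LINT z:A|circle_measure. 0)"
      using z[OF A] integral_Im[OF ii[OF A]] by (simp add: set_lebesgue_integral_def)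
  qed (use F in auto)
  ultimately show ?thesis by eventually_elim (simp add: complex_eq_iff)
qed

section \<open>Termwise integration of series\<close>

lemma continuous_on_circle_measurable:
  "continuous_on unit_circle f \<Longrightarrow> (f :: complex \<Rightarrow> 'b::topological_space) \<in> borel_measurable circle_measure"
  unfolding circle_measure_def
  by (rule measurable_completion) (simp add: borel_measurable_continuous_on_restrict)

text \<open>Meant for the Herglotz kernel, which is unbounded on the circle but bounded on the
  support of a function vanishing near its pole.\<close>

lemma integrable_mult_bounded_support:
  fixes F :: "'a \<Rightarrow> complex"
  assumes F: "integrable M F" and g[measurable]: "g \<in> borel_measurable M"
    and B: "AE z in M. F z = 0 \<or> norm (g z) \<le> B"
  shows "integrable M (\<lambda>z. F z * g z)"
proof -
  have [measurable]: "F \<in> borel_measurable M" using F by auto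
  have "integrable M (\<lambda>z. F z * (if F z = 0 then 0 else g z))"
    using B by (intro integrable_mult_bounded[OF F, of _ "\<bar>B\<bar>"]) (auto elim!: eventually_mono)
  also have "(\<lambda>z. F z * (if F z = 0 then 0 else g z)) = (\<lambda>z. F z * g z)" by auto
  finally show ?thesis .
qed

text \<open>The one interchange of sum and integral behind the coefficients of power series, the
  expansion of the Herglotz transform, Parseval's identity and multiplication in \<open>H2\<close>;
  only \<open>G\<close> and \<open>e\<close> change.\<close>

lemma sums_integral_mult:
  fixes G :: "'a \<Rightarrow> complex"
  assumes G: "integrable M G" and b: "summable (\<lambda>n. norm (b n))"
    and e[measurable]: "\<And>n::nat. e n \<in> borel_measurable M" and e1: "\<And>n. AE z in M. norm (e n z) \<le> 1"
    and S: "AE z in M. (\<lambda>n. b n * e n z) sums S z" and [measurable]: "S \<in> borel_measurable M"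
  shows "(\<lambda>n. b n * (LINT z|M. G z * e n z)) sums (LINT z|M. G z * S z)"
proof -
  have [measurable]: "G \<in> borel_measurable M" using G by auto
  have ie: "integrable M (\<lambda>z. G z * e n z)" for n by (rule integrable_mult_bounded[OF G e e1])
  have ie': "integrable M (\<lambda>z. b n * (G z * e n z))" for n using ie by auto
  have le: "AE z in M. norm (b n * (G z * e n z)) \<le> norm (b n) * norm (G z)" for n
    using e1[of n] by eventually_elim (auto simp: norm_mult intro!: mult_left_mono mult_left_le)
  have 1: "AE z in M. \<forall>n. norm (e n z) \<le> 1" using e1 by (subst AE_all_countable) auto
  have "(\<lambda>n. LINT z|M. b n * (G z * e n z)) sums (LINT z|M. (\<Sum>n. b n * (G z * e n z)))"
  proof (rule sums_integral[OF ie'])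
    show "AE z in M. summable (\<lambda>n. norm (b n * (G z * e n z)))"
      using 1
    proof eventually_elim
      case (elim z)
      show ?case
      proof (rule summable_comparison_test'[OF summable_mult2[OF b, of "norm (G z)"]])
        fix n
        show "norm (norm (b n * (G z * e n z))) \<le> norm (b n) * norm (G z)"
          using elim[rule_format, of n] by (auto simp: norm_mult intro!: mult_left_mono mult_left_le)
      qed
    qed
    show "summable (\<lambda>n. LINT z|M. norm (b n * (G z * e n z)))"
    proof (rule summable_comparison_test'[OF summable_mult2[OF b, of "LINT z|M. norm (G z)"]])
      fix n
      have "(LINT z|M. norm (b n * (G z * e n z))) \<le> (LINT z|M. norm (b n) * norm (G z))"
        using le[of n] G ie'[of n] by (intro integral_mono_AE) auto
      moreover have "0 \<le> (LINT z|M. norm (b n * (G z * e n z)))" by (intro integral_nonneg_AE AE_I2) auto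
      ultimately show "norm (LINT z|M. norm (b n * (G z * e n z))) \<le> norm (b n) * (LINT z|M. norm (G z))" by simp
    qed
  qed
  moreover have "(LINT z|M. (\<Sum>n. b n * (G z * e n z))) = (LINT z|M. G z * S z)"
  proof (rule integral_cong_AE)
    show "AE z in M. (\<Sum>n. b n * (G z * e n z)) = G z * S z"
      using S
    proof eventually_elim
      case (elim z)
      have "(\<lambda>n. G z * (b n * e n z)) sums (G z * S z)" by (rule sums_mult[OF elim])
      then show ?case by (auto simp: sums_iff mult_ac)
    qed
  qed auto
  ultimately show ?thesis by simp
qed

lemma power_series_fourier:
  assumes b: "summable (\<lambda>n. norm (b n))" and S: "AE z in circle_measure. (\<lambda>n. b n * z ^ n) sums S z"
    and [measurable]: "S \<in> borel_measurable circle_measure"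
  shows "(LINT z|circle_measure. S z * z powi (- m)) = (if m \<ge> 0 then b (nat m) else 0)"
proof -
  have "integrable circle_measure (\<lambda>z. 1 * z powi (-m))" by (rule integrable_mult_powi) simp
  then have i: "integrable circle_measure (\<lambda>z. z powi (-m))" by simp
  have "(\<lambda>n. b n * (LINT z|circle_measure. z powi (-m) * z ^ n)) sums (LINT z|circle_measure. z powi (-m) * S z)"
    using AE_circle_norm
    by (intro sums_integral_mult i b S) (auto simp: norm_power elim!: eventually_mono)
  moreover have "(LINT z|circle_measure. z powi (-m) * z ^ n) = (if int n = m then 1 else 0)" for n
  proof -
    have "AE z in circle_measure. z powi (-m) * z ^ n = z powi (int n - m)"
      using AE_circle_norm
    proof eventually_elim
      case (elim z)
      then have "z \<noteq> 0" by auto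
      then show ?case by (simp add: power_int_diff power_int_minus field_simps)
    qed
    then have "(LINT z|circle_measure. z powi (-m) * z ^ n) = (LINT z|circle_measure. z powi (int n - m))"
      by (intro integral_cong_AE) auto
    then show ?thesis by (simp add: integral_powi_circle)
  qed
  ultimately have "(\<lambda>n. b n * (if int n = m then 1 else 0)) sums (LINT z|circle_measure. z powi (-m) * S z)" by simp
  moreover have "(\<lambda>n. b n * (if int n = m then 1 else 0)) sums (if m \<ge> 0 then b (nat m) else 0)"
  proof (cases "m \<ge> 0")
    case True
    then have "(\<lambda>n. b n * (if int n = m then 1 else 0)) = (\<lambda>n. if n = nat m then b n else 0)"
      by (intro ext) auto
    then show ?thesis using True sums_single[of "nat m" b] by simp
  next
    case False
    then have "(\<lambda>n. b n * (if int n = m then 1 else 0)) = (\<lambda>n. 0)" by auto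
    then show ?thesis using False by simp
  qed
  ultimately show ?thesis by (simp add: sums_unique2 mult.commute)
qed

section \<open>The Herglotz transform\<close>

text \<open>The Herglotz kernel: for \<open>s\<close> on the circle and \<open>w\<close> in the disc
  its real part is the Poisson kernel; with both on the circle it is purely imaginary.\<close>

definition herg :: "complex \<Rightarrow> complex \<Rightarrow> complex" where "herg s w = (s + w) / (s - w)"

definition herglotz :: "(complex \<Rightarrow> complex) \<Rightarrow> complex \<Rightarrow> complex" where
  "herglotz F w = (LINT s|circle_measure. F s * herg s w)"

lemma herg_measurable [measurable]:
  "f \<in> borel_measurable M \<Longrightarrow> g \<in> borel_measurable M \<Longrightarrow> (\<lambda>x. herg (f x) (g x)) \<in> borel_measurable M"
  unfolding herg_def by (intro borel_measurable_divide borel_measurable_add borel_measurable_diff)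

text \<open>Taylor coefficients of \<open>(1 + x) / (1 - x)\<close>, where \<open>x = w / s\<close>
  in the kernel.\<close>

abbreviation herg_coeff :: "nat \<Rightarrow> complex" where "herg_coeff n \<equiv> if n = 0 then 1 else 2"

lemma herg_sums:
  assumes "norm s = 1" "norm w < 1"
  shows "(\<lambda>n. herg_coeff n * w ^ n * s powi (- int n)) sums herg s w"
proof -
  have s: "s \<noteq> 0" using assms by auto
  have "norm (w / s) < 1" using assms by (simp add: norm_divide)
  then have "(\<lambda>n. 2 * (w / s) ^ n - (if n = 0 then 1 else 0)) sums (2 * (1 / (1 - w / s)) - 1)"
    by (intro sums_diff sums_mult geometric_sums sums_single[of 0 "\<lambda>_. 1", simplified])
  moreover have "2 * (w / s) ^ n - (if n = 0 then 1 else 0) = herg_coeff n * w ^ n * s powi (- int n)" for n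
    by (simp add: power_int_minus field_simps)
  moreover have "s \<noteq> w" using assms by auto
  then have "2 * (1 / (1 - w / s)) - 1 = herg s w"
    using s by (simp add: herg_def field_simps)
  ultimately show ?thesis by simp
qed

lemma norm_herg_le:
  assumes "norm s = 1" "0 < d" "d \<le> norm (s - w)"
  shows "norm (herg s w) \<le> (1 + norm w) / d"
proof -
  have "norm (s + w) \<le> 1 + norm w" using norm_triangle_ineq[of s w] assms by simp
  then show ?thesis unfolding herg_def norm_divide using assms by (intro frac_le) auto
qed

lemma summable_herg_coeff:
  assumes F: "integrable circle_measure F" and r: "norm (r :: complex) < 1"
  shows "summable (\<lambda>n. norm (herg_coeff n * r ^ n * fourier_coeff F (int n)))"
proof (rule summable_comparison_test'[of "\<lambda>n. 2 * (LINT z|circle_measure. norm (F z)) * norm r ^ n"])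
  show "summable (\<lambda>n. 2 * (LINT z|circle_measure. norm (F z)) * norm r ^ n)"
    using r by (intro summable_mult summable_geometric) auto
  fix n
  have "norm (fourier_coeff F (int n)) \<le> (LINT z|circle_measure. norm (F z))"
    unfolding fourier_coeff_def
  proof (rule Bochner_Integration.integral_norm_bound_integral)
    show "integrable circle_measure (\<lambda>z. F z * z powi - int n)" by (rule integrable_mult_powi[OF F])
  qed (use F in \<open>auto simp: norm_mult norm_power_int\<close>)
  then have "norm (herg_coeff n) * norm r ^ n * norm (fourier_coeff F (int n)) \<le> 2 * norm r ^ n * (LINT z|circle_measure. norm (F z))"
    by (intro mult_mono) auto
  then show "norm (norm (herg_coeff n * r ^ n * fourier_coeff F (int n))) \<le> 2 * (LINT z|circle_measure. norm (F z)) * norm r ^ n"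
    by (simp add: norm_mult norm_power mult_ac)
qed

lemma herglotz_sums:
  assumes F: "integrable circle_measure F" and w: "norm w < 1"
  shows "(\<lambda>n. herg_coeff n * fourier_coeff F (int n) * w ^ n) sums herglotz F w"
proof -
  have "summable (\<lambda>n. 2 * norm w ^ n)" using w by (intro summable_mult summable_geometric) auto
  then have s: "summable (\<lambda>n. norm (herg_coeff n * w ^ n))"
    by (rule summable_comparison_test') (auto simp: norm_mult norm_power)
  have "(\<lambda>n. herg_coeff n * w ^ n * (LINT z|circle_measure. F z * z powi (- int n))) sums (LINT z|circle_measure. F z * herg z w)"
  proof (rule sums_integral_mult[OF F s])
    show "AE z in circle_measure. (\<lambda>n. herg_coeff n * w ^ n * z powi (- int n)) sums herg z w"
      using AE_circle_norm by eventually_elim (rule herg_sums[OF _ w])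
    show "AE z in circle_measure. norm (z powi (- int n)) \<le> 1" for n
      using AE_circle_norm by eventually_elim (auto simp: norm_power_int)
  qed auto
  then show ?thesis unfolding herglotz_def fourier_coeff_def by (simp add: mult_ac)
qed

lemma integrable_herglotz:
  assumes F: "integrable circle_measure F" and d: "d > 0" "AE s in circle_measure. F s = 0 \<or> d \<le> norm (s - w)"
  shows "integrable circle_measure (\<lambda>s. F s * herg s w)"
  using d(2) AE_circle_norm norm_herg_le[OF _ d(1), of _ w]
  by (intro integrable_mult_bounded_support[OF F, of _ "(1 + norm w) / d"]) (auto elim!: eventually_elim2)

text \<open>The premise asks for a positive distance from \<open>w\<close> to the support of
  \<open>F\<close>, not for \<open>w\<close> in the disc; it thus covers the exterior and those
  points of the circle near which \<open>F\<close> vanishes.\<close>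

lemma herglotz_has_field_derivative:
  assumes F: "integrable circle_measure F" and d: "d > 0" "AE s in circle_measure. F s = 0 \<or> d \<le> norm (s - w)"
  shows "(herglotz F has_field_derivative (LINT s|circle_measure. F s * (2 * s / (s - w)\<^sup>2))) (at w)"
proof -
  have [measurable]: "F \<in> borel_measurable circle_measure" using F by auto
  let ?D = "LINT s|circle_measure. F s * (2 * s / (s - w)\<^sup>2)"
  let ?N = "LINT s|circle_measure. norm (F s)"
  have iD: "integrable circle_measure (\<lambda>s. F s * (2 * s / (s - w)\<^sup>2))"
  proof (rule integrable_mult_bounded_support[OF F, of _ "2 / d\<^sup>2"])
    show "AE s in circle_measure. F s = 0 \<or> norm (2 * s / (s - w)\<^sup>2) \<le> 2 / d\<^sup>2"
      using d(2) AE_circle_norm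
    proof eventually_elim
      case (elim s)
      show ?case
      proof (cases "F s = 0")
        case False
        then have le: "d \<le> norm (s - w)" using elim by simp
        then have "d\<^sup>2 \<le> (norm (s - w))\<^sup>2" using d by (intro power_mono) auto
        moreover have "0 < norm (s - w)" using d le by linarith
        ultimately have "2 / (norm (s - w))\<^sup>2 \<le> 2 / d\<^sup>2" using d by (intro divide_left_mono mult_pos_pos zero_less_power) auto
        then show ?thesis using elim by (simp add: norm_divide norm_mult norm_power)
      qed simp
    qed
  qed auto
  \<comment> \<open>Within \<open>d / 2\<close> of \<open>w\<close> the distance to the support is
    still at least \<open>d / 2\<close>. The remainder is exactly
    \<open>2 * s * (x - w) / ((s - x) * (s - w)\<^sup>2)\<close>, whence the constant
    \<open>2 / (d / 2 * d\<^sup>2)\<close>.\<close>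
  have key: "norm ((herglotz F x - herglotz F w) / (x - w) - ?D) \<le> norm (x - w) * (4 / d ^ 3 * ?N)"
    if x: "x \<noteq> w" "dist x w < d / 2" for x
  proof -
    have d2: "AE s in circle_measure. F s = 0 \<or> d / 2 \<le> norm (s - x)"
      using d(2)
    proof eventually_elim
      case (elim s)
      then show ?case using norm_triangle_ineq[of "s - x" "x - w"] x(2) by (auto simp: dist_norm)
    qed
    have ix: "integrable circle_measure (\<lambda>s. F s * herg s x)" using d d2 by (intro integrable_herglotz[OF F, of "d/2"]) auto
    have iw: "integrable circle_measure (\<lambda>s. F s * herg s w)" using d by (intro integrable_herglotz[OF F, of "d"]) auto
    have i: "integrable circle_measure (\<lambda>s. (F s * herg s x - F s * herg s w) / (x - w) - F s * (2 * s / (s - w)\<^sup>2))"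
      using ix iw iD by auto
    have "(herglotz F x - herglotz F w) / (x - w) - ?D
        = (LINT s|circle_measure. (F s * herg s x - F s * herg s w) / (x - w) - F s * (2 * s / (s - w)\<^sup>2))"
      using ix iw iD by (simp add: herglotz_def)
    also have "norm \<dots> \<le> (LINT s|circle_measure. norm (x - w) * (4 / d ^ 3) * norm (F s))"
    proof (rule order_trans[OF integral_norm_bound], rule integral_mono_AE)
      show "AE s in circle_measure. norm ((F s * herg s x - F s * herg s w) / (x - w) - F s * (2 * s / (s - w)\<^sup>2))
        \<le> norm (x - w) * (4 / d ^ 3) * norm (F s)"
        using d(2) d2 AE_circle_norm
      proof eventually_elim
        case (elim s)
        show ?case
        proof (cases "F s = 0")
          case False
          then have le: "d \<le> norm (s - w)" "d / 2 \<le> norm (s - x)" using elim by auto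
          then have ne: "s - w \<noteq> 0" "s - x \<noteq> 0" "x - w \<noteq> 0" using d x by auto
          have "(herg s x - herg s w) / (x - w) - 2 * s / (s - w)\<^sup>2 = 2 * s * (x - w) / ((s - x) * (s - w)\<^sup>2)"
            using ne unfolding herg_def by (simp add: divide_simps power2_eq_square) (simp add: algebra_simps)
          then have "(F s * herg s x - F s * herg s w) / (x - w) - F s * (2 * s / (s - w)\<^sup>2)
              = F s * (2 * s * (x - w) / ((s - x) * (s - w)\<^sup>2))"
            by (metis (no_types, lifting) right_diff_distrib times_divide_eq_right)
          also have "norm \<dots> = norm (F s) * (2 * norm (x - w) / (norm (s - x) * norm (s - w) ^ 2))"
            using elim by (simp add: norm_mult norm_divide norm_power)
          also have "\<dots> \<le> norm (F s) * (2 * norm (x - w) / (d / 2 * d ^ 2))"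
            using le d ne by (intro mult_left_mono divide_left_mono mult_mono power_mono mult_pos_pos) auto
          also have "\<dots> = norm (x - w) * (4 / d ^ 3) * norm (F s)" using d by (simp add: field_simps power3_eq_cube power2_eq_square)
          finally show ?thesis .
        qed simp
      qed
    qed (use i F in auto)
    also have "\<dots> = norm (x - w) * (4 / d ^ 3 * ?N)" by simp
    finally show ?thesis .
  qed
  have "((\<lambda>x. (herglotz F x - herglotz F w) / (x - w) - ?D) \<longlongrightarrow> 0) (at w)"
  proof (rule Lim_null_comparison)
    show "\<forall>\<^sub>F x in at w. norm ((herglotz F x - herglotz F w) / (x - w) - ?D) \<le> norm (x - w) * (4 / d ^ 3 * ?N)"
      unfolding eventually_at using d key by (intro exI[of _ "d / 2"]) auto
    have "((\<lambda>x. norm (x - w) * (4 / d ^ 3 * ?N)) \<longlongrightarrow> norm (w - w) * (4 / d ^ 3 * ?N)) (at w)"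
      by (intro tendsto_intros)
    then show "((\<lambda>x. norm (x - w) * (4 / d ^ 3 * ?N)) \<longlongrightarrow> 0) (at w)" by simp
  qed
  then show ?thesis unfolding has_field_derivative_iff by (rule LIM_zero_cancel)
qed

lemma herglotz_measurable_circle:
  assumes F: "integrable circle_measure F" and r: "0 \<le> r" "r < 1"
  shows "(\<lambda>z. herglotz F (of_real r * z)) \<in> borel_measurable circle_measure"
proof (rule continuous_on_circle_measurable)
  have "continuous_on (ball 0 1) (herglotz F)"
  proof (rule continuous_at_imp_continuous_on, rule ballI)
    fix w :: complex assume w: "w \<in> ball 0 1"
    have "AE s in circle_measure. F s = 0 \<or> 1 - norm w \<le> norm (s - w)"
      using AE_circle_norm
    proof eventually_elim
      case (elim s)
      then show ?case using norm_triangle_ineq2[of s w] by simp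
    qed
    then show "isCont (herglotz F) w"
      using herglotz_has_field_derivative[OF F, of "1 - norm w"] w by (auto intro: DERIV_isCont)
  qed
  then show "continuous_on unit_circle (\<lambda>z. herglotz F (of_real r * z))"
    by (rule continuous_on_compose2) (use r in \<open>auto intro!: continuous_intros simp: norm_mult\<close>)
qed

text \<open>Values in the disc reveal only the coefficients of index at least 0; the others are
  reached by reflection.\<close>

lemma herglotz_fourier:
  assumes F: "integrable circle_measure F" and r: "0 \<le> r" "r < 1"
  shows "fourier_coeff (\<lambda>z. herglotz F (of_real r * z)) m
    = (if m \<ge> 0 then herg_coeff (nat m) * of_real r ^ nat m * fourier_coeff F m else 0)"
proof -
  have "(LINT z|circle_measure. herglotz F (of_real r * z) * z powi (- m)) =
    (if m \<ge> 0 then herg_coeff (nat m) * of_real r ^ nat m * fourier_coeff F (int (nat m)) else 0)"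
  proof (rule power_series_fourier)
    show "summable (\<lambda>n. norm (herg_coeff n * of_real r ^ n * fourier_coeff F (int n)))"
      using r by (intro summable_herg_coeff[OF F]) auto
    show "AE z in circle_measure. (\<lambda>n. herg_coeff n * of_real r ^ n * fourier_coeff F (int n) * z ^ n) sums herglotz F (of_real r * z)"
      using AE_circle_norm
    proof eventually_elim
      case (elim z)
      then show ?case using herglotz_sums[OF F, of "of_real r * z"] r
        by (simp add: norm_mult power_mult_distrib mult_ac)
    qed
  qed (rule herglotz_measurable_circle[OF F r])
  then show ?thesis by (simp add: fourier_coeff_def)
qed

section \<open>Reflection in the circle and continuation across a gap\<close>

lemma herg_reflect:
  assumes "norm s = 1" "w \<noteq> 0"
  shows "herg s w = - cnj (herg s (1 / cnj w))"
proof (cases "s = w")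
  case False
  have s: "cnj s = 1 / s" using assms(1)
    by (metis complex_div_cnj mult_1 of_real_1 divide_divide_eq_right power_one div_by_1 complex_cnj_cnj nonzero_eq_divide_eq complex_norm_square mult.commute norm_zero zero_neq_one)
  have "s \<noteq> 0" using assms by auto
  moreover have "w - s \<noteq> 0" "s - w \<noteq> 0" using False by auto
  ultimately show ?thesis using assms unfolding herg_def by (simp add: s divide_simps) (simp add: algebra_simps)
next
  \<comment> \<open>Inversion fixes the pole, and both sides are 0 because division by 0 gives
    0.\<close>
  case True
  then have "1 / cnj w = s" using assms by (metis complex_div_cnj mult_1 of_real_1 power_one div_by_1 divide_divide_eq_right complex_cnj_cnj nonzero_eq_divide_eq complex_norm_square mult.commute norm_zero zero_neq_one)
  then show ?thesis using True by (simp add: herg_def)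
qed

text \<open>Inversion exchanges disc and exterior, so the coefficients of \<open>F\<close> of
  negative index can be read off from its transform outside the disc.\<close>

lemma herglotz_reflect:
  assumes "w \<noteq> 0"
  shows "herglotz (\<lambda>s. cnj (F s)) w = - cnj (herglotz F (1 / cnj w))"
proof -
  have "herglotz (\<lambda>s. cnj (F s)) w = (LINT s|circle_measure. - cnj (F s * herg s (1 / cnj w)))"
    unfolding herglotz_def
    using herg_reflect[OF _ assms] by (intro Bochner_Integration.integral_cong) auto
  then show ?thesis unfolding herglotz_def by (simp add: integral_cnj[symmetric] del: complex_cnj_mult)
qed

lemma fourier_coeff_cnj: "fourier_coeff (\<lambda>s. cnj (F s)) m = cnj (fourier_coeff F (- m))"
  unfolding fourier_coeff_def Bochner_Integration.integral_cnj[symmetric]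
proof (rule Bochner_Integration.integral_cong[OF refl])
  fix z :: complex assume "z \<in> space circle_measure"
  then have "norm z = 1" by simp
  then have "cnj (z powi m) = z powi (- m)"
    by (metis complex_cnj_power_int complex_mod_cnj complex_norm_square mult.commute norm_one of_real_1 one_power2 power_int_minus power_int_inverse nonzero_eq_divide_eq inverse_unique)
  then show "cnj (F z) * z powi - m = cnj (F z * z powi - (- m))" by simp
qed

text \<open>The Herglotz transform of a function vanishing near \<open>t0\<close> continues analytically from the disc
  through \<open>t0\<close> to the exterior of the disc.\<close>
lemma herglotz_zeros_imp_AE_zero:
  fixes t0 :: complex
  assumes F: "integrable circle_measure F" and t0: "norm t0 = 1" and r: "r > 0"
    and F0: "AE s in circle_measure. s \<in> ball t0 r \<longrightarrow> F s = 0"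
    and Z: "Z \<subseteq> ball 0 1 \<union> ball t0 r \<union> {w. norm w > 1}" "\<And>w. w \<in> Z \<Longrightarrow> herglotz F w = 0"
    and l: "l \<in> ball 0 1 \<union> ball t0 r \<union> {w. norm w > 1}" "l islimpt Z"
  shows "AE s in circle_measure. F s = 0"
proof -
  define \<Omega> where "\<Omega> = ball 0 1 \<union> ball t0 r \<union> {w::complex. norm w > 1}"
  have ext: "{w::complex. norm w > 1} = - cball 0 1" by auto
  have open\<Omega>: "open \<Omega>" unfolding \<Omega>_def ext by (intro open_Un) auto
  \<comment> \<open>The points \<open>(1 - \<delta>) * t0\<close> and
    \<open>(1 + \<delta>) * t0\<close> then lie in the overlaps of the three regions, which makes
    the union connected.\<close>
  define \<delta> where "\<delta> = min r 1 / 2"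
  have \<delta>: "0 < \<delta>" "\<delta> < r" "\<delta> < 1" using r by (auto simp: \<delta>_def)
  have i1: "(1 - of_real \<delta>) * t0 \<in> ball 0 1 \<inter> ball t0 r"
  proof -
    have "norm (1 - of_real \<delta> :: complex) = 1 - \<delta>" using \<delta> by (metis abs_of_pos diff_gt_0_iff_gt norm_of_real of_real_1 of_real_diff)
    moreover have "dist t0 ((1 - of_real \<delta>) * t0) = \<delta>" using \<delta> t0 by (simp add: dist_norm algebra_simps norm_mult)
    ultimately show ?thesis using \<delta> t0 by (simp add: norm_mult)
  qed
  have i2: "(1 + of_real \<delta>) * t0 \<in> ball t0 r \<inter> {w. norm w > 1}"
  proof -
    have "norm (1 + of_real \<delta> :: complex) = 1 + \<delta>" using \<delta> by (metis abs_of_pos add_pos_pos norm_of_real of_real_1 of_real_add zero_less_one)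
    moreover have "dist t0 ((1 + of_real \<delta>) * t0) = \<delta>" using \<delta> t0 by (simp add: dist_norm algebra_simps norm_mult)
    ultimately show ?thesis using \<delta> t0 by (simp add: norm_mult)
  qed
  have "connected {w::complex. norm w > 1}"
    unfolding ext by (intro connected_complement_bounded_convex) auto
  moreover have "ball 0 1 \<inter> ball t0 r \<noteq> {}" using i1 by blast
  moreover have "(ball 0 1 \<union> ball t0 r) \<inter> {w. norm w > 1} \<noteq> {}" using i2 by blast
  ultimately have conn: "connected \<Omega>" unfolding \<Omega>_def
    by (intro connected_Un connected_ball)
  have hol: "herglotz F holomorphic_on \<Omega>"
  proof (rule holomorphic_onI)
    fix w assume w: "w \<in> \<Omega>"
    have "\<exists>d>0. AE s in circle_measure. F s = 0 \<or> d \<le> norm (s - w)"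
    proof -
      obtain e where e: "e > 0" "ball w e \<subseteq> \<Omega>" using open\<Omega> w by (meson open_contains_ball)
      \<comment> \<open>A point of the circle within \<open>e\<close> of \<open>w\<close> lies in
        \<Omega>, hence in the ball around \<open>t0\<close>, where \<open>F\<close>
        vanishes.\<close>
      have "AE s in circle_measure. F s = 0 \<or> e \<le> norm (s - w)"
        using F0 AE_circle_norm
      proof eventually_elim
        case (elim s)
        show ?case
        proof (rule ccontr)
          assume *: "\<not> (F s = 0 \<or> e \<le> cmod (s - w))"
          then have "s \<in> \<Omega>" using e(2) by (auto simp: dist_norm norm_minus_commute)
          then show False using elim * by (auto simp: \<Omega>_def)
        qed
      qed
      with e show ?thesis by blast
    qed
    then obtain d where "d > 0" "AE s in circle_measure. F s = 0 \<or> d \<le> norm (s - w)" by blast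
    from herglotz_has_field_derivative[OF F this] show "herglotz F field_differentiable at w within \<Omega>"
      by (meson field_differentiable_at_within field_differentiable_def)
  qed
  have zero: "herglotz F w = 0" if "w \<in> \<Omega>" for w
    by (rule analytic_continuation[OF hol open\<Omega> conn Z(1)[folded \<Omega>_def] l[folded \<Omega>_def] Z(2) that])
  have cF: "integrable circle_measure (\<lambda>s. cnj (F s))" using F by simp
  \<comment> \<open>Values at radius 1/2 give the coefficients of index at least 0; values at radius
    2, seen through reflection, give the others.\<close>
  have "fourier_coeff F m = 0" if "m \<ge> 0" for m
  proof -
    have "fourier_coeff (\<lambda>z. herglotz F (of_real (1/2) * z)) m = 0"
      unfolding fourier_coeff_def
      by (subst Bochner_Integration.integral_cong[OF refl, where g = "\<lambda>_. 0"]) (auto simp: zero \<Omega>_def norm_mult norm_divide)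
    then show ?thesis using herglotz_fourier[OF F, of "1/2" m] that by (simp split: if_splits)
  qed
  moreover have "fourier_coeff F (- m) = 0" if "m \<ge> 0" for m
  proof -
    have "fourier_coeff (\<lambda>z. herglotz (\<lambda>s. cnj (F s)) (of_real (1/2) * z)) m = 0"
      unfolding fourier_coeff_def
    proof (subst Bochner_Integration.integral_cong[OF refl, where g = "\<lambda>_. 0"])
      fix z :: complex assume "z \<in> space circle_measure"
      then have z: "norm z = 1" by simp
      then have "herglotz (\<lambda>s. cnj (F s)) (of_real (1/2) * z) = - cnj (herglotz F (1 / cnj (of_real (1/2) * z)))"
        by (intro herglotz_reflect) auto
      also have "\<dots> = 0" using z by (subst zero) (auto simp: \<Omega>_def norm_divide norm_mult)
      finally show "herglotz (\<lambda>s. cnj (F s)) (of_real (1/2) * z) * z powi - m = 0" by simp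
    qed simp
    then have "fourier_coeff (\<lambda>s. cnj (F s)) m = 0"
      using herglotz_fourier[OF cF, of "1/2" m] that by (simp split: if_splits)
    moreover have "fourier_coeff (\<lambda>s. cnj (F s)) m = cnj (fourier_coeff F (- m))" by (rule fourier_coeff_cnj)
    ultimately show ?thesis by simp
  qed
  ultimately have "fourier_coeff F m = 0" for m by (metis minus_minus neg_0_le_iff_le nle_le)
  then have "(LINT z|circle_measure. F z * z powi n) = 0" for n
    using fourier_coeff_def[of F "-n"] by simp
  then show ?thesis by (rule fourier_zero_imp_AE_zero[OF F])
qed

text \<open>Two independent radii are allowed because the squared \<open>L2\<close> distance of two
  dilates contains their mixed inner product.\<close>

lemma parseval_cnj:
  assumes a: "\<And>w. norm w < 1 \<Longrightarrow> (\<lambda>n. a n * w ^ n) sums F w" and r: "0 \<le> r" "r < 1" "0 \<le> \<rho>" "\<rho> < 1"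
    and [measurable]: "\<And>r. 0 \<le> r \<Longrightarrow> r < 1 \<Longrightarrow> (\<lambda>z. F (of_real r * z)) \<in> borel_measurable circle_measure"
    and B: "\<And>w. norm w < 1 \<Longrightarrow> norm (F w) \<le> B"
  shows "(\<lambda>n. of_real ((norm (a n))\<^sup>2 * (r * \<rho>) ^ n)) sums (LINT z|circle_measure. F (of_real r * z) * cnj (F (of_real \<rho> * z)))"
proof -
  have m: "(\<lambda>z. F (of_real r * z)) \<in> borel_measurable circle_measure" "(\<lambda>z. F (of_real \<rho> * z)) \<in> borel_measurable circle_measure"
    using r by auto
  have nr: "norm (of_real r * z) < 1" "norm (of_real \<rho> * z) < 1" if "norm z = 1" for z :: complex
    using that r by (auto simp: norm_mult)
  \<comment> \<open>Convergence at the larger radius \<open>(r + 1) / 2\<close> forces absolute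
    convergence at \<open>r\<close>.\<close>
  have sm: "summable (\<lambda>n. norm (a n * of_real r ^ n))" if "0 \<le> r" "r < 1" for r
  proof (rule powser_insidea)
    show "summable (\<lambda>n. a n * of_real ((r + 1) / 2) ^ n)" using a[of "of_real ((r + 1) / 2)"] that by (simp add: sums_iff norm_divide norm_of_real[symmetric] del: norm_of_real of_real_add of_real_divide) (simp add: norm_of_real)
    show "norm (of_real r :: complex) < norm (of_real ((r + 1) / 2) :: complex)" using that by (simp add: norm_of_real del: of_real_add of_real_divide)
  qed
  have int: "integrable circle_measure (\<lambda>z. F (of_real r * z))"
    using AE_circle_norm m(1) by (intro circle.integrable_const_bound[of _ B]) (auto intro!: B nr elim!: eventually_mono)
  have "(\<lambda>n. cnj (a n * of_real \<rho> ^ n) * (LINT z|circle_measure. F (of_real r * z) * z powi (- int n)))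
      sums (LINT z|circle_measure. F (of_real r * z) * cnj (F (of_real \<rho> * z)))"
  proof (rule sums_integral_mult[OF int])
    show "summable (\<lambda>n. norm (cnj (a n * of_real \<rho> ^ n)))" using sm[OF r(3,4)] by (simp only: complex_mod_cnj)
    show "AE z in circle_measure. norm (z powi (- int n)) \<le> 1" for n
      using AE_circle_norm by eventually_elim (auto simp: norm_power_int)
    show "AE z in circle_measure. (\<lambda>n. cnj (a n * of_real \<rho> ^ n) * z powi (- int n)) sums cnj (F (of_real \<rho> * z))"
      using AE_circle_norm
    proof eventually_elim
      case (elim z)
      have "cnj z = inverse z" using elim by (metis complex_norm_square inverse_unique of_real_1 one_power2)
      then have "cnj (z ^ n) = z powi (- int n)" for n by (simp add: power_int_minus power_inverse)
      then have "cnj (a n * (of_real \<rho> * z) ^ n) = cnj (a n * of_real \<rho> ^ n) * z powi (- int n)" for n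
        by (simp add: power_mult_distrib)
      moreover have "(\<lambda>n. cnj (a n * (of_real \<rho> * z) ^ n)) sums cnj (F (of_real \<rho> * z))"
        using a[OF nr(2)[OF elim]] by (simp only: sums_cnj)
      ultimately show ?case by (simp only:)
    qed
    show "(\<lambda>z. cnj (F (of_real \<rho> * z))) \<in> borel_measurable circle_measure"
      by (rule borel_measurable_continuous_on[OF _ m(2)]) (intro continuous_intros)
  qed auto
  moreover have "(LINT z|circle_measure. F (of_real r * z) * z powi (- int n)) = a n * of_real r ^ n" for n
  proof -
    have "(LINT z|circle_measure. F (of_real r * z) * z powi (- int n)) = (if int n \<ge> 0 then a (nat (int n)) * of_real r ^ nat (int n) else 0)"
    proof (rule power_series_fourier[OF sm[OF r(1,2)] _ m(1)])
      show "AE z in circle_measure. (\<lambda>n. a n * of_real r ^ n * z ^ n) sums F (of_real r * z)"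
        using AE_circle_norm
      proof eventually_elim
        case (elim z)
        show ?case using a[OF nr(1)[OF elim]] by (simp add: power_mult_distrib mult_ac)
      qed
    qed
    then show ?thesis by simp
  qed
  moreover have "cnj (a n * of_real \<rho> ^ n) * (a n * of_real r ^ n) = of_real ((norm (a n))\<^sup>2 * (r * \<rho>) ^ n)" for n
    unfolding of_real_mult complex_norm_square by (simp add: power_mult_distrib mult_ac)
  ultimately show ?thesis by simp
qed

section \<open>Boundary functions and multipliers of the Hardy space\<close>

lemma cmod_diff_squared: "(cmod (x - y))\<^sup>2 = Re (x * cnj x) + Re (y * cnj y) - 2 * Re (x * cnj y)"
  unfolding cmod_power2 by (simp add: power2_eq_square algebra_simps)

text \<open>By Parseval the inner products \<open>s n m\<close> of dilates increase in both radii,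
  with diagonal bounded by \<open>B\<^sup>2\<close>. So the dilates are Cauchy in \<open>L2\<close>,
  hence in \<open>L1\<close>, and a subsequence converges almost everywhere.\<close>

lemma bounded_holomorphic_radial_limits:
  assumes hol: "F holomorphic_on ball 0 1" and B: "\<And>w. norm w < 1 \<Longrightarrow> norm (F w) \<le> B"
  obtains r :: "nat \<Rightarrow> real" and G where "\<forall>n. 0 \<le> r n \<and> r n < 1" "r \<longlonglongrightarrow> 1"
    "G \<in> borel_measurable circle_measure"
    "AE z in circle_measure. (\<lambda>n. F (of_real (r n) * z)) \<longlonglongrightarrow> G z"
proof -
  define a where "a n = (deriv ^^ n) F 0 / fact n" for n
  define R where "R n = 1 + - inverse (real (Suc n))" for n
  have R: "0 \<le> R n" "R n < 1" for n by (auto simp: R_def field_simps)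
  have Rmono: "R n \<le> R m" if "n \<le> m" for n m using that by (simp add: R_def le_imp_inverse_le del: of_nat_Suc)
  have a: "(\<lambda>n. a n * w ^ n) sums F w" if "norm w < 1" for w
    using holomorphic_power_series[OF hol, of w] that by (simp add: a_def)
  have meas: "(\<lambda>z. F (of_real r * z)) \<in> borel_measurable circle_measure" if "0 \<le> r" "r < 1" for r
  proof (rule continuous_on_circle_measurable)
    show "continuous_on unit_circle (\<lambda>z. F (of_real r * z))"
      by (rule continuous_on_compose2[OF holomorphic_on_imp_continuous_on[OF hol]])
        (use that in \<open>auto intro!: continuous_intros simp: norm_mult\<close>)
  qed
  define f where "f n z = F (of_real (R n) * z)" for n z
  have [measurable]: "f n \<in> borel_measurable circle_measure" for n unfolding f_def by (rule meas[OF R])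
  have fB: "norm (f n z) \<le> B" if "norm z = 1" for n z unfolding f_def using that R[of n] by (intro B) (simp add: norm_mult)
  have fint: "integrable circle_measure (f n)" for n
    using AE_circle_norm by (intro circle.integrable_const_bound[of _ B]) (auto intro!: fB elim!: eventually_mono)
  have cm: "(\<lambda>z. cnj (f n z)) \<in> borel_measurable circle_measure" for n
    by (rule borel_measurable_continuous_on[of cnj]) (auto intro: continuous_intros)
  have fint2: "integrable circle_measure (\<lambda>z. f n z * cnj (f m z))" for n m
    using AE_circle_norm cm by (intro integrable_mult_bounded[OF fint, of _ B]) (auto intro!: fB elim!: eventually_mono)
  define s where "s n m = (\<Sum>k. (norm (a k))\<^sup>2 * (R n * R m) ^ k)" for n m
  have pars: "(\<lambda>k. (norm (a k))\<^sup>2 * (R n * R m) ^ k) sums s n m"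
     "(LINT z|circle_measure. f n z * cnj (f m z)) = of_real (s n m)" for n m
  proof -
    have *: "(\<lambda>k. of_real ((norm (a k))\<^sup>2 * (R n * R m) ^ k)) sums (LINT z|circle_measure. f n z * cnj (f m z))"
      unfolding f_def by (rule parseval_cnj[OF a R R meas B])
    then have "summable (\<lambda>k. of_real ((norm (a k))\<^sup>2 * (R n * R m) ^ k) :: complex)" by (rule sums_summable)
    then have "summable (\<lambda>k. (norm (a k))\<^sup>2 * (R n * R m) ^ k)" by (simp only: summable_complex_of_real)
    then show s: "(\<lambda>k. (norm (a k))\<^sup>2 * (R n * R m) ^ k) sums s n m" unfolding s_def by (rule summable_sums)
    from sums_unique2[OF * sums_of_real[OF s]] show "(LINT z|circle_measure. f n z * cnj (f m z)) = of_real (s n m)" .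
  qed
  \<comment> \<open>For \<open>n \<le> m\<close> this gives
    \<open>s n n + s m m - 2 * s n m \<le> s m m - s n n\<close>, so the diagonal controls all
    distances.\<close>
  have smono: "s n n \<le> s n m" "s n m \<le> s m m" if "n \<le> m" for n m
  proof -
    show "s n n \<le> s n m" using Rmono[OF that] R
      by (intro sums_le[OF _ pars(1) pars(1)] mult_left_mono power_mono) auto
    show "s n m \<le> s m m" using Rmono[OF that] R
      by (intro sums_le[OF _ pars(1) pars(1)] mult_left_mono mult_right_mono power_mono) auto
  qed
  have "norm (s n n) \<le> B\<^sup>2" for n
  proof -
    have "of_real (s n n) = (LINT z|circle_measure. f n z * cnj (f n z))" by (simp add: pars(2))
    also have "norm \<dots> \<le> (LINT z|circle_measure. B\<^sup>2)"
    proof (rule Bochner_Integration.integral_norm_bound_integral)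
      fix z assume "z \<in> space circle_measure"
      then show "norm (f n z * cnj (f n z)) \<le> B\<^sup>2" using fB[of z n] by (simp add: norm_mult power2_eq_square mult_mono')
    qed (use fint2 in auto)
    also have "\<dots> = B\<^sup>2" using circle.prob_space by simp
    finally have "norm (of_real (s n n) :: complex) \<le> B\<^sup>2" .
    then show ?thesis by simp
  qed
  moreover have "incseq (\<lambda>n. s n n)" using order_trans[OF smono(1) smono(2)] by (auto simp: incseq_def)
  ultimately have "convergent (\<lambda>n. s n n)"
    by (intro Bseq_monoseq_convergent incseq_imp_monoseq BseqI'[of _ "B\<^sup>2"])
  then have cau: "Cauchy (\<lambda>n. s n n)" by (simp add: Cauchy_convergent_iff)
  define q where "q n m z = Re (f n z * cnj (f m z))" for n m z
  have q: "integrable circle_measure (q n m)" "(LINT z|circle_measure. q n m z) = s n m" for n m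
    using integrable_Re[OF fint2[of n m]] integral_Re[OF fint2[of n m]] pars(2)[of n m]
    unfolding q_def by (simp_all only: Re_complex_of_real)
  have D: "(LINT z|circle_measure. (cmod (f n z - f m z))\<^sup>2) = s n n + s m m - 2 * s n m" for n m
    unfolding cmod_diff_squared q_def[symmetric] using q by simp
  have D': "integrable circle_measure (\<lambda>z. (cmod (f n z - f m z))\<^sup>2)" for n m
    unfolding cmod_diff_squared q_def[symmetric] using q by simp
  \<comment> \<open>The inequality \<open>x \<le> e / 2 + x\<^sup>2 / (2 * e)\<close> passes from
    \<open>L2\<close> to \<open>L1\<close> on a probability space.\<close>
  have L1: "(LINT z|circle_measure. norm (f n z - f m z)) < e" if e: "e > 0" and "s n n + s m m - 2 * s n m < e\<^sup>2" for n m e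
  proof -
    have "(LINT z|circle_measure. norm (f n z - f m z)) \<le> (LINT z|circle_measure. e / 2 + (cmod (f n z - f m z))\<^sup>2 / (2 * e))"
    proof (rule integral_mono)
      fix z
      have "0 \<le> (cmod (f n z - f m z) - e)\<^sup>2" by simp
      then show "norm (f n z - f m z) \<le> e / 2 + (cmod (f n z - f m z))\<^sup>2 / (2 * e)"
        using e by (simp add: field_simps power2_eq_square)
    qed (use fint D' in auto)
    also have "\<dots> = e / 2 + (s n n + s m m - 2 * s n m) / (2 * e)" using D' D circle.prob_space by simp
    also have "\<dots> < e / 2 + e\<^sup>2 / (2 * e)" using that by (intro add_strict_left_mono divide_strict_right_mono) auto
    also have "\<dots> = e" using e by (simp add: power2_eq_square)
    finally show ?thesis .
  qed
  have cs: "\<exists>N. \<forall>i\<ge>N. \<forall>j\<ge>N. (LINT z|circle_measure. norm (f i z - f j z)) < e" if e: "e > 0" for e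
  proof -
    obtain N where N: "\<And>i j. i \<ge> N \<Longrightarrow> j \<ge> N \<Longrightarrow> dist (s i i) (s j j) < e\<^sup>2"
      using cau e unfolding Cauchy_def by (metis zero_less_power)
    have comm: "s i j = s j i" for i j by (simp add: s_def mult.commute)
    have "(LINT z|circle_measure. norm (f i z - f j z)) < e" if "i \<ge> N" "j \<ge> N" for i j
    proof (rule L1[OF e])
      show "s i i + s j j - 2 * s i j < e\<^sup>2"
        using N[OF that] smono[of i j] smono[of j i] comm[of i j] by (cases "i \<le> j") (auto simp: dist_real_def)
    qed
    then show ?thesis by blast
  qed
  obtain r where r: "strict_mono r" "AE z in circle_measure. Cauchy (\<lambda>i. f (r i) z)"
    by (rule cauchy_L1_AE_cauchy_subseq[OF fint cs])
  show thesis
  proof (rule that[of "\<lambda>i. R (r i)" "\<lambda>z. lim (\<lambda>i. f (r i) z)"])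
    have "R \<longlonglongrightarrow> 1" unfolding R_def by (rule LIMSEQ_inverse_real_of_nat_add_minus)
    then show "(\<lambda>i. R (r i)) \<longlonglongrightarrow> 1" using LIMSEQ_subseq_LIMSEQ[OF _ r(1)] by (auto simp: o_def)
    show "AE z in circle_measure. (\<lambda>n. F (of_real (R (r n)) * z)) \<longlonglongrightarrow> lim (\<lambda>i. f (r i) z)"
      using r(2) by eventually_elim (auto simp: f_def Cauchy_convergent_iff convergent_LIMSEQ_iff)
  qed (use R in auto)
qed

section \<open>Hardy functions and multiplication by power series\<close>

lemma H2_iff:
  "h \<in> H2 \<longleftrightarrow> h \<in> borel_measurable circle_measure \<and> integrable circle_measure (\<lambda>z. (cmod (h z))\<^sup>2)
     \<and> (\<forall>n<0. fourier_coeff h n = 0)"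
proof -
  have 1: "set_borel_measurable circle_measure unit_circle h \<longleftrightarrow> h \<in> borel_measurable circle_measure"
    unfolding set_borel_measurable_def by (intro measurable_cong) simp
  have 2: "set_integrable circle_measure unit_circle g \<longleftrightarrow> integrable circle_measure g" for g :: "complex \<Rightarrow> real"
    unfolding set_integrable_def by (intro Bochner_Integration.integrable_cong) simp_all
  show ?thesis unfolding H2_def L2_on_def by (simp add: 1 2)
qed

lemma square_integrable_imp_integrable:
  assumes [measurable]: "h \<in> borel_measurable circle_measure" and i: "integrable circle_measure (\<lambda>z. (cmod (h z))\<^sup>2)"
  shows "integrable circle_measure (h :: complex \<Rightarrow> complex)"
proof (rule Bochner_Integration.integrable_bound[of _ "\<lambda>z. 1 + (cmod (h z))\<^sup>2"])
  have "cmod x \<le> 1 + (cmod x)\<^sup>2" for x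
    using power2_sum[of "cmod x - 1 / 2" 0] zero_le_power2[of "cmod x - 1/2"] by (simp add: power2_eq_square algebra_simps)
  then show "AE z in circle_measure. norm (h z) \<le> norm (1 + (cmod (h z))\<^sup>2)"
    by (intro AE_I2) (simp add: abs_of_nonneg add_nonneg_nonneg)
qed (use i in auto)

lemma H2_integrable: "h \<in> H2 \<Longrightarrow> integrable circle_measure h"
  by (auto simp: H2_iff intro: square_integrable_imp_integrable)

lemma L2_mult_bounded:
  assumes g: "g \<in> borel_measurable circle_measure" "integrable circle_measure (\<lambda>z. (cmod (g z))\<^sup>2)"
    and S: "S \<in> borel_measurable circle_measure" "AE z in circle_measure. norm (S z) \<le> B"
  shows "integrable circle_measure (\<lambda>z. (cmod (g z * S z))\<^sup>2)"
proof (rule Bochner_Integration.integrable_bound[of _ "\<lambda>z. B\<^sup>2 * (cmod (g z))\<^sup>2"])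
  show "AE z in circle_measure. norm ((cmod (g z * S z))\<^sup>2) \<le> norm (B\<^sup>2 * (cmod (g z))\<^sup>2)"
    using S(2)
  proof eventually_elim
    case (elim z)
    then have "(cmod (S z))\<^sup>2 \<le> B\<^sup>2" by (intro power_mono) auto
    from mult_right_mono[OF this, of "(cmod (g z))\<^sup>2"] show ?case
      by (simp add: norm_mult power_mult_distrib mult.commute)
  qed
qed (use g S in auto)

text \<open>Multiplication by \<open>z ^ k\<close> only raises indices: each term is a coefficient
  of \<open>g\<close> of index \<open>n - k\<close>, still negative.\<close>

lemma integral_H2_power_series:
  assumes g: "g \<in> H2" and b: "summable (\<lambda>n. norm (b n))"
    and S: "AE z in circle_measure. (\<lambda>n. b n * z ^ n) sums S z" "S \<in> borel_measurable circle_measure" and n: "n < 0"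
  shows "fourier_coeff (\<lambda>z. g z * S z) n = 0"
proof -
  have gi: "integrable circle_measure (\<lambda>z. g z * z powi (- n))" by (rule integrable_mult_powi[OF H2_integrable[OF g]])
  have "(\<lambda>k. b k * (LINT z|circle_measure. g z * z powi (- n) * z ^ k)) sums (LINT z|circle_measure. g z * z powi (- n) * S z)"
  proof (rule sums_integral_mult[OF gi b _ _ S])
    show "AE z in circle_measure. norm (z ^ k) \<le> 1" for k
      using AE_circle_norm by eventually_elim (simp add: norm_power)
  qed auto
  moreover have "(LINT z|circle_measure. g z * z powi (- n) * z ^ k) = 0" for k
  proof -
    have "(LINT z|circle_measure. g z * z powi (- n) * z ^ k) = fourier_coeff g (n - int k)"
      unfolding fourier_coeff_def
    proof (rule Bochner_Integration.integral_cong[OF refl])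
      fix z :: complex assume "z \<in> space circle_measure"
      then have "z \<noteq> 0" by auto
      then show "g z * z powi (- n) * z ^ k = g z * z powi - (n - int k)"
        by (simp add: power_int_diff power_int_minus field_simps)
    qed
    also have "\<dots> = 0" using g n by (simp add: H2_iff)
    finally show ?thesis .
  qed
  ultimately have "(\<lambda>k::nat. 0) sums (LINT z|circle_measure. g z * z powi (- n) * S z)" by simp
  then have "(LINT z|circle_measure. g z * z powi (- n) * S z) = 0" by (metis sums_0 sums_unique2)
  then show ?thesis by (simp add: fourier_coeff_def mult_ac)
qed

lemma H2_mult_power_series:
  assumes g: "g \<in> H2" and b: "summable (\<lambda>n. norm (b n))"
    and S: "\<And>z. norm z = 1 \<Longrightarrow> (\<lambda>n. b n * z ^ n) sums S z" "S \<in> borel_measurable circle_measure"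
  shows "(\<lambda>z. g z * S z) \<in> H2"
proof -
  have [measurable]: "g \<in> borel_measurable circle_measure" using g by (simp add: H2_iff)
  have SB: "norm (S z) \<le> (\<Sum>n. norm (b n))" if "norm z = 1" for z
  proof -
    have "norm (b n * z ^ n) = norm (b n)" for n using that by (simp add: norm_mult norm_power)
    then show ?thesis using summable_norm[of "\<lambda>n. b n * z ^ n"] b S(1)[OF that] by (simp add: sums_iff)
  qed
  have "AE z in circle_measure. norm (S z) \<le> (\<Sum>n. norm (b n))" using AE_circle_norm by eventually_elim (rule SB)
  then have "integrable circle_measure (\<lambda>z. (cmod (g z * S z))\<^sup>2)"
    using g S(2) by (intro L2_mult_bounded) (auto simp: H2_iff)
  moreover have "AE z in circle_measure. (\<lambda>n. b n * z ^ n) sums S z" using AE_circle_norm by eventually_elim (rule S(1))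
  ultimately show ?thesis
    using integral_H2_power_series[OF g b _ S(2)] g S(2) by (auto simp: H2_iff)
qed

section \<open>Poisson bounds and boundary values of the Herglotz transform\<close>

lemma fourier_coeff_one: "fourier_coeff (\<lambda>_. 1) m = (if m = 0 then 1 else 0)"
  by (simp add: fourier_coeff_def integral_powi_circle)

lemma herglotz_one:
  assumes "norm w < 1" shows "herglotz (\<lambda>_. 1) w = 1"
proof -
  have "(\<lambda>n. herg_coeff n * fourier_coeff (\<lambda>_. 1) (int n) * w ^ n) sums herglotz (\<lambda>_. 1) w"
    by (rule herglotz_sums[OF _ assms]) simp
  moreover have "(\<lambda>n. herg_coeff n * fourier_coeff (\<lambda>_. 1) (int n) * w ^ n) = (\<lambda>n. if n = 0 then 1 else 0)"
    by (auto simp: fourier_coeff_one)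
  ultimately show ?thesis using sums_single[of 0 "\<lambda>_. 1 :: complex"] by (auto dest: sums_unique2)
qed

lemma AE_dist_circle:
  assumes "norm w < 1" shows "AE s in circle_measure. F s = 0 \<or> 1 - norm w \<le> norm (s - w)"
  using AE_circle_norm
proof eventually_elim
  case (elim s)
  then show ?case using norm_triangle_ineq2[of s w] by simp
qed

lemma Re_herg_nonneg:
  assumes "norm s = 1" "norm w < 1" shows "Re (herg s w) \<ge> 0"
proof -
  have "Re ((s + w) * cnj (s - w)) = (cmod s)\<^sup>2 - (cmod w)\<^sup>2"
    unfolding cmod_power2 by (simp add: power2_eq_square algebra_simps)
  also have "\<dots> \<ge> 0" using assms power_mono[of "cmod w" 1 2] by simp
  finally show ?thesis unfolding herg_def
    by (subst complex_div_cnj) (simp add: Re_divide_of_real[of _ "(cmod (s - w))\<^sup>2", simplified])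
qed

text \<open>The Poisson kernel is nonnegative and has mean 1, the mean being the Herglotz transform
  of the constant 1.\<close>

lemma Re_herglotz_bounded:
  assumes [measurable]: "u \<in> borel_measurable circle_measure" and u: "\<And>z. \<bar>u z\<bar> \<le> B" and w: "norm w < 1"
  shows "\<bar>Re (herglotz (\<lambda>s. of_real (u s)) w)\<bar> \<le> B"
proof -
  have i: "integrable circle_measure (\<lambda>s. of_real (v s) * herg s w)"
    if [measurable]: "v \<in> borel_measurable circle_measure" and "\<And>z. \<bar>v z\<bar> \<le> B" for v :: "complex \<Rightarrow> real"  and B
    using w that by (intro integrable_herglotz[OF _ _ AE_dist_circle[OF w]] circle.integrable_const_bound[of _ B]) auto
  note iu = i[OF assms(1) u] and i1 = i[of "\<lambda>_. 1" 1]
  have "\<bar>Re (herglotz (\<lambda>s. of_real (u s)) w)\<bar> = \<bar>LINT s|circle_measure. u s * Re (herg s w)\<bar>"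
    unfolding herglotz_def using iu by (subst integral_Re[symmetric]) auto
  also have "\<dots> \<le> (LINT s|circle_measure. B * Re (herg s w))"
  proof (rule Bochner_Integration.integral_abs_bound_integral)
    show "integrable circle_measure (\<lambda>s. u s * Re (herg s w))" using integrable_Re[OF iu] by simp
    show "integrable circle_measure (\<lambda>s. B * Re (herg s w))" using integrable_Re[OF i1] by simp
    fix s assume "s \<in> space circle_measure"
    then have "Re (herg s w) \<ge> 0" using w by (intro Re_herg_nonneg) auto
    then show "\<bar>u s * Re (herg s w)\<bar> \<le> B * Re (herg s w)" using u[of s] by (simp add: abs_mult mult_right_mono)
  qed
  also have "\<dots> = B * Re (herglotz (\<lambda>_. 1) w)" unfolding herglotz_def using i1 by (simp add: integral_Re)
  also have "\<dots> = B" using herglotz_one[OF w] by simp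
  finally show ?thesis .
qed

lemma herglotz_holomorphic_disc:
  assumes F: "integrable circle_measure F" shows "herglotz F holomorphic_on ball 0 1"
proof (rule holomorphic_onI)
  fix w :: complex assume "w \<in> ball 0 1"
  then have w: "norm w < 1" by simp
  from herglotz_has_field_derivative[OF F _ AE_dist_circle[OF w]] w
  show "herglotz F field_differentiable at w within ball 0 1"
    by (meson field_differentiable_at_within field_differentiable_def diff_gt_0_iff_gt)
qed

text \<open>First-order vanishing of \<open>u\<close> at \<open>s\<close> cancels the pole of the
  kernel, so the integral at \<open>s\<close> converges absolutely and the dilated integrands share
  a bound.\<close>

lemma herglotz_radial_limit:
  assumes u: "integrable circle_measure u" and s: "norm s = 1" and M: "AE t in circle_measure. norm (u t) \<le> M * norm (t - s)"
    and r: "\<And>n. 0 \<le> r n" "\<And>n. r n < 1" "r \<longlonglongrightarrow> 1"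
  shows "(\<lambda>n. herglotz u (of_real (r n) * s)) \<longlonglongrightarrow> herglotz u s"
  unfolding herglotz_def
proof (rule integral_dominated_convergence)
  have [measurable]: "u \<in> borel_measurable circle_measure" using u by auto
  show "(\<lambda>t. u t * herg t s) \<in> borel_measurable circle_measure"
    "(\<lambda>t. u t * herg t (of_real (r n) * s)) \<in> borel_measurable circle_measure" for n by measurable
  show "integrable circle_measure (\<lambda>_. 4 * M)" by simp
  show "AE t in circle_measure. (\<lambda>n. u t * herg t (of_real (r n) * s)) \<longlonglongrightarrow> u t * herg t s"
    using AE_circle_neq[of s]
  proof eventually_elim
    case (elim t)
    have "(\<lambda>n. of_real (r n) :: complex) \<longlonglongrightarrow> of_real 1" by (intro tendsto_of_real r)
    then show ?case unfolding herg_def using elim by (auto intro!: tendsto_eq_intros r(3))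
  qed
  show "AE t in circle_measure. norm (u t * herg t (of_real (r n) * s)) \<le> 4 * M" for n
    using M AE_circle_norm AE_circle_neq[of s]
  proof eventually_elim
    case (elim t)
    have nrs: "norm (of_real (r n) * s) = r n" using s r(1)[of n] by (simp add: norm_mult)
    then have pos: "0 < norm (t - of_real (r n) * s)" using elim r(2)[of n] by auto
    \<comment> \<open>No point of the circle is closer to \<open>r n * s\<close> than
      \<open>s\<close> is; the triangle inequality then yields the factor 2.\<close>
    have "norm (s - of_real (r n) * s) = 1 - r n"
    proof -
      have "s - of_real (r n) * s = of_real (1 - r n) * s" by (simp add: algebra_simps)
      then show ?thesis using s r(2)[of n] by (simp only: norm_mult norm_of_real) simp
    qed
    moreover have "1 - r n \<le> norm (t - of_real (r n) * s)" using norm_triangle_ineq2[of t "of_real (r n) * s"] nrs elim by simp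
    moreover have "norm (t - s) \<le> norm (t - of_real (r n) * s) + norm (s - of_real (r n) * s)"
      using norm_triangle_ineq4[of "t - of_real (r n) * s" "s - of_real (r n) * s"] by simp
    ultimately have 2: "norm (t - s) \<le> 2 * norm (t - of_real (r n) * s)" by linarith
    have M0: "M \<ge> 0"
    proof (rule ccontr)
      assume "\<not> M \<ge> 0"
      then have "M * norm (t - s) < 0" using elim by (simp add: mult_neg_pos)
      then show False using elim(1) norm_ge_zero[of "u t"] by linarith
    qed
    have "norm (herg t (of_real (r n) * s)) \<le> (1 + norm (of_real (r n) * s)) / norm (t - of_real (r n) * s)"
      using elim pos by (intro norm_herg_le) auto
    also have "\<dots> \<le> 2 / norm (t - of_real (r n) * s)" using nrs r(2)[of n] pos by (intro divide_right_mono) auto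
    finally have "norm (u t) * norm (herg t (of_real (r n) * s)) \<le> (M * (2 * norm (t - of_real (r n) * s))) * (2 / norm (t - of_real (r n) * s))"
      using elim 2 M0 by (intro mult_mono order_trans[OF elim(1)] mult_left_mono) auto
    also have "\<dots> = 4 * M" using pos by simp
    finally show ?case by (simp add: norm_mult)
  qed
qed

text \<open>For real \<open>u\<close> this is the Poisson integral. Averaging with the conjugate
  cancels the 2 in \<open>herg_coeff\<close> for \<open>m \<noteq> 0\<close>, while for
  \<open>m = 0\<close> both terms contribute.\<close>

lemma fourier_coeff_Re_herglotz:
  assumes [measurable]: "u \<in> borel_measurable circle_measure" and u: "\<And>z. \<bar>u z\<bar> \<le> B" and r: "0 \<le> r" "r < 1"
  shows "fourier_coeff (\<lambda>z. of_real (Re (herglotz (\<lambda>s. of_real (u s)) (of_real r * z)))) m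
    = of_real r ^ nat \<bar>m\<bar> * fourier_coeff (\<lambda>s. of_real (u s)) m"
proof -
  let ?u = "\<lambda>s. complex_of_real (u s)" and ?U = "\<lambda>z. herglotz (\<lambda>s. complex_of_real (u s)) (of_real r * z)"
  have ui: "integrable circle_measure ?u" using u by (intro circle.integrable_const_bound[of _ B]) auto
  have [measurable]: "?U \<in> borel_measurable circle_measure" by (rule herglotz_measurable_circle[OF ui r])
  have "continuous_on (cball 0 r) (herglotz ?u)"
    by (rule continuous_on_subset[OF holomorphic_on_imp_continuous_on[OF herglotz_holomorphic_disc[OF ui]]]) (use r in auto)
  then have "bounded (herglotz ?u ` cball 0 r)" by (intro compact_imp_bounded compact_continuous_image) auto
  then obtain C where C: "\<forall>w\<in>cball 0 r. norm (herglotz ?u w) \<le> C" by (auto simp: bounded_iff)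
  have "AE z in circle_measure. norm (?U z) \<le> C"
    using AE_circle_norm by eventually_elim (use r in \<open>auto intro!: C[rule_format] simp: norm_mult\<close>)
  then have iU: "integrable circle_measure ?U" by (intro circle.integrable_const_bound[of _ C]) auto
  then have iU': "integrable circle_measure (\<lambda>z. cnj (?U z))" by simp
  have "fourier_coeff (\<lambda>z. of_real (Re (?U z))) m = fourier_coeff (\<lambda>z. (?U z + cnj (?U z)) / 2) m"
    by (simp add: complex_add_cnj)
  also have "\<dots> = (fourier_coeff ?U m + fourier_coeff (\<lambda>z. cnj (?U z)) m) / 2"
    using integrable_mult_powi[OF iU, of "-m"] integrable_mult_powi[OF iU', of "-m"]
    by (simp add: fourier_coeff_def distrib_right add_divide_distrib)
  also have "\<dots> = (fourier_coeff ?U m + cnj (fourier_coeff ?U (- m))) / 2" by (simp only: fourier_coeff_cnj)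
  also have "\<dots> = of_real r ^ nat \<bar>m\<bar> * fourier_coeff ?u m"
  proof -
    have "cnj (fourier_coeff ?u (- m)) = fourier_coeff ?u m"
      using fourier_coeff_cnj[of ?u m] by simp
    then show ?thesis
      using herglotz_fourier[OF ui r, of m] herglotz_fourier[OF ui r, of "-m"] by (auto split: if_splits)
  qed
  finally show ?thesis .
qed

text \<open>This is the exponential of the analytic completion of \<open>- u\<close>; radial limits along a sequence
  suffice to produce its boundary function, so that Fatou's theorem is not needed.\<close>
lemma outer_function:
  fixes u :: "complex \<Rightarrow> real"
  assumes [measurable]: "u \<in> borel_measurable circle_measure" and u: "\<And>z. \<bar>u z\<bar> \<le> B"
  obtains \<phi> where "\<phi> \<in> borel_measurable circle_measure"
    "AE z in circle_measure. norm (\<phi> z) = exp (- u z)"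
    "\<And>g. g \<in> H2 \<Longrightarrow> (\<lambda>z. g z * \<phi> z) \<in> H2"
    "AE s in circle_measure. \<forall>M. (AE t in circle_measure. \<bar>u t\<bar> \<le> M * norm (t - s)) \<longrightarrow>
        \<phi> s = exp (- herglotz (\<lambda>s. of_real (u s)) s)"
proof -
  let ?u = "\<lambda>s. complex_of_real (u s)"
  let ?U = "herglotz ?u"
  define F where "F w = exp (- ?U w)" for w
  have ui: "integrable circle_measure ?u" using u by (intro circle.integrable_const_bound[of _ B]) auto
  have RU: "\<bar>Re (?U w)\<bar> \<le> B" if "norm w < 1" for w using Re_herglotz_bounded[OF _ u that] by simp
  have hol: "F holomorphic_on ball 0 1" unfolding F_def
    by (intro holomorphic_intros herglotz_holomorphic_disc ui)
  have FB: "norm (F w) \<le> exp B" if "norm w < 1" for w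
    using RU[OF that] by (simp add: F_def)
  obtain r G where r': "\<forall>n. 0 \<le> r n \<and> r n < 1" and r1: "r \<longlonglongrightarrow> 1" and [measurable]: "G \<in> borel_measurable circle_measure"
    and G: "AE z in circle_measure. (\<lambda>n. F (of_real (r n) * z)) \<longlonglongrightarrow> G z"
    by (rule bounded_holomorphic_radial_limits[OF hol FB])
  have r: "0 \<le> r n" "r n < 1" "r \<longlonglongrightarrow> 1" for n using r' r1 by auto
  have nr: "norm (of_real (r n) * z) < 1" if "norm z = 1" for n and z :: complex
    using that r(1)[of n] r(2)[of n] by (simp add: norm_mult)
  have [measurable]: "(\<lambda>z. ?U (of_real (r n) * z)) \<in> borel_measurable circle_measure" for n
    by (rule herglotz_measurable_circle[OF ui r(1,2)])
  have mF[measurable]: "(\<lambda>z. F (of_real (r n) * z)) \<in> borel_measurable circle_measure" for n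
    unfolding F_def by measurable
  \<comment> \<open>The truncation provides a bound at every point; by \<open>P\<close> it changes
    nothing almost everywhere.\<close>
  define p where "p z = (if - B \<le> - ln (norm (G z)) \<and> - ln (norm (G z)) \<le> B then - ln (norm (G z)) else 0)" for z
  have [measurable]: "p \<in> borel_measurable circle_measure" unfolding p_def by measurable
  have P: "AE z in circle_measure. G z \<noteq> 0 \<and> p z = - ln (norm (G z)) \<and> \<bar>p z\<bar> \<le> B \<and> (\<lambda>n. Re (?U (of_real (r n) * z))) \<longlonglongrightarrow> p z"
    using G AE_circle_norm
  proof eventually_elim
    case (elim z)
    have l: "(\<lambda>n. norm (F (of_real (r n) * z))) \<longlonglongrightarrow> norm (G z)" using elim by (intro tendsto_norm)
    have "norm (F (of_real (r n) * z)) \<ge> exp (- B)" for n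
      using RU[OF nr[OF elim(2)], of n] by (simp add: F_def)
    then have "norm (G z) \<ge> exp (- B)" by (intro LIMSEQ_le_const[OF l]) auto
    then have nz: "norm (G z) > 0" using exp_gt_zero[of "-B"] by linarith
    have "(\<lambda>n. - ln (norm (F (of_real (r n) * z)))) \<longlonglongrightarrow> - ln (norm (G z))"
      using nz by (intro tendsto_intros l) auto
    then have l2: "(\<lambda>n. Re (?U (of_real (r n) * z))) \<longlonglongrightarrow> - ln (norm (G z))" by (simp add: F_def)
    have b: "Re (?U (of_real (r n) * z)) \<le> B" "- B \<le> Re (?U (of_real (r n) * z))" for n
      using RU[OF nr[OF elim(2)], of n] by auto
    have "- ln (norm (G z)) \<le> B" by (rule LIMSEQ_le_const2[OF l2]) (use b in auto)
    moreover have "- B \<le> - ln (norm (G z))" by (rule LIMSEQ_le_const[OF l2]) (use b in auto)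
    ultimately show ?case using l2 nz by (auto simp: p_def)
  qed
  have pB: "\<bar>p z\<bar> \<le> B" for z using u[of z] by (auto simp: p_def)
  have pi: "integrable circle_measure (\<lambda>z. complex_of_real (p z))" using pB by (intro circle.integrable_const_bound[of _ B]) auto
  \<comment> \<open>The Poisson means converge boundedly to \<open>p\<close>, and their coefficients
    converge to those of \<open>u\<close>; uniqueness then identifies \<open>p\<close> with
    \<open>u\<close>.\<close>
  have fcp: "fourier_coeff (\<lambda>z. of_real (p z)) m = fourier_coeff ?u m" for m
  proof -
    have "(\<lambda>n. fourier_coeff (\<lambda>z. of_real (Re (?U (of_real (r n) * z)))) m) \<longlonglongrightarrow> fourier_coeff (\<lambda>z. of_real (p z)) m"
      unfolding fourier_coeff_def
    proof (rule integral_dominated_convergence)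
      show "integrable circle_measure (\<lambda>_. B)" by simp
      show "AE z in circle_measure. (\<lambda>n. of_real (Re (?U (of_real (r n) * z))) * z powi (- m)) \<longlonglongrightarrow> of_real (p z) * z powi (- m)"
        using P by eventually_elim (intro tendsto_intros; blast)
      show "AE z in circle_measure. norm (of_real (Re (?U (of_real (r n) * z))) * z powi (- m)) \<le> B" for n
        using AE_circle_norm by eventually_elim (simp add: norm_mult norm_power_int RU[OF nr])
    qed measurable
    moreover have "(\<lambda>n. fourier_coeff (\<lambda>z. of_real (Re (?U (of_real (r n) * z)))) m) \<longlonglongrightarrow> of_real 1 ^ nat \<bar>m\<bar> * fourier_coeff ?u m"
      unfolding fourier_coeff_Re_herglotz[OF assms r(1,2)] by (intro tendsto_intros r(3))
    ultimately show ?thesis using LIMSEQ_unique by force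
  qed
  have "AE z in circle_measure. of_real (p z) - ?u z = 0"
  proof (rule fourier_zero_imp_AE_zero)
    show "integrable circle_measure (\<lambda>z. of_real (p z) - ?u z)" using pi ui by simp
    fix n
    have "(LINT z|circle_measure. (of_real (p z) - ?u z) * z powi n) = fourier_coeff (\<lambda>z. of_real (p z)) (- n) - fourier_coeff ?u (- n)"
      using integrable_mult_powi[OF pi, of n] integrable_mult_powi[OF ui, of n] by (simp add: fourier_coeff_def left_diff_distrib)
    then show "(LINT z|circle_measure. (of_real (p z) - ?u z) * z powi n) = 0" by (simp add: fcp)
  qed
  with P have mod: "AE z in circle_measure. norm (G z) = exp (- u z)"
  proof eventually_elim
    case (elim z)
    then have "p z = u z" by (simp flip: of_real_diff)
    with elim have "ln (norm (G z)) = - u z" "norm (G z) > 0" by auto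
    then show ?case using exp_ln[of "norm (G z)"] by simp
  qed
  have GB: "AE z in circle_measure. norm (G z) \<le> exp B"
    using mod by eventually_elim (metis abs_le_iff exp_le_cancel_iff minus_le_iff u)
  show thesis
  proof (rule that)
    show "G \<in> borel_measurable circle_measure" by measurable
    show "AE z in circle_measure. norm (G z) = exp (- u z)" by (rule mod)
    show "(\<lambda>z. g z * G z) \<in> H2" if g: "g \<in> H2" for g
    proof -
      have [measurable]: "g \<in> borel_measurable circle_measure" using g by (simp add: H2_iff)
      have gi: "integrable circle_measure (\<lambda>z. norm (g z))" using H2_integrable[OF g] by simp
      have "fourier_coeff (\<lambda>z. g z * G z) m = 0" if m: "m < 0" for m
      proof -
        \<comment> \<open>A dilate of \<open>F\<close> has absolutely summable Taylor coefficients,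
          so it preserves the vanishing of negative coefficients; the bound \<open>exp B\<close>
          carries this to the limit.\<close>
        have "(\<lambda>n. fourier_coeff (\<lambda>z. g z * F (of_real (r n) * z)) m) \<longlonglongrightarrow> fourier_coeff (\<lambda>z. g z * G z) m"
          unfolding fourier_coeff_def
        proof (rule integral_dominated_convergence)
          show "integrable circle_measure (\<lambda>z. exp B * norm (g z))" using gi by simp
          show "AE z in circle_measure. (\<lambda>n. g z * F (of_real (r n) * z) * z powi (- m)) \<longlonglongrightarrow> g z * G z * z powi (- m)"
            using G by eventually_elim (intro tendsto_intros)
          show "AE z in circle_measure. norm (g z * F (of_real (r n) * z) * z powi (- m)) \<le> exp B * norm (g z)" for n
            using AE_circle_norm
          proof eventually_elim
            case (elim z)
            then show ?case using mult_right_mono[OF FB[OF nr[OF elim]], of "norm (g z)" n]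
              by (simp add: norm_mult norm_power_int mult.commute)
          qed
        qed measurable
        moreover have "fourier_coeff (\<lambda>z. g z * F (of_real (r n) * z)) m = 0" for n
        proof (rule integral_H2_power_series[OF g _ _ mF m])
          let ?a = "\<lambda>k. (deriv ^^ k) F 0 / fact k"
          have a: "(\<lambda>k. ?a k * w ^ k) sums F w" if "norm w < 1" for w
            using holomorphic_power_series[OF hol, of w] that by simp
          show "summable (\<lambda>k. norm (?a k * of_real (r n) ^ k))"
          proof (rule powser_insidea)
            show "summable (\<lambda>k. ?a k * of_real ((r n + 1) / 2) ^ k)"
              by (rule sums_summable[OF a]) (use r(1)[of n] r(2)[of n] in \<open>simp add: norm_of_real del: of_real_add of_real_divide\<close>)
            show "norm (of_real (r n) :: complex) < norm (of_real ((r n + 1) / 2) :: complex)"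
              using r(1)[of n] r(2)[of n] by (simp add: norm_of_real del: of_real_add of_real_divide)
          qed
          show "AE z in circle_measure. (\<lambda>k. ?a k * of_real (r n) ^ k * z ^ k) sums F (of_real (r n) * z)"
            using AE_circle_norm
          proof eventually_elim
            case (elim z)
            show ?case using a[OF nr[OF elim], of n] by (simp add: power_mult_distrib mult_ac)
          qed
        qed
        ultimately show ?thesis by (simp add: LIMSEQ_const_iff)
      qed
      then show ?thesis using g L2_mult_bounded[OF _ _ _ GB, of g] by (simp add: H2_iff)
    qed
    show "AE s in circle_measure. \<forall>M. (AE t in circle_measure. \<bar>u t\<bar> \<le> M * norm (t - s)) \<longrightarrow> G s = exp (- ?U s)"
      using G AE_circle_norm
    proof eventually_elim
      case (elim s)
      show ?case
      proof (intro allI impI)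
        fix M assume "AE t in circle_measure. \<bar>u t\<bar> \<le> M * norm (t - s)"
        then have "(\<lambda>n. ?U (of_real (r n) * s)) \<longlonglongrightarrow> ?U s"
          by (intro herglotz_radial_limit[OF ui elim(2) _ r]) simp
        then have "(\<lambda>n. F (of_real (r n) * s)) \<longlonglongrightarrow> exp (- ?U s)" unfolding F_def by (intro tendsto_intros)
        then show "G s = exp (- ?U s)" using elim(1) LIMSEQ_unique by blast
      qed
    qed
  qed
qed

section \<open>Closure properties of square-integrable and Hardy functions\<close>

definition L2 :: "(complex \<Rightarrow> complex) \<Rightarrow> bool" where
  "L2 h \<longleftrightarrow> h \<in> borel_measurable circle_measure \<and> integrable circle_measure (\<lambda>z. (cmod (h z))\<^sup>2)"

lemma L2_measurable: "L2 h \<Longrightarrow> h \<in> borel_measurable circle_measure"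
  by (simp add: L2_def)

lemma L2_integrable: "L2 h \<Longrightarrow> integrable circle_measure h"
  by (auto simp: L2_def intro: square_integrable_imp_integrable)

lemma L2_add:
  assumes "L2 x" "L2 y" shows "L2 (\<lambda>z. x z + y z)"
  unfolding L2_def
proof
  show m: "(\<lambda>z. x z + y z) \<in> borel_measurable circle_measure" using assms by (auto simp: L2_def)
  show "integrable circle_measure (\<lambda>z. (cmod (x z + y z))\<^sup>2)"
  proof (rule Bochner_Integration.integrable_bound)
    show "integrable circle_measure (\<lambda>z. 2 * (cmod (x z))\<^sup>2 + 2 * (cmod (y z))\<^sup>2)" using assms by (auto simp: L2_def)
    show "(\<lambda>z. (cmod (x z + y z))\<^sup>2) \<in> borel_measurable circle_measure" using m by auto
    have "(cmod (a + b))\<^sup>2 \<le> 2 * (cmod a)\<^sup>2 + 2 * (cmod b)\<^sup>2" for a b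
    proof -
      have "(cmod (a + b))\<^sup>2 \<le> (cmod a + cmod b)\<^sup>2" by (intro power_mono norm_triangle_ineq) auto
      also have "\<dots> \<le> 2 * (cmod a)\<^sup>2 + 2 * (cmod b)\<^sup>2"
        using zero_le_power2[of "cmod a - cmod b"] by (simp add: power2_eq_square algebra_simps)
      finally show ?thesis .
    qed
    then show "AE z in circle_measure. norm ((cmod (x z + y z))\<^sup>2) \<le> norm (2 * (cmod (x z))\<^sup>2 + 2 * (cmod (y z))\<^sup>2)"
      by (intro AE_I2) simp
  qed
qed

lemma L2_cmult: "L2 x \<Longrightarrow> L2 (\<lambda>z. c * x z)"
  by (auto simp: L2_def norm_mult power_mult_distrib)

lemma L2_diff: "L2 x \<Longrightarrow> L2 y \<Longrightarrow> L2 (\<lambda>z. x z - y z)"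
  using L2_add[of x "\<lambda>z. -1 * y z"] L2_cmult[of y "-1"] by simp

lemma L2_bounded_mult:
  assumes "L2 x" "y \<in> borel_measurable circle_measure" "AE z in circle_measure. norm (y z) \<le> B"
  shows "L2 (\<lambda>z. x z * y z)"
  using assms L2_mult_bounded[of x y B] by (auto simp: L2_def)

lemma measurable_circle_cnj:
  "x \<in> borel_measurable M \<Longrightarrow> (\<lambda>z. cnj (x z)) \<in> borel_measurable M"
  by (rule borel_measurable_continuous_on[of cnj]) (auto intro: continuous_intros)

lemma L2_mult_integrable:
  assumes "L2 x" "L2 y" shows "integrable circle_measure (\<lambda>z. cmod (x z) * cmod (y z))"
    "integrable circle_measure (\<lambda>z. x z * cnj (y z))"
proof -
  have [measurable]: "x \<in> borel_measurable circle_measure" "y \<in> borel_measurable circle_measure" using assms by (auto simp: L2_def)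
  show 1: "integrable circle_measure (\<lambda>z. cmod (x z) * cmod (y z))"
  proof (rule Bochner_Integration.integrable_bound)
    show "integrable circle_measure (\<lambda>z. (cmod (x z))\<^sup>2 + (cmod (y z))\<^sup>2)" using assms by (auto simp: L2_def)
    have "a * b \<le> a\<^sup>2 + b\<^sup>2" for a b :: real
    proof -
      have "2 * (a * b) \<le> a\<^sup>2 + b\<^sup>2" using sum_squares_bound[of a b] by simp
      moreover have "0 \<le> a\<^sup>2 + b\<^sup>2" by simp
      ultimately show ?thesis by linarith
    qed
    then show "AE z in circle_measure. norm (cmod (x z) * cmod (y z)) \<le> norm ((cmod (x z))\<^sup>2 + (cmod (y z))\<^sup>2)"
      by (intro AE_I2) simp
  qed measurable
  show "integrable circle_measure (\<lambda>z. x z * cnj (y z))"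
    by (rule Bochner_Integration.integrable_bound[OF 1])
      (auto simp: norm_mult intro!: borel_measurable_times measurable_circle_cnj)
qed

lemma H2_L2: "h \<in> H2 \<longleftrightarrow> L2 h \<and> (\<forall>n<0. fourier_coeff h n = 0)"
  by (auto simp: H2_iff L2_def)

lemma H2_add: "x \<in> H2 \<Longrightarrow> y \<in> H2 \<Longrightarrow> (\<lambda>z. x z + y z) \<in> H2"
  by (simp add: H2_L2 L2_add fourier_coeff_def distrib_right integrable_mult_powi L2_integrable)

lemma H2_cmult: "x \<in> H2 \<Longrightarrow> (\<lambda>z. c * x z) \<in> H2"
  by (simp add: H2_L2 L2_cmult fourier_coeff_def mult.assoc)

lemma H2_diff: "x \<in> H2 \<Longrightarrow> y \<in> H2 \<Longrightarrow> (\<lambda>z. x z - y z) \<in> H2"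
  using H2_add[of x "\<lambda>z. -1 * y z"] H2_cmult[of y "-1"] by simp

lemma H2_zero: "(\<lambda>_. 0) \<in> H2"
  by (simp add: H2_iff fourier_coeff_def)

lemma H2_mult_ident:
  assumes "h \<in> H2" shows "(\<lambda>z. h z * z) \<in> H2"
proof (rule H2_mult_power_series[OF assms, of "\<lambda>k. if k = 1 then 1 else 0"])
  show "summable (\<lambda>k. norm (if k = 1 then 1 else 0 :: complex))" by (rule summable_finite[of "{1}"]) auto
  show "(\<lambda>k. (if k = 1 then 1 else 0) * z ^ k) sums z" for z :: complex
    using sums_single[of 1 "\<lambda>k. z ^ k"] by (simp add: if_distrib if_distribR cong: if_cong)
qed measurable

lemma H2_powers: "(\<lambda>z. z ^ n) \<in> H2"
proof (induction n)
  case 0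
  show ?case by (auto simp: H2_iff fourier_coeff_one)
next
  case (Suc n)
  from H2_mult_ident[OF this] show ?case by (simp add: mult.commute)
qed

lemma H2_mult_prod:
  assumes "finite P" "h \<in> H2" shows "(\<lambda>z. h z * (\<Prod>p\<in>P. z - p)) \<in> H2"
  using assms
proof (induction P rule: finite_induct)
  case (insert q P)
  let ?x = "\<lambda>z. h z * (\<Prod>p\<in>P. z - p)"
  have "(\<lambda>z. ?x z * z - q * ?x z) \<in> H2" using insert by (intro H2_diff H2_mult_ident H2_cmult) auto
  also have "(\<lambda>z. ?x z * z - q * ?x z) = (\<lambda>z. h z * (\<Prod>p\<in>insert q P. z - p))"
    using insert.hyps by (auto simp: algebra_simps)
  finally show ?case .
qed simp

text \<open>The pole is outside the closed disc, so the geometric series converges absolutely on the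
  circle.\<close>

lemma H2_divide:
  assumes "h \<in> H2" "norm a > 1" shows "(\<lambda>z. h z / (z - a)) \<in> H2"
proof -
  have "(\<lambda>z. h z * (1 / (z - a))) \<in> H2"
  proof (rule H2_mult_power_series[OF assms(1), of "\<lambda>k. - (1 / a) * (1 / a) ^ k"])
    show "summable (\<lambda>k. norm (- (1 / a) * (1 / a) ^ k))"
      unfolding norm_mult norm_power
    proof (intro summable_mult summable_geometric)
      show "norm (norm (1 / a)) < 1" using assms(2) by (simp add: norm_divide divide_less_eq)
    qed
    fix z :: complex assume z: "norm z = 1"
    have "(\<lambda>k. - (1 / a) * (z / a) ^ k) sums (- (1 / a) * (1 / (1 - z / a)))"
      using z assms by (intro sums_mult geometric_sums) (simp add: norm_divide divide_less_eq)
    moreover have "a \<noteq> 0" "z \<noteq> a" using z assms by auto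
    then have "- (1 / a) * (1 / (1 - z / a)) = 1 / (z - a)" by (simp add: field_simps)
    ultimately show "(\<lambda>k. - (1 / a) * (1 / a) ^ k * z ^ k) sums (1 / (z - a))"
      by (simp add: power_divide)
  qed measurable
  then show ?thesis by simp
qed

lemma H2_divide_prod:
  assumes "finite Q" "\<And>q. q \<in> Q \<Longrightarrow> norm (a q) > 1" "h \<in> H2" shows "(\<lambda>z. h z / (\<Prod>q\<in>Q. z - a q)) \<in> H2"
  using assms
proof (induction Q rule: finite_induct)
  case (insert q Q)
  have "(\<lambda>z. h z / (\<Prod>q\<in>Q. z - a q) / (z - a q)) \<in> H2" using insert by (intro H2_divide) auto
  then show ?case using insert.hyps by (simp add: mult.commute)
qed simp

lemma L2_on_L2:
  assumes "E \<in> sets circle_measure"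
  shows "x \<in> L2_on E \<longleftrightarrow> L2 (\<lambda>z. if z \<in> E then x z else 0)"
proof -
  have 1: "(\<lambda>z. indicator E z *\<^sub>R x z) = (\<lambda>z. if z \<in> E then x z else 0)" by (auto simp: indicator_def)
  have 2: "(\<lambda>z. indicator E z *\<^sub>R (cmod (x z))\<^sup>2) = (\<lambda>z. (cmod (if z \<in> E then x z else 0))\<^sup>2)" by (auto simp: indicator_def)
  show ?thesis unfolding L2_on_def L2_def set_borel_measurable_def set_integrable_def mem_Collect_eq 1 2 ..
qed

lemma L2_restrict:
  assumes "E \<in> sets circle_measure" "L2 x"
  shows "L2 (\<lambda>z. if z \<in> E then x z else 0)"
proof -
  have "L2 (\<lambda>z. x z * indicator E z)"
    using assms by (intro L2_bounded_mult[of _ _ 1]) (auto simp: indicator_def)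
  also have "(\<lambda>z. x z * indicator E z) = (\<lambda>z. if z \<in> E then x z else 0)" by (auto simp: indicator_def)
  finally show ?thesis .
qed

lemma L2_norm_on_eq: "L2_norm_on E x = sqrt (LINT z|circle_measure. (cmod (if z \<in> E then x z else 0))\<^sup>2)"
  unfolding L2_norm_on_def set_lebesgue_integral_def
  by (intro arg_cong[where f = sqrt] Bochner_Integration.integral_cong) auto

lemma inner_on_eq: "inner_on E x y = (LINT z|circle_measure. (if z \<in> E then x z else 0) * cnj (y z))"
  unfolding inner_on_def set_lebesgue_integral_def
  by (intro Bochner_Integration.integral_cong) auto

lemma L2_norm_expand:
  assumes "L2 x" "L2 y"
  shows "(LINT z|circle_measure. (cmod (x z - of_real t * y z))\<^sup>2)
    = (LINT z|circle_measure. (cmod (x z))\<^sup>2) - 2 * t * Re (LINT z|circle_measure. y z * cnj (x z)) + t\<^sup>2 * (LINT z|circle_measure. (cmod (y z))\<^sup>2)"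
proof -
  have "(cmod (a - of_real t * b))\<^sup>2 = (cmod a)\<^sup>2 - 2 * t * Re (b * cnj a) + t\<^sup>2 * (cmod b)\<^sup>2" for a b
    unfolding cmod_power2 by (simp add: power2_eq_square algebra_simps)
  moreover have "integrable circle_measure (\<lambda>z. Re (y z * cnj (x z)))" "(LINT z|circle_measure. Re (y z * cnj (x z))) = Re (LINT z|circle_measure. y z * cnj (x z))"
    using L2_mult_integrable(2)[OF assms(2,1)] by (rule integrable_Re, rule integral_Re)
  ultimately show ?thesis using assms unfolding L2_def by simp
qed

section \<open>The conjugate kernel on the circle\<close>

lemma herg_imaginary:
  assumes "norm t = 1" "norm s = 1"
  shows "herg t s = \<i> * of_real (Im (herg t s))"
proof (cases "s = t")
  case False
  have "Re ((t + s) * cnj (t - s)) = (cmod t)\<^sup>2 - (cmod s)\<^sup>2"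
    unfolding cmod_power2 by (simp add: power2_eq_square algebra_simps)
  then have "Re (herg t s) = 0" unfolding herg_def using assms
    by (subst complex_div_cnj) (simp add: Re_divide_of_real[of _ "(cmod (t - s))\<^sup>2", simplified])
  then show ?thesis by (simp add: complex_eq_iff)
qed (simp add: herg_def)

text \<open>The kernel of the conjugate function: for \<open>t = cis x\<close> and
  \<open>s = cis y\<close> it is \<open>cot ((y - x) / 2)\<close>.\<close>

definition \<kappa> :: "complex \<Rightarrow> complex \<Rightarrow> real" where "\<kappa> t s = Im (herg t s)"

lemma abs_kappa_le:
  assumes "norm t = 1" "norm s = 1" shows "\<bar>\<kappa> t s\<bar> * norm (t - s) \<le> 2"
proof (cases "s = t")
  case False
  have "\<bar>\<kappa> t s\<bar> \<le> norm (herg t s)" unfolding \<kappa>_def by (rule abs_Im_le_cmod)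
  also have "\<dots> \<le> (1 + norm s) / norm (t - s)" using False assms by (intro norm_herg_le) auto
  finally show ?thesis using False assms by (simp add: field_simps)
qed (simp)

lemma kappa_measurable [measurable]:
  "f \<in> borel_measurable M \<Longrightarrow> g \<in> borel_measurable M \<Longrightarrow> (\<lambda>x. \<kappa> (f x) (g x)) \<in> borel_measurable M"
  unfolding \<kappa>_def by (rule measurable_compose[OF herg_measurable borel_measurable_Im])

interpretation circle2: pair_prob_space circle_measure circle_measure ..

section \<open>Variations of the solution\<close>

lemma ABEP_solution_iff:
  "ABEP_solution I J f g \<longleftrightarrow> g \<in> admissible J \<and>
     (\<forall>k\<in>admissible J. L2_norm_on I (\<lambda>z. f z - g z) \<le> L2_norm_on I (\<lambda>z. f z - k z))"
proof -
  have bdd: "bdd_below ((\<lambda>g. L2_norm_on I (\<lambda>z. f z - g z)) ` admissible J)"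
    by (intro bdd_belowI[of _ 0]) (auto simp: L2_norm_on_eq)
  show ?thesis unfolding ABEP_solution_def
  proof safe
    fix k assume "g \<in> admissible J" "L2_norm_on I (\<lambda>z. f z - g z) = (INF g\<in>admissible J. L2_norm_on I (\<lambda>z. f z - g z))"
      "k \<in> admissible J"
    then show "L2_norm_on I (\<lambda>z. f z - g z) \<le> L2_norm_on I (\<lambda>z. f z - k z)" using cINF_lower[OF bdd] by simp
  next
    assume *: "g \<in> admissible J" "\<forall>k\<in>admissible J. L2_norm_on I (\<lambda>z. f z - g z) \<le> L2_norm_on I (\<lambda>z. f z - k z)"
    then show "L2_norm_on I (\<lambda>z. f z - g z) = (INF g\<in>admissible J. L2_norm_on I (\<lambda>z. f z - g z))"
      by (intro antisym cINF_greatest cINF_lower[OF bdd]) auto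
  qed
qed

text \<open>All geometry of the arcs is condensed into the inequality with \<open>K\<close>: on
  \<open>J\<close> the product of the distances to finitely many points of the circle is dominated
  by the distance to any point of \<open>I\<close>.\<close>

locale extremal =
  fixes I J P :: "complex set" and K :: real and f g :: "complex \<Rightarrow> complex"
  assumes I [measurable]: "I \<in> sets circle_measure" and J: "J = unit_circle - I"
    and P: "finite P" "P \<subseteq> unit_circle"
    and K: "\<And>t s. t \<in> J \<Longrightarrow> s \<in> I \<Longrightarrow> (\<Prod>p\<in>P. norm (t - p)) \<le> K * norm (t - s)"
    and f: "f \<in> L2_on I" and sol: "ABEP_solution I J f g"
begin

lemma J_measurable [measurable]: "J \<in> sets circle_measure"
  using I sets.compl_sets[OF I] unfolding J by simp

lemma g_H2: "g \<in> H2" and g_le: "AE z in circle_measure. z \<in> J \<longrightarrow> cmod (g z) \<le> 1"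
  using sol by (auto simp: ABEP_solution_def admissible_def)

definition e where "e z = (if z \<in> I then f z - g z else 0)"

lemma g_L2: "L2 g" using g_H2 by (simp add: H2_L2)

lemma e_L2: "L2 e"
proof -
  have "L2 (\<lambda>z. (if z \<in> I then f z else 0) - (if z \<in> I then g z else 0))"
    using f by (intro L2_diff[OF _ L2_restrict[OF I g_L2]]) (simp add: L2_on_L2[OF I])
  also have "(\<lambda>z. (if z \<in> I then f z else 0) - (if z \<in> I then g z else 0)) = e" by (auto simp: e_def)
  finally show ?thesis .
qed

lemmas [measurable] = L2_measurable[OF g_L2] L2_measurable[OF e_L2]

text \<open>The admissible set is convex, so the segment from \<open>g\<close> to \<open>k\<close>
  consists of competitors; comparing squared errors along it for small parameters leaves the
  first-order term.\<close>

lemma variational_inequality: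
  assumes k: "k \<in> admissible J"
  shows "Re (LINT z|circle_measure. (k z - g z) * cnj (e z)) \<le> 0"
proof -
  define d where "d z = (if z \<in> I then k z - g z else 0)" for z
  have kH: "k \<in> H2" using k by (simp add: admissible_def)
  have d: "L2 d" unfolding d_def using kH g_L2 by (intro L2_restrict I L2_diff) (auto simp: H2_L2)
  let ?R = "Re (LINT z|circle_measure. d z * cnj (e z))" and ?D = "LINT z|circle_measure. (cmod (d z))\<^sup>2"
  have eq: "(LINT z|circle_measure. (k z - g z) * cnj (e z)) = (LINT z|circle_measure. d z * cnj (e z))"
    by (intro Bochner_Integration.integral_cong) (auto simp: d_def e_def)
  have D0: "?D \<ge> 0" by simp
  have key: "2 * ?R \<le> t * ?D" if t: "0 < t" "t \<le> 1" for t
  proof -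
    let ?k = "\<lambda>z. g z + of_real t * (k z - g z)"
    have "AE z in circle_measure. z \<in> J \<longrightarrow> cmod (k z) \<le> 1" using k by (simp add: admissible_def)
    then have "AE z in circle_measure. z \<in> J \<longrightarrow> cmod (?k z) \<le> 1"
      using g_le
    proof eventually_elim
      case (elim z)
      show ?case
      proof
        assume "z \<in> J"
        then have "cmod (g z) \<le> 1" "cmod (k z) \<le> 1" using elim by auto
        then have "(1 - t) * cmod (g z) + t * cmod (k z) \<le> (1 - t) * 1 + t * 1"
          using t by (intro add_mono mult_left_mono) auto
        moreover have "?k z = of_real (1 - t) * g z + of_real t * k z" by (simp add: algebra_simps)
        then have "cmod (?k z) \<le> (1 - t) * cmod (g z) + t * cmod (k z)"
          using norm_triangle_ineq[of "of_real (1 - t) * g z" "of_real t * k z"] t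
          by (simp add: norm_mult del: of_real_diff)
        ultimately show "cmod (?k z) \<le> 1" by simp
      qed
    qed
    moreover have "?k \<in> H2" using kH g_H2 by (intro H2_add H2_cmult H2_diff)
    ultimately have "?k \<in> admissible J" by (simp add: admissible_def)
    then have "L2_norm_on I (\<lambda>z. f z - g z) \<le> L2_norm_on I (\<lambda>z. f z - ?k z)"
      using bspec[OF conjunct2[OF sol[unfolded ABEP_solution_iff]]] by blast
    then have "(LINT z|circle_measure. (cmod (if z \<in> I then f z - g z else 0))\<^sup>2) \<le> (LINT z|circle_measure. (cmod (if z \<in> I then f z - ?k z else 0))\<^sup>2)"
      unfolding L2_norm_on_eq by simp
    moreover have "(\<lambda>z. if z \<in> I then f z - g z else 0) = e" by (auto simp: e_def)
    moreover have "(\<lambda>z. if z \<in> I then f z - ?k z else 0) = (\<lambda>z. e z - of_real t * d z)"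
      by (auto simp: e_def d_def)
    ultimately have "(LINT z|circle_measure. (cmod (e z))\<^sup>2) \<le> (LINT z|circle_measure. (cmod (e z - of_real t * d z))\<^sup>2)"
      by metis
    also note L2_norm_expand[OF e_L2 d, of t]
    finally have "t * (2 * ?R) \<le> t * (t * ?D)" by (simp add: power2_eq_square mult_ac)
    then show ?thesis using t by simp
  qed
  show ?thesis unfolding eq
  proof (rule ccontr)
    assume "\<not> ?R \<le> 0"
    then have R0: "0 < ?R" by simp
    have D1: "0 < ?D + 1" by (rule add_nonneg_pos[OF D0]) simp
    \<comment> \<open>This makes \<open>t * ?D\<close> at most \<open>?R\<close>, against the lower
      bound \<open>2 * ?R\<close>; the 1 guards against \<open>?D = 0\<close>.\<close>
    define t where "t = min 1 (?R / (?D + 1))"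
    have "0 < t" "t \<le> 1" using divide_pos_pos[OF R0 D1] by (auto simp: t_def)
    then have "2 * ?R \<le> t * ?D" by (rule key)
    also have "\<dots> \<le> ?R / (?D + 1) * ?D" by (rule mult_right_mono[OF _ D0]) (simp add: t_def)
    also have "\<dots> = ?R * (?D / (?D + 1))" by simp
    also have "\<dots> \<le> ?R * 1"
    proof (rule mult_left_mono)
      show "?D / (?D + 1) \<le> 1" by (subst pos_divide_le_eq[OF D1]) simp
    qed (use R0 in simp)
    finally show False using \<open>\<not> ?R \<le> 0\<close> by simp
  qed
qed

section \<open>The weight and the multiplier\<close>

definition \<rho> where "\<rho> t = (\<Prod>p\<in>P. norm (t - p))"

text \<open>\<open>lam\<close> is the conjugate function of \<open>k\<close>; off the closure of \<open>I\<close> it is given by an absolutely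
  convergent integral, of growth at most \<open>1 / \<rho>\<close> at the endpoints of \<open>I\<close>.\<close>
definition k where "k s = Re (\<i> * g s * cnj (e s))"

definition lam where "lam t = (LINT s|circle_measure. k s * \<kappa> t s)"

lemma rho_measurable [measurable]: "\<rho> \<in> borel_measurable circle_measure"
  unfolding \<rho>_def by measurable

lemma rho_nonneg: "0 \<le> \<rho> t"
  unfolding \<rho>_def by (intro prod_nonneg) auto

lemma rho_AE: "AE t in circle_measure. 0 < \<rho> t"
  using AE_circle_notin_finite[OF P(1)]
  by eventually_elim (auto simp: \<rho>_def intro!: prod_pos)

definition R where "R = (2::real) ^ card P"

lemma rho_le: "norm t = 1 \<Longrightarrow> \<rho> t \<le> R"
proof -
  assume t: "norm t = 1"
  have "\<rho> t \<le> (\<Prod>p\<in>P. 2)" unfolding \<rho>_def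
  proof (intro prod_mono conjI)
    fix p assume "p \<in> P"
    then have "norm p = 1" using P by auto
    then show "norm (t - p) \<le> 2" using norm_triangle_ineq4[of t p] t by simp
  qed auto
  then show ?thesis by (simp add: R_def)
qed

text \<open>The weight is at most a multiple of the distance from \<open>t\<close> to
  \<open>s\<close>, which is the order of the pole of the kernel.\<close>

lemma rho_kappa:
  assumes "t \<in> J" "s \<in> I" shows "\<rho> t * \<bar>\<kappa> t s\<bar> \<le> 2 * \<bar>K\<bar>"
proof -
  have t: "norm t = 1" "norm s = 1" using assms J sets.sets_into_space[OF I] by auto
  have "\<rho> t * \<bar>\<kappa> t s\<bar> \<le> (\<bar>K\<bar> * norm (t - s)) * \<bar>\<kappa> t s\<bar>"
    using K[OF assms] unfolding \<rho>_def
    by (intro mult_right_mono order_trans[OF K[OF assms]]) auto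
  also have "\<dots> = \<bar>K\<bar> * (\<bar>\<kappa> t s\<bar> * norm (t - s))" by (simp add: mult_ac)
  also have "\<dots> \<le> \<bar>K\<bar> * 2" using abs_kappa_le[OF t] by (intro mult_left_mono) auto
  finally show ?thesis by simp
qed

lemma ge_integrable: "integrable circle_measure (\<lambda>s. g s * cnj (e s))"
  by (rule L2_mult_integrable(2)[OF g_L2 e_L2])

lemma k_integrable: "integrable circle_measure k"
  unfolding k_def using integrable_Re[OF integrable_mult_right[OF ge_integrable, of "\<i>"]] by (simp add: mult.assoc)

lemma k_measurable [measurable]: "k \<in> borel_measurable circle_measure"
  using k_integrable by auto

lemma k_outside: "s \<notin> I \<Longrightarrow> k s = 0"
  by (simp add: k_def e_def)

lemma lam_measurable [measurable]: "lam \<in> borel_measurable circle_measure"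
  unfolding lam_def by measurable

lemma abs_lam_le:
  assumes "t \<in> J" shows "\<rho> t * \<bar>lam t\<bar> \<le> 2 * \<bar>K\<bar> * (LINT s|circle_measure. \<bar>k s\<bar>)"
proof -
  have "\<rho> t * \<bar>lam t\<bar> = \<bar>LINT s|circle_measure. \<rho> t * (k s * \<kappa> t s)\<bar>"
    using rho_nonneg[of t] by (simp add: lam_def abs_mult)
  also have "\<dots> \<le> (LINT s|circle_measure. \<bar>\<rho> t * (k s * \<kappa> t s)\<bar>)" by (rule integral_abs_bound)
  also have "\<dots> \<le> (LINT s|circle_measure. 2 * \<bar>K\<bar> * \<bar>k s\<bar>)"
  proof (rule integral_mono')
    show "integrable circle_measure (\<lambda>s. 2 * \<bar>K\<bar> * \<bar>k s\<bar>)" using k_integrable by auto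
    fix s
    show "\<bar>\<rho> t * (k s * \<kappa> t s)\<bar> \<le> 2 * \<bar>K\<bar> * \<bar>k s\<bar>"
    proof (cases "s \<in> I")
      case True
      from mult_right_mono[OF rho_kappa[OF assms True], of "\<bar>k s\<bar>"] show ?thesis
        using rho_nonneg[of t] by (simp add: abs_mult mult_ac)
    qed (simp add: k_outside)
  qed auto
  finally show ?thesis by simp
qed

text \<open>Domination by the weight bounds the double integrand by a constant times
  \<open>\<bar>k s\<bar>\<close>. The exchange turns the conjugate function of \<open>v\<close> on
  \<open>I\<close> into that of \<open>k\<close> on \<open>J\<close>.\<close>

lemma fubini_lam:
  assumes [measurable]: "v \<in> borel_measurable circle_measure" and v: "\<And>t. \<bar>v t\<bar> \<le> C * \<rho> t" "\<And>t. t \<notin> J \<Longrightarrow> v t = 0"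
  shows "(LINT s|circle_measure. k s * (LINT t|circle_measure. v t * \<kappa> t s)) = (LINT t|circle_measure. v t * lam t)"
proof -
  have bound: "\<bar>k s * (v t * \<kappa> t s)\<bar> \<le> \<bar>k s\<bar> * (\<bar>C\<bar> * (2 * \<bar>K\<bar>))" for s t
  proof (cases "s \<in> I \<and> t \<in> J")
    case True
    have "\<bar>v t\<bar> * \<bar>\<kappa> t s\<bar> \<le> \<bar>C\<bar> * \<rho> t * \<bar>\<kappa> t s\<bar>"
      by (intro mult_right_mono order_trans[OF v(1) mult_right_mono[OF abs_ge_self rho_nonneg]]) auto
    also have "\<dots> \<le> \<bar>C\<bar> * (2 * \<bar>K\<bar>)" using mult_left_mono[OF rho_kappa, of t s "\<bar>C\<bar>"] True by (simp add: mult_ac)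
    finally show ?thesis by (simp add: abs_mult mult_left_mono)
  qed (use k_outside v(2) in auto)
  have ii: "integrable circle_measure (\<lambda>t. k s * (v t * \<kappa> t s))" for s
    by (rule circle.integrable_const_bound[of _ "\<bar>k s\<bar> * (\<bar>C\<bar> * (2 * \<bar>K\<bar>))"]) (use bound in auto)
  have "integrable (circle_measure \<Otimes>\<^sub>M circle_measure) (\<lambda>(s, t). k s * (v t * \<kappa> t s))"
  proof (rule circle2.Fubini_integrable)
    show "integrable circle_measure (\<lambda>s. LINT t|circle_measure. norm (case (s, t) of (s, t) \<Rightarrow> k s * (v t * \<kappa> t s)))"
    proof (rule Bochner_Integration.integrable_bound)
      show "integrable circle_measure (\<lambda>s. \<bar>k s\<bar> * (\<bar>C\<bar> * (2 * \<bar>K\<bar>)))" using k_integrable by auto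
      show "AE s in circle_measure. norm (LINT t|circle_measure. norm (case (s, t) of (s, t) \<Rightarrow> k s * (v t * \<kappa> t s))) \<le> norm (\<bar>k s\<bar> * (\<bar>C\<bar> * (2 * \<bar>K\<bar>)))"
      proof (rule AE_I2)
        fix s
        have "(LINT t|circle_measure. \<bar>k s * (v t * \<kappa> t s)\<bar>) \<le> (LINT t|circle_measure. \<bar>k s\<bar> * (\<bar>C\<bar> * (2 * \<bar>K\<bar>)))"
          using ii[of s] bound by (intro integral_mono) auto
        also have "\<dots> = \<bar>k s\<bar> * (\<bar>C\<bar> * (2 * \<bar>K\<bar>))" using circle.prob_space by simp
        finally show "norm (LINT t|circle_measure. norm (case (s, t) of (s, t) \<Rightarrow> k s * (v t * \<kappa> t s))) \<le> norm (\<bar>k s\<bar> * (\<bar>C\<bar> * (2 * \<bar>K\<bar>)))"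
          by (simp add: abs_of_nonneg integral_nonneg_AE)
      qed
    qed measurable
  qed (use ii in auto)
  from circle2.Fubini_integral[OF this]
  have "(LINT t|circle_measure. LINT s|circle_measure. k s * (v t * \<kappa> t s)) = (LINT s|circle_measure. LINT t|circle_measure. k s * (v t * \<kappa> t s))" .
  moreover have "(LINT s|circle_measure. k s * (v t * \<kappa> t s)) = v t * lam t" for t
    unfolding lam_def by (simp flip: integral_mult_right_zero add: mult_ac)
  ultimately show ?thesis by simp
qed

text \<open>The competitor is \<open>(g + \<epsilon> h) \<phi>\<close>, with \<open>\<phi>\<close> the outer function of modulus
  \<open>exp (- \<epsilon> v - \<epsilon>\<^sup>2 w)\<close> on \<open>J\<close> and \<open>1\<close> on \<open>I\<close>. The weight \<open>\<rho>\<close> keeps the argument of \<open>\<phi>\<close> bounded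
  on \<open>I\<close>; the second-order term \<open>w\<close> leaves room to absorb the square of \<open>h\<close>.\<close>
lemma first_variation:
  assumes h: "h \<in> H2" and [measurable]: "v \<in> borel_measurable circle_measure" "w \<in> borel_measurable circle_measure"
    and v: "\<And>t. \<bar>v t\<bar> \<le> C * \<rho> t" "\<And>t. t \<notin> J \<Longrightarrow> v t = 0"
    and w: "\<And>t. \<bar>w t\<bar> \<le> C * \<rho> t" "\<And>t. t \<notin> J \<Longrightarrow> w t = 0"
    and \<epsilon>0: "0 < \<epsilon>0"
    and adm: "\<And>\<epsilon>. 0 < \<epsilon> \<Longrightarrow> \<epsilon> < \<epsilon>0 \<Longrightarrow> AE t in circle_measure. t \<in> J \<longrightarrow> cmod (g t + of_real \<epsilon> * h t) \<le> exp (\<epsilon> * v t + \<epsilon>\<^sup>2 * w t)"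
  shows "Re (LINT s|circle_measure. h s * cnj (e s)) \<le> (LINT t|circle_measure. v t * lam t)"
proof -
  \<comment> \<open>Conjugate functions of \<open>v\<close> and \<open>w\<close>, taken only on
    \<open>I\<close>, where the weight makes the integrals absolutely convergent.\<close>
  define V where "V s = (if s \<in> I then LINT t|circle_measure. v t * \<kappa> t s else 0)" for s
  define W where "W s = (if s \<in> I then LINT t|circle_measure. w t * \<kappa> t s else 0)" for s
  define A where "A = \<bar>C\<bar> * (2 * \<bar>K\<bar>)"
  have hL: "L2 h" using h by (simp add: H2_L2)
  note [measurable] = L2_measurable[OF hL]
  have I1: "norm s = 1" if "s \<in> I" for s using that sets.sets_into_space[OF I] by auto
  have bound: "\<bar>u t * \<kappa> t s\<bar> \<le> A" if "s \<in> I" and u: "\<And>t. \<bar>u t\<bar> \<le> C * \<rho> t" "\<And>t. t \<notin> J \<Longrightarrow> u t = 0" for u s t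
  proof (cases "t \<in> J")
    case True
    have "\<bar>u t\<bar> * \<bar>\<kappa> t s\<bar> \<le> \<bar>C\<bar> * \<rho> t * \<bar>\<kappa> t s\<bar>"
      by (intro mult_right_mono order_trans[OF u(1) mult_right_mono[OF abs_ge_self rho_nonneg]]) auto
    also have "\<dots> \<le> A" using mult_left_mono[OF rho_kappa[OF True that(1)], of "\<bar>C\<bar>"] by (simp add: mult_ac A_def)
    finally show ?thesis by (simp add: abs_mult)
  qed (simp add: u A_def)
  have iv: "integrable circle_measure (\<lambda>t. u t * \<kappa> t s)" if "s \<in> I" and u: "\<And>t. \<bar>u t\<bar> \<le> C * \<rho> t" "\<And>t. t \<notin> J \<Longrightarrow> u t = 0"
    "u \<in> borel_measurable circle_measure" for u s
    by (rule circle.integrable_const_bound[of _ A]) (use bound[OF that(1-3)] u(3) in auto)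
  have bI: "\<bar>LINT t|circle_measure. u t * \<kappa> t s\<bar> \<le> A" if "s \<in> I" and u: "\<And>t. \<bar>u t\<bar> \<le> C * \<rho> t" "\<And>t. t \<notin> J \<Longrightarrow> u t = 0"
    "u \<in> borel_measurable circle_measure" for u s
  proof -
    have "\<bar>LINT t|circle_measure. u t * \<kappa> t s\<bar> \<le> (LINT t|circle_measure. A)"
      by (rule Bochner_Integration.integral_abs_bound_integral) (use iv[OF that] bound[OF that(1-3)] in auto)
    then show ?thesis using circle.prob_space by simp
  qed
  have A0: "A \<ge> 0" by (simp add: A_def)
  have VA: "\<bar>V s\<bar> \<le> A" and WA: "\<bar>W s\<bar> \<le> A" for s
    unfolding V_def W_def using bI[OF _ v] bI[OF _ w] A0 by auto
  have [measurable]: "V \<in> borel_measurable circle_measure" "W \<in> borel_measurable circle_measure"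
    unfolding V_def W_def by measurable
  define E where "E \<epsilon> s = exp (- (\<i> * of_real (\<epsilon> * V s + \<epsilon>\<^sup>2 * W s)))" for \<epsilon> s
  have [measurable]: "E \<epsilon> \<in> borel_measurable circle_measure" for \<epsilon> unfolding E_def by measurable
  have E1: "norm (E \<epsilon> s) = 1" for \<epsilon> s by (simp add: E_def)
  have step: "Re (LINT s|circle_measure. ((g s + of_real \<epsilon> * h s) * E \<epsilon> s - g s) * cnj (e s)) \<le> 0"
    if \<epsilon>: "0 < \<epsilon>" "\<epsilon> < \<epsilon>0" for \<epsilon>
  proof -
    define u where "u t = \<epsilon> * v t + \<epsilon>\<^sup>2 * w t" for t
    have [measurable]: "u \<in> borel_measurable circle_measure" unfolding u_def by measurable
    have u: "\<bar>u t\<bar> \<le> (\<epsilon> + \<epsilon>\<^sup>2) * \<bar>C\<bar> * \<rho> t" for t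
    proof -
      have "\<bar>u t\<bar> \<le> \<epsilon> * \<bar>v t\<bar> + \<epsilon>\<^sup>2 * \<bar>w t\<bar>"
        unfolding u_def using \<epsilon> abs_triangle_ineq[of "\<epsilon> * v t" "\<epsilon>\<^sup>2 * w t"] by (simp add: abs_mult)
      also have "\<dots> \<le> \<epsilon> * (\<bar>C\<bar> * \<rho> t) + \<epsilon>\<^sup>2 * (\<bar>C\<bar> * \<rho> t)"
        using \<epsilon> by (intro add_mono mult_left_mono order_trans[OF v(1) mult_right_mono[OF abs_ge_self rho_nonneg]]
            order_trans[OF w(1) mult_right_mono[OF abs_ge_self rho_nonneg]]) auto
      finally show ?thesis by (simp add: algebra_simps)
    qed
    have uJ: "u t = 0" if "t \<notin> J" for t using v(2) w(2) that by (simp add: u_def)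
    have uB: "\<bar>u t\<bar> \<le> (\<epsilon> + \<epsilon>\<^sup>2) * \<bar>C\<bar> * R" for t
    proof (cases "t \<in> J")
      case True
      then have "\<rho> t \<le> R" using J by (intro rho_le) auto
      then show ?thesis using \<epsilon> by (intro order_trans[OF u] mult_left_mono) auto
    qed (use \<epsilon> uJ in \<open>auto simp: R_def\<close>)
    obtain \<phi> where [measurable]: "\<phi> \<in> borel_measurable circle_measure"
      and \<phi>1: "AE z in circle_measure. norm (\<phi> z) = exp (- u z)"
      and \<phi>2: "\<And>g. g \<in> H2 \<Longrightarrow> (\<lambda>z. g z * \<phi> z) \<in> H2"
      and \<phi>3: "AE s in circle_measure. \<forall>M. (AE t in circle_measure. \<bar>u t\<bar> \<le> M * norm (t - s)) \<longrightarrow>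
          \<phi> s = exp (- herglotz (\<lambda>s. of_real (u s)) s)"
      by (rule outer_function[of u, OF _ uB]) auto
    \<comment> \<open>At a point of \<open>I\<close> the function \<open>u\<close> vanishes to first
      order, so the boundary value of the outer function is explicit; its exponent is imaginary
      because the kernel is so on the circle.\<close>
    have \<phi>E: "AE s in circle_measure. s \<in> I \<longrightarrow> \<phi> s = E \<epsilon> s"
      using \<phi>3
    proof eventually_elim
      case (elim s)
      show ?case
      proof
        assume s: "s \<in> I"
        have "\<bar>u t\<bar> \<le> ((\<epsilon> + \<epsilon>\<^sup>2) * \<bar>C\<bar> * \<bar>K\<bar>) * norm (t - s)" for t
        proof (cases "t \<in> J")
          case True
          have "\<rho> t \<le> \<bar>K\<bar> * norm (t - s)" unfolding \<rho>_def by (intro order_trans[OF K[OF True s]] mult_right_mono) auto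
          then have "(\<epsilon> + \<epsilon>\<^sup>2) * \<bar>C\<bar> * \<rho> t \<le> (\<epsilon> + \<epsilon>\<^sup>2) * \<bar>C\<bar> * (\<bar>K\<bar> * norm (t - s))"
            using \<epsilon> by (intro mult_left_mono) auto
          then show ?thesis using u[of t] by (simp add: mult_ac)
        qed (use \<epsilon> uJ in auto)
        then have "\<phi> s = exp (- herglotz (\<lambda>s. of_real (u s)) s)" using elim by blast
        moreover have "herglotz (\<lambda>s. of_real (u s)) s = (LINT t|circle_measure. \<i> * of_real (u t * \<kappa> t s))"
          unfolding herglotz_def
        proof (rule Bochner_Integration.integral_cong[OF refl])
          fix t assume "t \<in> space circle_measure"
          then have "herg t s = \<i> * of_real (\<kappa> t s)" unfolding \<kappa>_def using I1[OF s] by (intro herg_imaginary) auto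
          then show "of_real (u t) * herg t s = \<i> * of_real (u t * \<kappa> t s)" by simp
        qed
        moreover have "(LINT t|circle_measure. u t * \<kappa> t s) = \<epsilon> * V s + \<epsilon>\<^sup>2 * W s"
        proof -
          have "(LINT t|circle_measure. u t * \<kappa> t s) = (LINT t|circle_measure. \<epsilon> * (v t * \<kappa> t s) + \<epsilon>\<^sup>2 * (w t * \<kappa> t s))"
            by (simp add: u_def algebra_simps)
          also have "\<dots> = \<epsilon> * V s + \<epsilon>\<^sup>2 * W s"
            using iv[OF s v] iv[OF s w] s by (simp add: V_def W_def)
          finally show ?thesis .
        qed
        ultimately show "\<phi> s = E \<epsilon> s" unfolding E_def by (simp del: of_real_mult of_real_add of_real_power)
      qed
    qed
    let ?k = "\<lambda>z. (g z + of_real \<epsilon> * h z) * \<phi> z"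
    have "?k \<in> H2" by (intro \<phi>2 H2_add H2_cmult g_H2 h)
    moreover have "AE t in circle_measure. t \<in> J \<longrightarrow> cmod (?k t) \<le> 1"
      using adm[OF \<epsilon>] \<phi>1
    proof eventually_elim
      case (elim t)
      show ?case
      proof
        assume "t \<in> J"
        then have "cmod (?k t) \<le> exp (u t) * exp (- u t)"
          using elim unfolding norm_mult u_def by (intro mult_mono) auto
        then show "cmod (?k t) \<le> 1" by (simp flip: exp_add)
      qed
    qed
    ultimately have "?k \<in> admissible J" by (simp add: admissible_def)
    from variational_inequality[OF this]
    have "Re (LINT z|circle_measure. (?k z - g z) * cnj (e z)) \<le> 0" .
    moreover have "(LINT z|circle_measure. (?k z - g z) * cnj (e z)) = (LINT s|circle_measure. ((g s + of_real \<epsilon> * h s) * E \<epsilon> s - g s) * cnj (e s))"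
    proof (rule integral_cong_AE)
      show "AE z in circle_measure. (?k z - g z) * cnj (e z) = ((g z + of_real \<epsilon> * h z) * E \<epsilon> z - g z) * cnj (e z)"
        using \<phi>E by eventually_elim (auto simp: e_def)
    qed (auto intro!: borel_measurable_times measurable_circle_cnj)
    ultimately show ?thesis by simp
  qed
  \<comment> \<open>Parameters at most 1 allow
    \<open>(\<epsilon> n)\<^sup>2 \<le> \<epsilon> n\<close> in the dominating bound.\<close>
  define \<epsilon> where "\<epsilon> n = min \<epsilon>0 1 / 2 * inverse (real (Suc n))" for n
  have \<epsilon>: "0 < \<epsilon> n" "\<epsilon> n < \<epsilon>0" "\<epsilon> n \<le> 1" for n
  proof -
    have i: "0 < inverse (real (Suc n))" "inverse (real (Suc n)) \<le> 1" by (auto simp: field_simps)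
    show "0 < \<epsilon> n" unfolding \<epsilon>_def using \<epsilon>0 i by (intro mult_pos_pos) auto
    have "\<epsilon> n \<le> min \<epsilon>0 1 / 2 * 1" unfolding \<epsilon>_def using \<epsilon>0 i by (intro mult_left_mono) auto
    then show "\<epsilon> n < \<epsilon>0" "\<epsilon> n \<le> 1" using \<epsilon>0 by linarith+
  qed
  have \<epsilon>lim: "\<epsilon> \<longlonglongrightarrow> 0"
    unfolding \<epsilon>_def using tendsto_mult_left[OF LIMSEQ_inverse_real_of_nat] by fastforce
  define X where "X n s = ((g s + of_real (\<epsilon> n) * h s) * E (\<epsilon> n) s - g s) / of_real (\<epsilon> n) * cnj (e s)" for n s
  have [measurable]: "(\<lambda>s. cnj (e s)) \<in> borel_measurable circle_measure" by (intro measurable_circle_cnj) measurable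
  have [measurable]: "X n \<in> borel_measurable circle_measure" for n unfolding X_def by measurable
  have "(\<lambda>n. LINT s|circle_measure. X n s) \<longlonglongrightarrow> (LINT s|circle_measure. (h s - \<i> * of_real (V s) * g s) * cnj (e s))"
  proof (rule integral_dominated_convergence)
    show "integrable circle_measure (\<lambda>s. 2 * A * (cmod (g s) * cmod (e s)) + cmod (h s) * cmod (e s))"
      using L2_mult_integrable(1)[OF g_L2 e_L2] L2_mult_integrable(1)[OF hL e_L2] by auto
    show "AE s in circle_measure. (\<lambda>n. X n s) \<longlonglongrightarrow> (h s - \<i> * of_real (V s) * g s) * cnj (e s)"
    proof (rule AE_I2)
      fix s
      \<comment> \<open>With a complex parameter in place of the real one, the limit of the
        quotients is a complex derivative at 0.\<close>
      let ?Y = "\<lambda>z. (g s + z * h s) * exp (- (\<i> * (z * of_real (V s) + z\<^sup>2 * of_real (W s))))"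
      have "(?Y has_field_derivative (h s - \<i> * of_real (V s) * g s)) (at 0)"
        by (auto intro!: derivative_eq_intros)
      then have "((\<lambda>z. (?Y (0 + z) - ?Y 0) / z) \<longlongrightarrow> h s - \<i> * of_real (V s) * g s) (at 0)" by (rule DERIV_D)
      moreover have "filterlim (\<lambda>n. complex_of_real (\<epsilon> n)) (at 0) sequentially"
        unfolding filterlim_at using tendsto_of_real[OF \<epsilon>lim, where ?'a = complex] \<epsilon>(1)
        by (auto intro!: always_eventually simp: less_imp_neq[symmetric])
      ultimately have "(\<lambda>n. (?Y (0 + of_real (\<epsilon> n)) - ?Y 0) / of_real (\<epsilon> n)) \<longlonglongrightarrow> h s - \<i> * of_real (V s) * g s"
        by (rule filterlim_compose)
      then have "(\<lambda>n. (?Y (0 + of_real (\<epsilon> n)) - ?Y 0) / of_real (\<epsilon> n) * cnj (e s)) \<longlonglongrightarrow> (h s - \<i> * of_real (V s) * g s) * cnj (e s)"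
        by (intro tendsto_mult_right)
      then show "(\<lambda>n. X n s) \<longlonglongrightarrow> (h s - \<i> * of_real (V s) * g s) * cnj (e s)"
        by (simp add: X_def E_def)
    qed
    show "AE s in circle_measure. norm (X n s) \<le> 2 * A * (cmod (g s) * cmod (e s)) + cmod (h s) * cmod (e s)" for n
    proof (rule AE_I2)
      fix s
      define x where "x = - (\<epsilon> n * V s + (\<epsilon> n)\<^sup>2 * W s)"
      have "\<bar>x\<bar> \<le> \<epsilon> n * \<bar>V s\<bar> + (\<epsilon> n)\<^sup>2 * \<bar>W s\<bar>"
        unfolding x_def using \<epsilon>(1)[of n] abs_triangle_ineq[of "\<epsilon> n * V s" "(\<epsilon> n)\<^sup>2 * W s"] by (simp add: abs_mult)
      also have "\<dots> \<le> \<epsilon> n * A + \<epsilon> n * A"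
        using \<epsilon>[of n] VA[of s] WA[of s] by (intro add_mono mult_mono) (auto simp: power2_eq_square mult_le_one mult_left_le)
      finally have x: "\<bar>x\<bar> \<le> \<epsilon> n * (2 * A)" by (simp add: mult_ac)
      \<comment> \<open>A chord is no longer than its arc, so \<open>E (\<epsilon> n) s - 1\<close>
        is of order \<open>\<epsilon> n\<close> uniformly in \<open>s\<close>.\<close>
      have "E (\<epsilon> n) s = exp (\<i> * of_real x)" unfolding E_def x_def by (simp only: of_real_minus mult_minus_right)
      then have "norm (E (\<epsilon> n) s - 1) = 2 * \<bar>sin (x / 2)\<bar>" by (simp only: dist_exp_i_1)
      also have "\<dots> \<le> 2 * \<bar>x / 2\<bar>" by (intro mult_left_mono abs_sin_x_le_abs_x) auto
      finally have Ex: "norm (E (\<epsilon> n) s - 1) \<le> \<epsilon> n * (2 * A)" using x by simp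
      have "(g s + of_real (\<epsilon> n) * h s) * E (\<epsilon> n) s - g s = g s * (E (\<epsilon> n) s - 1) + of_real (\<epsilon> n) * h s * E (\<epsilon> n) s"
        by (simp add: algebra_simps)
      also have "norm \<dots> \<le> cmod (g s) * norm (E (\<epsilon> n) s - 1) + \<epsilon> n * cmod (h s)"
        using norm_triangle_ineq[of "g s * (E (\<epsilon> n) s - 1)" "of_real (\<epsilon> n) * h s * E (\<epsilon> n) s"] \<epsilon>(1)[of n]
        by (simp add: norm_mult E1)
      also have "\<dots> \<le> cmod (g s) * (\<epsilon> n * (2 * A)) + \<epsilon> n * cmod (h s)"
        by (rule add_right_mono[OF mult_left_mono[OF Ex norm_ge_zero]])
      also have "\<dots> = \<epsilon> n * (2 * A * cmod (g s) + cmod (h s))" by (simp add: algebra_simps)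
      finally have "norm (((g s + of_real (\<epsilon> n) * h s) * E (\<epsilon> n) s - g s) / of_real (\<epsilon> n)) \<le> 2 * A * cmod (g s) + cmod (h s)"
        using \<epsilon>(1)[of n] by (simp add: norm_divide field_simps)
      from mult_right_mono[OF this, of "cmod (e s)"]
      show "norm (X n s) \<le> 2 * A * (cmod (g s) * cmod (e s)) + cmod (h s) * cmod (e s)"
        unfolding X_def norm_mult complex_mod_cnj by (simp add: algebra_simps)
    qed
  qed measurable
  then have lim: "(\<lambda>n. Re (LINT s|circle_measure. X n s)) \<longlonglongrightarrow> Re (LINT s|circle_measure. (h s - \<i> * of_real (V s) * g s) * cnj (e s))"
    by (rule tendsto_Re)
  have neg: "Re (LINT s|circle_measure. X n s) \<le> 0" for n
  proof -
    define Y where "Y = (LINT s|circle_measure. ((g s + of_real (\<epsilon> n) * h s) * E (\<epsilon> n) s - g s) * cnj (e s))"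
    have "(LINT s|circle_measure. X n s) = (LINT s|circle_measure. of_real (inverse (\<epsilon> n)) * (((g s + of_real (\<epsilon> n) * h s) * E (\<epsilon> n) s - g s) * cnj (e s)))"
      by (intro Bochner_Integration.integral_cong) (auto simp: X_def field_simps)
    also have "\<dots> = of_real (inverse (\<epsilon> n)) * Y"
      unfolding Y_def by (rule integral_mult_right_zero)
    finally have "Re (LINT s|circle_measure. X n s) = inverse (\<epsilon> n) * Re Y"
      by (simp only: times_complex.simps Re_complex_of_real Im_complex_of_real mult_zero_left diff_zero)
    moreover have "Re Y \<le> 0" unfolding Y_def by (rule step[OF \<epsilon>(1)[of n] \<epsilon>(2)[of n]])
    ultimately show ?thesis using \<epsilon>(1)[of n] by (simp add: mult_nonneg_nonpos)
  qed
  have le: "Re (LINT s|circle_measure. (h s - \<i> * of_real (V s) * g s) * cnj (e s)) \<le> 0"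
    by (rule LIMSEQ_le_const2[OF lim]) (intro exI allI impI neg)
  have ih: "integrable circle_measure (\<lambda>s. h s * cnj (e s))" by (rule L2_mult_integrable(2)[OF hL e_L2])
  have ig: "integrable circle_measure (\<lambda>s. g s * cnj (e s) * (\<i> * of_real (V s)))"
    using VA by (intro integrable_mult_bounded[OF ge_integrable, of _ A]) (auto simp: norm_mult)
  have "(LINT s|circle_measure. (h s - \<i> * of_real (V s) * g s) * cnj (e s))
      = (LINT s|circle_measure. h s * cnj (e s) - g s * cnj (e s) * (\<i> * of_real (V s)))"
    by (simp add: algebra_simps)
  with le have "Re (LINT s|circle_measure. h s * cnj (e s)) \<le> Re (LINT s|circle_measure. g s * cnj (e s) * (\<i> * of_real (V s)))"
    using ih ig by simp
  also have "\<dots> = (LINT s|circle_measure. k s * V s)"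
    unfolding integral_Re[OF ig, symmetric] by (intro Bochner_Integration.integral_cong) (auto simp: k_def algebra_simps)
  also have "\<dots> = (LINT s|circle_measure. k s * (LINT t|circle_measure. v t * \<kappa> t s))"
    by (intro Bochner_Integration.integral_cong) (auto simp: V_def k_outside)
  also have "\<dots> = (LINT t|circle_measure. v t * lam t)"
    by (rule fubini_lam[OF _ v]) auto
  finally show ?thesis .
qed

end

lemma herg_swap: "herg s w = - herg w s"
  unfolding herg_def by (metis add.commute minus_diff_eq minus_divide_right)

context extremal
begin

section \<open>Sign and integrability of the multiplier\<close>

lemma v_lam_integrable:
  assumes [measurable]: "v \<in> borel_measurable circle_measure"
    and v: "\<And>t. \<bar>v t\<bar> \<le> C * \<rho> t" "\<And>t. t \<notin> J \<Longrightarrow> v t = 0"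
  shows "integrable circle_measure (\<lambda>t. v t * lam t)"
proof (rule circle.integrable_const_bound)
  show "AE t in circle_measure. norm (v t * lam t) \<le> \<bar>C\<bar> * (2 * \<bar>K\<bar> * (LINT s|circle_measure. \<bar>k s\<bar>))"
  proof (rule AE_I2)
    fix t
    show "norm (v t * lam t) \<le> \<bar>C\<bar> * (2 * \<bar>K\<bar> * (LINT s|circle_measure. \<bar>k s\<bar>))"
    proof (cases "t \<in> J")
      case True
      have "\<bar>v t\<bar> * \<bar>lam t\<bar> \<le> \<bar>C\<bar> * \<rho> t * \<bar>lam t\<bar>"
        by (intro mult_right_mono order_trans[OF v(1) mult_right_mono[OF abs_ge_self rho_nonneg]]) auto
      also have "\<dots> \<le> \<bar>C\<bar> * (2 * \<bar>K\<bar> * (LINT s|circle_measure. \<bar>k s\<bar>))"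
        unfolding mult.assoc using abs_lam_le[OF True] by (intro mult_left_mono) (auto simp: mult.assoc)
      finally show ?thesis by (simp add: abs_mult)
    next
      case False
      have "0 \<le> (LINT s|circle_measure. \<bar>k s\<bar>)" by (intro integral_nonneg_AE AE_I2) auto
      then show ?thesis using v(2)[OF False] by simp
    qed
  qed
qed measurable

text \<open>With \<open>h = 0\<close> the first variation makes the integral of
  \<open>v * lam\<close> nonnegative, so a nonpositive integrand vanishes.\<close>

lemma nonpos_variation_zero:
  assumes [measurable]: "v \<in> borel_measurable circle_measure"
    and v: "\<And>t. \<bar>v t\<bar> \<le> C * \<rho> t" "\<And>t. t \<notin> J \<Longrightarrow> v t = 0"
    and \<epsilon>0: "0 < \<epsilon>0"
    and adm: "\<And>\<epsilon>. 0 < \<epsilon> \<Longrightarrow> \<epsilon> < \<epsilon>0 \<Longrightarrow> AE t in circle_measure. t \<in> J \<longrightarrow> cmod (g t) \<le> exp (\<epsilon> * v t)"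
    and nonpos: "\<And>t. v t * lam t \<le> 0"
  shows "AE t in circle_measure. v t * lam t = 0"
proof -
  have C: "0 \<le> C * \<rho> t" for t using v(1)[of t] abs_ge_zero[of "v t"] by linarith
  have "0 \<le> (LINT t|circle_measure. v t * lam t)"
    using first_variation[OF H2_zero _ _ v, of "\<lambda>_. 0" \<epsilon>0] \<epsilon>0 adm C by simp
  moreover have i: "integrable circle_measure (\<lambda>t. - (v t * lam t))" using v_lam_integrable[OF _ v] by simp
  moreover have "0 \<le> (LINT t|circle_measure. - (v t * lam t))"
    using nonpos by (intro integral_nonneg_AE AE_I2) simp
  ultimately have "(LINT t|circle_measure. - (v t * lam t)) = 0" by simp
  then show ?thesis using integral_nonneg_eq_0_iff_AE[OF i] nonpos by simp
qed

text \<open>A nonnegative \<open>v\<close> is always allowed since \<open>cmod (g t) \<le> 1\<close>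
  on \<open>J\<close>; it is placed where \<open>lam\<close> would be negative.\<close>

lemma lam_nonneg: "AE t in circle_measure. t \<in> J \<longrightarrow> 0 \<le> lam t"
proof -
  let ?v = "\<lambda>t. if t \<in> J \<and> lam t < 0 then \<rho> t else 0"
  have "AE t in circle_measure. ?v t * lam t = 0"
  proof (rule nonpos_variation_zero[of ?v 1 1])
    show "?v \<in> borel_measurable circle_measure" by measurable
    fix \<epsilon> :: real assume "0 < \<epsilon>"
    then have e1: "1 \<le> exp (\<epsilon> * ?v t)" for t using rho_nonneg[of t] by simp
    show "AE t in circle_measure. t \<in> J \<longrightarrow> cmod (g t) \<le> exp (\<epsilon> * ?v t)"
      using g_le by eventually_elim (blast intro: order_trans[OF _ e1])
  qed (use rho_nonneg in \<open>auto simp: mult_nonneg_nonpos\<close>)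
  then show ?thesis using rho_AE by eventually_elim (auto split: if_splits)
qed

text \<open>Complementary slackness: where the constraint has slack \<delta>, a negative
  \<open>v\<close> is allowed too. The range \<open>\<epsilon> < \<delta> / R\<close> keeps
  \<open>\<epsilon> * \<rho> t\<close> at most \<delta>, so that
  \<open>1 - \<delta> \<le> exp (- (\<epsilon> * \<rho> t))\<close>.\<close>

lemma lam_zero_if_small:
  assumes \<delta>: "\<delta> > 0"
  shows "AE t in circle_measure. t \<in> J \<and> cmod (g t) \<le> 1 - \<delta> \<longrightarrow> lam t = 0"
proof -
  let ?v = "\<lambda>t. if t \<in> J \<and> cmod (g t) \<le> 1 - \<delta> \<and> lam t > 0 then - \<rho> t else 0"
  have R: "R > 0" by (simp add: R_def)
  have "AE t in circle_measure. ?v t * lam t = 0"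
  proof (rule nonpos_variation_zero[of ?v 1 "\<delta> / R"])
    show "?v \<in> borel_measurable circle_measure" by measurable
    show "0 < \<delta> / R" using \<delta> R by simp
    fix \<epsilon> :: real assume \<epsilon>: "0 < \<epsilon>" "\<epsilon> < \<delta> / R"
    show "AE t in circle_measure. t \<in> J \<longrightarrow> cmod (g t) \<le> exp (\<epsilon> * ?v t)"
      using g_le
    proof eventually_elim
      case (elim t)
      show ?case
      proof
        assume t: "t \<in> J"
        have "\<epsilon> * \<rho> t \<le> \<delta> / R * R" using \<epsilon> R t J rho_nonneg rho_le[of t] by (intro mult_mono) auto
        then have "1 - \<delta> \<le> 1 + \<epsilon> * - \<rho> t" using R by simp
        also have "\<dots> \<le> exp (\<epsilon> * - \<rho> t)" by (rule exp_ge_add_one_self)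
        finally show "cmod (g t) \<le> exp (\<epsilon> * ?v t)" using elim t by auto
      qed
    qed
  qed (use rho_nonneg in \<open>auto simp: mult_nonneg_nonneg\<close>)
  then show ?thesis using rho_AE lam_nonneg by eventually_elim (auto split: if_splits)
qed

text \<open>Shrinking \<open>g\<close> by the factor \<open>1 - \<epsilon>\<close> allows it to be multiplied on \<open>J\<close> by a function of modulus
  \<open>exp (\<epsilon> u)\<close> with \<open>0 \<le> u \<le> 1\<close>; this bounds the integral of \<open>u * lam\<close> uniformly in \<open>u\<close>.\<close>
lemma lam_integrable: "integrable circle_measure (\<lambda>t. if t \<in> J then lam t else 0)"
proof -
  \<comment> \<open>Each \<open>v n\<close> is dominated by a multiple of the weight, as the first
    variation requires, and off \<open>P\<close> the sequence increases to the indicator of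
    \<open>J\<close>.\<close>
  define v where "v n t = (if t \<in> J then min 1 (real n * \<rho> t) else 0)" for n t
  have [measurable]: "v n \<in> borel_measurable circle_measure" for n unfolding v_def by measurable
  have v: "\<bar>- v n t\<bar> \<le> real n * \<rho> t" "t \<notin> J \<Longrightarrow> - v n t = 0" for n t
    using rho_nonneg[of t] by (auto simp: v_def)
  define C where "C = Re (LINT s|circle_measure. g s * cnj (e s))"
  have i: "integrable circle_measure (\<lambda>t. v n t * lam t)" for n
    using v_lam_integrable[of "\<lambda>t. - v n t", OF _ v] by simp
  have le: "(LINT t|circle_measure. v n t * lam t) \<le> C" for n
  proof -
    \<comment> \<open>The direction \<open>h = - g\<close> is the shrinking of \<open>g\<close>; the
      resulting bound \<open>C\<close> does not depend on \<open>n\<close>.\<close>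
    have "Re (LINT s|circle_measure. (- 1 * g s) * cnj (e s)) \<le> (LINT t|circle_measure. - v n t * lam t)"
    proof (rule first_variation[of _ "\<lambda>t. - v n t" "\<lambda>_. 0", OF _ _ _ v])
      show "(\<lambda>s. - 1 * g s) \<in> H2" by (intro H2_cmult g_H2)
      show "(0::real) < 1" by simp
      fix \<epsilon> :: real assume \<epsilon>: "0 < \<epsilon>" "\<epsilon> < 1"
      show "AE t in circle_measure. t \<in> J \<longrightarrow> cmod (g t + of_real \<epsilon> * (- 1 * g t)) \<le> exp (\<epsilon> * - v n t + \<epsilon>\<^sup>2 * 0)"
        using g_le
      proof eventually_elim
        case (elim t)
        show ?case
        proof
          assume "t \<in> J"
          have "g t + of_real \<epsilon> * (- 1 * g t) = of_real (1 - \<epsilon>) * g t" by (simp add: algebra_simps)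
          then have "cmod (g t + of_real \<epsilon> * (- 1 * g t)) = (1 - \<epsilon>) * cmod (g t)"
            using \<epsilon> by (simp only: norm_mult norm_of_real)
          also have "\<dots> \<le> (1 - \<epsilon>) * 1" using elim \<open>t \<in> J\<close> \<epsilon> by (intro mult_left_mono) auto
          also have "\<dots> \<le> 1 + \<epsilon> * - v n t" using \<epsilon> mult_left_mono[of "v n t" 1 \<epsilon>] by (auto simp: v_def)
          also have "\<dots> \<le> exp (\<epsilon> * - v n t)" by (rule exp_ge_add_one_self)
          finally show "cmod (g t + of_real \<epsilon> * (- 1 * g t)) \<le> exp (\<epsilon> * - v n t + \<epsilon>\<^sup>2 * 0)" by simp
        qed
      qed
    qed (use rho_nonneg in auto)
    then show ?thesis by (simp add: C_def)
  qed
  define Y where "Y n = (LINT t|circle_measure. v n t * lam t)" for n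
  have mono: "AE t in circle_measure. mono (\<lambda>n. v n t * lam t)"
    using lam_nonneg
  proof eventually_elim
    case (elim t)
    show ?case
    proof (rule monoI)
      fix n m :: nat assume "n \<le> m"
      then have "real n * \<rho> t \<le> real m * \<rho> t" using rho_nonneg[of t] by (intro mult_right_mono) auto
      then have "v n t \<le> v m t" by (auto simp: v_def)
      then show "v n t * lam t \<le> v m t * lam t" using elim by (cases "t \<in> J") (auto simp: v_def intro: mult_right_mono)
    qed
  qed
  have mY: "mono Y" unfolding Y_def
  proof (rule monoI)
    fix n m :: nat assume "n \<le> m"
    then show "(LINT t|circle_measure. v n t * lam t) \<le> (LINT t|circle_measure. v m t * lam t)"
      using i mono by (intro integral_mono_AE) (auto elim!: eventually_mono dest: monoD)
  qed
  have leY: "Y n \<le> C" for n using le by (simp add: Y_def)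
  obtain L where L: "Y \<longlonglongrightarrow> L" using incseq_convergent[of Y C] mY leY by metis
  show ?thesis
  proof (rule integrable_monotone_convergence[OF i mono _ L[unfolded Y_def]])
    show "AE t in circle_measure. (\<lambda>n. v n t * lam t) \<longlonglongrightarrow> (if t \<in> J then lam t else 0)"
      using rho_AE
    proof eventually_elim
      case (elim t)
      obtain N :: nat where N: "1 < real N * \<rho> t" using reals_Archimedean3[OF elim] by blast
      have "v n t * lam t = (if t \<in> J then lam t else 0)" if "n \<ge> N" for n
      proof -
        have "real N * \<rho> t \<le> real n * \<rho> t" using that elim by (intro mult_right_mono) auto
        then show ?thesis using N by (simp add: v_def)
      qed
      then show ?case by (intro tendsto_eventually eventually_sequentiallyI[of N])
    qed
  qed measurable
qed

section \<open>The degenerate case of a vanishing multiplier\<close>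

definition P0 where "P0 z = (\<Prod>p\<in>P. z - p)"

lemma norm_P0: "cmod (P0 z) = \<rho> z"
  by (simp add: P0_def \<rho>_def prod_norm)

text \<open>When \<open>lam = 0\<close>, a polynomial divisible by \<open>P0\<close> can be
  compensated by \<open>v = \<rho>\<close> at no cost. Hence \<open>P0 * cnj e\<close> has no
  Fourier coefficient of index at most 0, its transform vanishes outside the disc, and the gap
  around \<open>t0\<close> lets the zeros spread.\<close>

lemma lam_zero_imp_trace:
  assumes lam0: "\<And>t. lam t = 0" and t0: "norm t0 = 1" and r: "r > 0" and disj: "ball t0 r \<inter> I = {}"
  shows "AE z in circle_measure. z \<in> I \<longrightarrow> f z = g z"
proof -
  define x where "x n = (LINT s|circle_measure. P0 s * s ^ n * cnj (e s))" for n :: nat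
  have PH: "(\<lambda>s. c * (s ^ n * P0 s)) \<in> H2" for c n
    unfolding P0_def by (intro H2_cmult H2_mult_prod P H2_powers)
  have x0: "x n = 0" for n
  proof -
    have *: "Re (c * x n) \<le> 0" if c: "norm c = 1" for c
    proof -
      have "Re (LINT s|circle_measure. c * (s ^ n * P0 s) * cnj (e s)) \<le> (LINT t|circle_measure. (if t \<in> J then \<rho> t else 0) * lam t)"
      proof (rule first_variation[of _ "\<lambda>t. if t \<in> J then \<rho> t else 0" "\<lambda>_. 0" 1 1])
        fix \<epsilon> :: real assume \<epsilon>: "0 < \<epsilon>"
        show "AE t in circle_measure. t \<in> J \<longrightarrow> cmod (g t + of_real \<epsilon> * (c * (t ^ n * P0 t))) \<le> exp (\<epsilon> * (if t \<in> J then \<rho> t else 0) + \<epsilon>\<^sup>2 * 0)"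
          using g_le AE_circle_norm
        proof eventually_elim
          case (elim t)
          show ?case
          proof
            assume t: "t \<in> J"
            have "cmod (g t + of_real \<epsilon> * (c * (t ^ n * P0 t))) \<le> 1 + \<epsilon> * \<rho> t"
              using elim t c \<epsilon> norm_triangle_ineq[of "g t" "of_real \<epsilon> * (c * (t ^ n * P0 t))"]
              by (simp add: norm_mult norm_power norm_P0)
            also have "\<dots> \<le> exp (\<epsilon> * \<rho> t)" by (rule exp_ge_add_one_self)
            finally show "cmod (g t + of_real \<epsilon> * (c * (t ^ n * P0 t))) \<le> exp (\<epsilon> * (if t \<in> J then \<rho> t else 0) + \<epsilon>\<^sup>2 * 0)"
              using t by simp
          qed
        qed
      qed (use rho_nonneg PH in auto)
      also have "\<dots> = 0" by (simp add: lam0)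
      also have "(LINT s|circle_measure. c * (s ^ n * P0 s) * cnj (e s)) = c * x n"
        unfolding x_def integral_mult_right_zero[symmetric] by (simp add: mult_ac)
      finally show ?thesis .
    qed
    \<comment> \<open>The four units turn the one-sided real inequality into a complex
      equality.\<close>
    show ?thesis
      using *[of 1] *[of "-1"] *[of "\<i>"] *[of "-\<i>"] by (auto simp: complex_eq_iff)
  qed
  define F where "F s = P0 s * cnj (e s)" for s
  have F: "integrable circle_measure F"
    unfolding F_def using PH[of 1 0] by (intro L2_mult_integrable(2) e_L2) (simp add: H2_L2)
  have "AE s in circle_measure. F s = 0"
  proof (rule herglotz_zeros_imp_AE_zero[OF F t0 r, of "{w. norm w > 1}" 2])
    show "AE s in circle_measure. s \<in> ball t0 r \<longrightarrow> F s = 0"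
      using disj by (intro AE_I2) (auto simp: F_def e_def)
    have "{w::complex. norm w > 1} = - cball 0 1" by auto
    then have "open {w::complex. norm w > 1}" by (metis closed_cball open_Compl)
    then show "2 islimpt {w::complex. norm w > 1}" by (intro open_imp_islimpt) auto
    fix w :: complex assume "w \<in> {w. norm w > 1}"
    then have w: "norm w > 1" by simp
    define w' where "w' = 1 / cnj w"
    have w': "norm w' < 1" "w' \<noteq> 0" "1 / cnj w' = w" using w by (auto simp: w'_def norm_divide divide_less_eq)
    have cF: "integrable circle_measure (\<lambda>s. cnj (F s))" using F by simp
    \<comment> \<open>The coefficient of \<open>F\<close> of index \<open>- n\<close> is
      \<open>x n\<close>; conjugation moves it to index \<open>n\<close>, where the expansion in the
      disc sees it.\<close>
    have "fourier_coeff (\<lambda>s. cnj (F s)) (int n) = 0" for n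
    proof -
      have "fourier_coeff F (- int n) = x n" unfolding fourier_coeff_def x_def F_def
        by (intro Bochner_Integration.integral_cong) (auto simp: mult_ac)
      then show ?thesis using x0 by (simp add: fourier_coeff_cnj)
    qed
    then have "(\<lambda>n. 0) sums herglotz (\<lambda>s. cnj (F s)) w'" using herglotz_sums[OF cF w'(1)] by simp
    then have "herglotz (\<lambda>s. cnj (F s)) w' = 0" by (metis sums_0 sums_unique2)
    then show "herglotz F w = 0" using herglotz_reflect[OF w'(2), of F] w'(3) by simp
  qed auto
  then show ?thesis
    using rho_AE
  proof eventually_elim
    case (elim z)
    then have "P0 z \<noteq> 0" using norm_P0[of z] by auto
    then show ?case using elim by (auto simp: F_def e_def split: if_splits)
  qed
qed

text \<open>If \<open>|g| < 1\<close> on a set of positive measure, then \<open>lam\<close> vanishes there, so the Herglotz transform of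
  \<open>k\<close> has non-isolated zeros and \<open>k = 0\<close>.\<close>
lemma modulus_one:
  assumes nt: "\<not> (\<exists>h\<in>admissible J. AE z in circle_measure. z \<in> I \<longrightarrow> f z = h z)"
  shows "AE z in circle_measure. z \<in> J \<longrightarrow> cmod (g z) = 1"
proof (rule ccontr)
  assume contra: "\<not> ?thesis"
  define \<delta> where "\<delta> m = inverse (real (Suc m))" for m
  have \<delta>: "\<delta> m > 0" for m by (simp add: \<delta>_def)
  \<comment> \<open>The bound on the weight keeps \<open>E m\<close> away from \<open>P\<close>. The
    condition \<open>lam z = 0\<close> is imposed pointwise because continuation needs genuine
    zeros.\<close>
  define E where "E m = {z \<in> J. cmod (g z) \<le> 1 - \<delta> m \<and> \<delta> m \<le> \<rho> z \<and> lam z = 0}" for m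
  have "\<exists>m. \<not> (AE z in circle_measure. z \<notin> E m)"
  proof (rule ccontr)
    assume "\<nexists>m. \<not> (AE z in circle_measure. z \<notin> E m)"
    then have "AE z in circle_measure. \<forall>m. z \<notin> E m" by (subst AE_all_countable) auto
    moreover have "AE z in circle_measure. \<forall>m. z \<in> J \<and> cmod (g z) \<le> 1 - \<delta> m \<longrightarrow> lam z = 0"
      using lam_zero_if_small \<delta> by (subst AE_all_countable) auto
    ultimately have "AE z in circle_measure. z \<in> J \<longrightarrow> cmod (g z) = 1"
      using g_le rho_AE
    proof eventually_elim
      case (elim z)
      show ?case
      proof (rule impI, rule ccontr)
        assume z: "z \<in> J" "cmod (g z) \<noteq> 1"
        then have "0 < min (1 - cmod (g z)) (\<rho> z)" using elim by auto
        then obtain m where "\<delta> m < min (1 - cmod (g z)) (\<rho> z)" using reals_Archimedean \<delta>_def by metis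
        then have "cmod (g z) \<le> 1 - \<delta> m" "\<delta> m \<le> \<rho> z" by auto
        then show False using elim(1,2) z(1) unfolding E_def by blast
      qed
    qed
    then show False using contra by simp
  qed
  then obtain m where m: "\<not> (AE z in circle_measure. z \<notin> E m)" by blast
  \<comment> \<open>Finite sets are null, so a set that is not null is infinite and accumulates on
    the circle.\<close>
  then have inf: "infinite (E m)" using AE_circle_notin_finite by blast
  have "E m \<subseteq> sphere 0 1" using J by (auto simp: E_def)
  then obtain l where l: "l \<in> sphere 0 1" "l islimpt E m"
    using inf compact_sphere[of "0::complex" 1] by (meson compact_eq_Bolzano_Weierstrass)
  \<comment> \<open>If \<open>I\<close> met the ball of this radius around \<open>l\<close>, some
    \<open>t\<close> in \<open>E m\<close> and \<open>s\<close> in \<open>I\<close> would have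
    distance below \<open>2 * r\<close>, against \<open>\<delta> m \<le> K * norm (t - s)\<close>.
    The maximum with 1 makes the denominator positive.\<close>
  define r where "r = \<delta> m / (2 * max K 1)"
  have r: "r > 0" using \<delta> by (simp add: r_def)
  have disj: "ball l r \<inter> I = {}"
  proof (rule ccontr)
    assume "ball l r \<inter> I \<noteq> {}"
    then obtain s where s: "s \<in> I" "dist l s < r" by auto
    obtain t where t: "t \<in> E m" "dist t l < r" using l(2) r unfolding islimpt_approachable by blast
    then have "\<delta> m \<le> \<rho> t" "t \<in> J" by (auto simp: E_def)
    then have "\<delta> m \<le> K * norm (t - s)" using K[of t s] s by (simp add: \<rho>_def)
    also have "\<dots> \<le> max K 1 * norm (t - s)" by (intro mult_right_mono) auto
    also have "\<dots> < max K 1 * (2 * r)"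
    proof (rule mult_strict_left_mono)
      show "norm (t - s) < 2 * r" using dist_triangle[of t s l] s t by (simp add: dist_norm)
    qed simp
    also have "\<dots> = \<delta> m" by (simp add: r_def)
    finally show False by simp
  qed
  have ki: "integrable circle_measure (\<lambda>s. complex_of_real (k s))" using k_integrable by simp
  have "AE s in circle_measure. complex_of_real (k s) = 0"
  proof (rule herglotz_zeros_imp_AE_zero[OF ki _ r, of l "E m \<inter> ball l r" l])
    show "norm l = 1" using l by simp
    show "AE s in circle_measure. s \<in> ball l r \<longrightarrow> complex_of_real (k s) = 0"
    proof (intro AE_I2 impI)
      fix s assume "s \<in> ball l r"
      then have "s \<notin> I" using disj by blast
      then show "complex_of_real (k s) = 0" by (simp add: k_outside)
    qed
    show "l islimpt E m \<inter> ball l r"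
      unfolding islimpt_def
    proof (intro allI impI)
      fix T assume "l \<in> T" "open T"
      then have "l \<in> T \<inter> ball l r" "open (T \<inter> ball l r)" using r by auto
      then obtain y where "y \<in> E m" "y \<in> T \<inter> ball l r" "y \<noteq> l" using l(2) unfolding islimpt_def by blast
      then show "\<exists>y\<in>E m \<inter> ball l r. y \<in> T \<and> y \<noteq> l" by auto
    qed
    fix w assume "w \<in> E m \<inter> ball l r"
    then have w: "norm w = 1" "lam w = 0" using J by (auto simp: E_def)
    \<comment> \<open>The kernel is imaginary on the circle, so the transform of \<open>k\<close> at
      \<open>w\<close> is \<open>- \<i> * lam w\<close>.\<close>
    have "herglotz (\<lambda>s. complex_of_real (k s)) w = (LINT s|circle_measure. - \<i> * of_real (k s * \<kappa> w s))"
      unfolding herglotz_def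
    proof (rule Bochner_Integration.integral_cong[OF refl])
      fix s assume "s \<in> space circle_measure"
      then have "herg w s = \<i> * of_real (\<kappa> w s)" unfolding \<kappa>_def using w by (intro herg_imaginary) auto
      then show "of_real (k s) * herg s w = - \<i> * of_real (k s * \<kappa> w s)" by (simp add: herg_swap[of s w])
    qed
    also have "\<dots> = - \<i> * of_real (lam w)" unfolding lam_def integral_mult_right_zero integral_complex_of_real ..
    finally show "herglotz (\<lambda>s. complex_of_real (k s)) w = 0" using w by simp
  qed (use r in auto)
  then have k0: "AE s in circle_measure. k s = 0" by simp
  have "lam t = 0" for t
  proof -
    have "lam t = (LINT s|circle_measure. 0)" unfolding lam_def
      by (intro integral_cong_AE) (use k0 in \<open>auto elim!: eventually_mono\<close>)
    then show ?thesis by simp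
  qed
  from lam_zero_imp_trace[OF this _ r disj] l nt show False
    using sol by (auto simp: ABEP_solution_def)
qed

text \<open>Where \<open>cmod (g t) = 1\<close>, the squared modulus of
  \<open>g + \<epsilon> * h\<close> is
  \<open>1 + 2 * (\<epsilon> * v + \<epsilon>\<^sup>2 * w)\<close> with
  \<open>v = Re (h * cnj g)\<close> and \<open>w\<close> half the squared modulus of
  \<open>h\<close>; then \<open>1 + x \<le> exp x\<close> makes the variation admissible.\<close>

lemma variation_vanishing_at_endpoints:
  assumes g1: "AE z in circle_measure. z \<in> J \<longrightarrow> cmod (g z) = 1" and h: "h \<in> H2"
    and hC: "AE z in circle_measure. z \<in> J \<longrightarrow> cmod (h z) \<le> C * \<rho> z" and C: "C \<ge> 0"
  shows "Re (LINT s|circle_measure. h s * cnj (e s)) \<le> Re (LINT t|circle_measure. of_real (if t \<in> J then lam t else 0) * (h t * cnj (g t)))"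
proof -
  have hL: "L2 h" using h by (simp add: H2_L2)
  note [measurable] = L2_measurable[OF hL]
  have [measurable]: "(\<lambda>t. cnj (g t)) \<in> borel_measurable circle_measure" by (intro measurable_circle_cnj) measurable
  \<comment> \<open>The first variation wants its bounds at every point, so conditions known almost
    everywhere on \<open>J\<close> are built into \<open>v\<close> and \<open>w\<close>.\<close>
  define ok where "ok t \<longleftrightarrow> t \<in> J \<and> cmod (h t) \<le> C * \<rho> t \<and> cmod (g t) \<le> 1" for t
  have [measurable]: "Measurable.pred circle_measure ok" unfolding ok_def by measurable
  define v where "v t = (if ok t then Re (h t * cnj (g t)) else 0)" for t
  define w where "w t = (if ok t then (cmod (h t))\<^sup>2 / 2 else 0)" for t
  have [measurable]: "v \<in> borel_measurable circle_measure" "w \<in> borel_measurable circle_measure"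
    unfolding v_def w_def by measurable
  have R: "R > 0" by (simp add: R_def)
  \<comment> \<open>One constant for both: \<open>C\<close> suffices for \<open>v\<close>, and
    \<open>C\<^sup>2 * R\<close> for the quadratic \<open>w\<close>, where one factor
    \<open>\<rho> t\<close> is bounded by \<open>R\<close>.\<close>
  let ?C = "C + C\<^sup>2 * R"
  have v: "\<bar>v t\<bar> \<le> ?C * \<rho> t" for t
  proof (cases "ok t")
    case True
    have "\<bar>v t\<bar> \<le> cmod (h t * cnj (g t))" using True abs_Re_le_cmod[of "h t * cnj (g t)"] by (simp only: v_def if_True)
    also have "\<dots> \<le> (C * \<rho> t) * 1" unfolding norm_mult using True by (intro mult_mono) (auto simp: ok_def C rho_nonneg)
    also have "\<dots> \<le> ?C * \<rho> t" using R rho_nonneg[of t] by (simp add: mult_right_mono)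
    finally show ?thesis .
  qed (use R C rho_nonneg in \<open>auto simp: v_def\<close>)
  have w: "\<bar>w t\<bar> \<le> ?C * \<rho> t" for t
  proof (cases "ok t")
    case True
    then have t: "norm t = 1" using J by (auto simp: ok_def)
    have "w t \<le> (cmod (h t))\<^sup>2" using True by (simp add: w_def)
    also have "\<dots> \<le> (C * \<rho> t)\<^sup>2" using True by (intro power_mono) (auto simp: ok_def)
    also have "\<dots> = C\<^sup>2 * (\<rho> t * \<rho> t)" by (simp add: power2_eq_square)
    also have "\<dots> \<le> C\<^sup>2 * (R * \<rho> t)" using rho_le[OF t] rho_nonneg[of t] by (intro mult_left_mono mult_right_mono) auto
    also have "\<dots> \<le> ?C * \<rho> t" using C rho_nonneg[of t] by (simp add: algebra_simps)
    finally show ?thesis using True by (simp add: w_def)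
  qed (use R C rho_nonneg in \<open>auto simp: w_def\<close>)
  have "Re (LINT s|circle_measure. h s * cnj (e s)) \<le> (LINT t|circle_measure. v t * lam t)"
  proof (rule first_variation[OF h _ _ v _ w _ zero_less_one])
    fix \<epsilon> :: real assume \<epsilon>: "0 < \<epsilon>"
    show "AE t in circle_measure. t \<in> J \<longrightarrow> cmod (g t + of_real \<epsilon> * h t) \<le> exp (\<epsilon> * v t + \<epsilon>\<^sup>2 * w t)"
      using g1 hC
    proof eventually_elim
      case (elim t)
      show ?case
      proof
        assume t: "t \<in> J"
        then have ok: "ok t" using elim by (simp add: ok_def)
        have "(cmod (g t + of_real \<epsilon> * h t))\<^sup>2 = (cmod (g t))\<^sup>2 + 2 * \<epsilon> * Re (h t * cnj (g t)) + \<epsilon>\<^sup>2 * (cmod (h t))\<^sup>2"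
          unfolding cmod_power2 by (simp add: power2_eq_square algebra_simps)
        also have "\<dots> = 1 + 2 * (\<epsilon> * v t + \<epsilon>\<^sup>2 * w t)" using elim t ok by (simp add: v_def w_def)
        also have "\<dots> \<le> exp (2 * (\<epsilon> * v t + \<epsilon>\<^sup>2 * w t))" by (rule exp_ge_add_one_self)
        also have "\<dots> = (exp (\<epsilon> * v t + \<epsilon>\<^sup>2 * w t))\<^sup>2" by (simp only: exp_double)
        finally show "cmod (g t + of_real \<epsilon> * h t) \<le> exp (\<epsilon> * v t + \<epsilon>\<^sup>2 * w t)" by (rule power2_le_imp_le) simp
      qed
    qed
  qed (auto simp: v_def w_def ok_def)
  also have "(LINT t|circle_measure. v t * lam t) = (LINT t|circle_measure. Re (of_real (if t \<in> J then lam t else 0) * (h t * cnj (g t))))"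
  proof (rule integral_cong_AE)
    show "AE t in circle_measure. v t * lam t = Re (of_real (if t \<in> J then lam t else 0) * (h t * cnj (g t)))"
      using g1 hC by eventually_elim (auto simp: v_def ok_def)
  qed measurable
  also have "\<dots> = Re (LINT t|circle_measure. of_real (if t \<in> J then lam t else 0) * (h t * cnj (g t)))"
  proof (rule integral_Re)
    have B: "AE t in circle_measure. complex_of_real (if t \<in> J then lam t else 0) = 0 \<or> norm (h t * cnj (g t)) \<le> C * R"
      using g1 hC AE_circle_norm
    proof eventually_elim
      case (elim t)
      then show ?case using mult_left_mono[OF rho_le[OF elim(3)] C] by (auto simp: norm_mult)
    qed
    show "integrable circle_measure (\<lambda>t. complex_of_real (if t \<in> J then lam t else 0) * (h t * cnj (g t)))"
      using integrable_of_real[OF lam_integrable, where ?'a = complex] by (rule integrable_mult_bounded_support[OF _ _ B]) measurable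
  qed
  finally show ?thesis .
qed

text \<open>The real inequality holds for every unimodular multiple of \<open>h\<close>; the
  multiples by 1, -1, \<open>\<i>\<close> and \<open>- \<i>\<close> give the complex
  equality.\<close>

lemma orthogonality_vanishing_at_endpoints:
  assumes g1: "AE z in circle_measure. z \<in> J \<longrightarrow> cmod (g z) = 1" and h: "h \<in> H2"
    and hC: "AE z in circle_measure. z \<in> J \<longrightarrow> cmod (h z) \<le> C * \<rho> z" and C: "C \<ge> 0"
  shows "(LINT s|circle_measure. h s * cnj (e s)) = (LINT t|circle_measure. of_real (if t \<in> J then lam t else 0) * (h t * cnj (g t)))"
    (is "?A = ?B")
proof -
  have *: "Re (c * ?A) \<le> Re (c * ?B)" if c: "norm c = 1" for c
  proof -
    have "Re (LINT s|circle_measure. c * h s * cnj (e s)) \<le> Re (LINT t|circle_measure. of_real (if t \<in> J then lam t else 0) * (c * h t * cnj (g t)))"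
      using hC c by (intro variation_vanishing_at_endpoints[OF g1 H2_cmult[OF h] _ C]) (simp add: norm_mult)
    also have "(\<lambda>t. of_real (if t \<in> J then lam t else 0) * (c * h t * cnj (g t))) = (\<lambda>t. c * (of_real (if t \<in> J then lam t else 0) * (h t * cnj (g t))))"
      by (simp add: mult_ac)
    finally show ?thesis by (simp only: mult.assoc integral_mult_right_zero)
  qed
  show ?thesis using *[of 1] *[of "-1"] *[of "\<i>"] *[of "-\<i>"] by (auto simp: complex_eq_iff)
qed

text \<open>The functions \<open>\<psi> n\<close> vanish at the endpoints of \<open>I\<close>, are bounded by \<open>1\<close> and tend to \<open>1\<close>.\<close>
lemma orthogonality:
  assumes g1: "AE z in circle_measure. z \<in> J \<longrightarrow> cmod (g z) = 1" and h: "h \<in> H2"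
    and hB: "AE z in circle_measure. z \<in> J \<longrightarrow> cmod (h z) \<le> B"
  shows "(LINT s|circle_measure. h s * cnj (e s)) = (LINT t|circle_measure. of_real (if t \<in> J then lam t else 0) * (h t * cnj (g t)))"
proof -
  \<comment> \<open>The poles \<open>a n * p\<close> lie outside the closed disc, so division
    preserves \<open>H2\<close>, and they converge to the zeros \<open>p\<close>.\<close>
  define a where "a n = 1 + inverse (real (Suc n))" for n
  have a1: "a n > 1" for n by (simp add: a_def)
  have alim: "a \<longlonglongrightarrow> 1" unfolding a_def by (rule LIMSEQ_inverse_real_of_nat_add)
  define \<psi> where "\<psi> n z = P0 z / (\<Prod>p\<in>P. z - of_real (a n) * p)" for n z
  have hL: "L2 h" using h by (simp add: H2_L2)
  note [measurable] = L2_measurable[OF hL]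
  have [measurable]: "(\<lambda>t. cnj (g t)) \<in> borel_measurable circle_measure" "(\<lambda>t. cnj (e t)) \<in> borel_measurable circle_measure"
    by (intro measurable_circle_cnj; measurable)+
  have [measurable]: "\<psi> n \<in> borel_measurable circle_measure" for n unfolding \<psi>_def P0_def by measurable
  \<comment> \<open>Pushing \<open>p\<close> outwards increases its distance to every point of the
    circle, which gives the bound 1 for \<open>\<psi>\<close>; the distance \<open>a n - 1\<close>
    from the pole to the circle gives domination by the weight.\<close>
  have dist: "norm (z - p) \<le> norm (z - of_real (a n) * p)" "a n - 1 \<le> norm (z - of_real (a n) * p)"
    if "norm z = 1" "p \<in> P" for z p n
  proof -
    have p: "norm p = 1" using that P by auto
    have "Re (z * cnj p) \<le> 1" using complex_Re_le_cmod[of "z * cnj p"] p that by (simp add: norm_mult)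
    then have "0 \<le> (a n - 1) * ((a n + 1) - 2 * Re (z * cnj p))" using a1[of n] by (intro mult_nonneg_nonneg) auto
    moreover have "(cmod (z - of_real x * p))\<^sup>2 = (cmod z)\<^sup>2 - 2 * x * Re (z * cnj p) + x\<^sup>2 * (cmod p)\<^sup>2" for x
      unfolding cmod_power2 by (simp add: power2_eq_square algebra_simps)
    from this[of 1] this[of "a n"] have "(cmod (z - of_real (a n) * p))\<^sup>2 - (cmod (z - p))\<^sup>2 = (a n - 1) * ((a n + 1) - 2 * Re (z * cnj p))"
      using p that by (simp add: power2_eq_square algebra_simps)
    ultimately have "0 \<le> (cmod (z - of_real (a n) * p))\<^sup>2 - (cmod (z - p))\<^sup>2" by (simp only:)
    then have "(cmod (z - p))\<^sup>2 \<le> (cmod (z - of_real (a n) * p))\<^sup>2" by (simp only: diff_ge_0_iff_ge)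
    then show "norm (z - p) \<le> norm (z - of_real (a n) * p)" by (rule power2_le_imp_le) simp
    show "a n - 1 \<le> norm (z - of_real (a n) * p)"
      using norm_triangle_ineq2[of "of_real (a n) * p" z] that p a1[of n] by (simp add: norm_mult norm_minus_commute)
  qed
  have \<psi>1: "norm (\<psi> n z) \<le> 1" if z: "norm z = 1" for n z
  proof -
    have "norm (\<psi> n z) = (\<Prod>p\<in>P. norm (z - p) / norm (z - of_real (a n) * p))"
      by (simp add: \<psi>_def norm_divide P0_def prod_norm[symmetric] prod_dividef)
    also have "\<dots> \<le> 1"
    proof (intro prod_le_1 conjI)
      fix p assume "p \<in> P"
      with dist[OF z this, of n] a1[of n] have "0 < norm (z - of_real (a n) * p)" by linarith
      then show "norm (z - p) / norm (z - of_real (a n) * p) \<le> 1" using dist[OF z \<open>p \<in> P\<close>, of n] by (simp add: divide_le_eq)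
    qed auto
    finally show ?thesis .
  qed
  have \<psi>\<rho>: "norm (\<psi> n z) \<le> inverse ((a n - 1) ^ card P) * \<rho> z" if z: "norm z = 1" for n z
  proof -
    have "(\<Prod>p\<in>P. a n - 1) \<le> (\<Prod>p\<in>P. norm (z - of_real (a n) * p))"
      using dist[OF z] a1[of n] by (intro prod_mono) auto
    then have "(a n - 1) ^ card P \<le> norm (\<Prod>p\<in>P. z - of_real (a n) * p)" by (simp add: prod_norm)
    moreover have "0 < (a n - 1) ^ card P" using a1[of n] by simp
    ultimately have "\<rho> z / norm (\<Prod>p\<in>P. z - of_real (a n) * p) \<le> \<rho> z / (a n - 1) ^ card P"
      using rho_nonneg[of z] by (intro divide_left_mono mult_pos_pos) auto
    moreover have "norm (\<psi> n z) = \<rho> z / norm (\<Prod>p\<in>P. z - of_real (a n) * p)"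
      by (simp only: \<psi>_def norm_divide norm_P0)
    ultimately show ?thesis by (metis divide_inverse mult.commute)
  qed
  have \<psi>lim: "(\<lambda>n. \<psi> n z) \<longlonglongrightarrow> 1" if "\<rho> z > 0" for z
  proof -
    have nz: "P0 z \<noteq> 0" using that norm_P0[of z] by auto
    have "(\<lambda>n. \<psi> n z) \<longlonglongrightarrow> P0 z / (\<Prod>p\<in>P. z - of_real 1 * p)"
      unfolding \<psi>_def using nz by (intro tendsto_divide tendsto_const tendsto_prod tendsto_diff tendsto_mult tendsto_of_real alim) (simp add: P0_def)
    then show ?thesis using nz by (simp add: P0_def)
  qed
  have eq: "(LINT s|circle_measure. h s * \<psi> n s * cnj (e s)) = (LINT t|circle_measure. of_real (if t \<in> J then lam t else 0) * (h t * \<psi> n t * cnj (g t)))" for n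
  proof (rule orthogonality_vanishing_at_endpoints[OF g1])
    have "(\<lambda>z. h z * P0 z / (\<Prod>p\<in>P. z - of_real (a n) * p)) \<in> H2"
    proof (rule H2_divide_prod)
      show "1 < norm (of_real (a n) * p)" if "p \<in> P" for p
      proof -
        have "norm p = 1" using that P by auto
        then show ?thesis using a1[of n] by (simp add: norm_mult)
      qed
      show "(\<lambda>z. h z * P0 z) \<in> H2" unfolding P0_def by (rule H2_mult_prod[OF P(1) h])
    qed (rule P)
    then show "(\<lambda>s. h s * \<psi> n s) \<in> H2" by (simp add: \<psi>_def)
    show "AE z in circle_measure. z \<in> J \<longrightarrow> cmod (h z * \<psi> n z) \<le> \<bar>B\<bar> * inverse ((a n - 1) ^ card P) * \<rho> z"
      using hB AE_circle_norm
    proof eventually_elim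
      case (elim z)
      show ?case
      proof
        assume "z \<in> J"
        then have "cmod (h z) * norm (\<psi> n z) \<le> \<bar>B\<bar> * (inverse ((a n - 1) ^ card P) * \<rho> z)"
          using elim by (intro mult_mono \<psi>\<rho>) auto
        then show "cmod (h z * \<psi> n z) \<le> \<bar>B\<bar> * inverse ((a n - 1) ^ card P) * \<rho> z" by (simp add: norm_mult mult_ac)
      qed
    qed
    show "0 \<le> \<bar>B\<bar> * inverse ((a n - 1) ^ card P)" using a1[of n] by simp
  qed
  have "(\<lambda>n. LINT s|circle_measure. h s * \<psi> n s * cnj (e s)) \<longlonglongrightarrow> (LINT s|circle_measure. h s * cnj (e s))"
  proof (rule integral_dominated_convergence)
    show "integrable circle_measure (\<lambda>s. cmod (h s) * cmod (e s))" by (rule L2_mult_integrable(1)[OF hL e_L2])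
    show "AE s in circle_measure. (\<lambda>n. h s * \<psi> n s * cnj (e s)) \<longlonglongrightarrow> h s * cnj (e s)"
      using rho_AE
    proof eventually_elim
      case (elim s)
      have "(\<lambda>n. h s * \<psi> n s * cnj (e s)) \<longlonglongrightarrow> h s * 1 * cnj (e s)" by (intro tendsto_intros \<psi>lim elim)
      then show ?case by simp
    qed
    show "AE s in circle_measure. norm (h s * \<psi> n s * cnj (e s)) \<le> cmod (h s) * cmod (e s)" for n
      using AE_circle_norm
    proof eventually_elim
      case (elim s)
      have "norm (h s) * norm (\<psi> n s) * norm (e s) \<le> norm (h s) * 1 * norm (e s)"
        by (intro mult_right_mono mult_left_mono \<psi>1 elim) auto
      then show ?case by (simp add: norm_mult)
    qed
  qed measurable
  \<comment> \<open>Here the integrability of \<open>lam\<close> itself, without the weight,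
    provides the dominating function.\<close>
  moreover have "(\<lambda>n. LINT t|circle_measure. of_real (if t \<in> J then lam t else 0) * (h t * \<psi> n t * cnj (g t)))
      \<longlonglongrightarrow> (LINT t|circle_measure. of_real (if t \<in> J then lam t else 0) * (h t * cnj (g t)))"
  proof (rule integral_dominated_convergence)
    show "integrable circle_measure (\<lambda>t. \<bar>B\<bar> * \<bar>if t \<in> J then lam t else 0\<bar>)"
      using integrable_abs[OF lam_integrable] by (rule integrable_mult_right)
    show "AE t in circle_measure. (\<lambda>n. of_real (if t \<in> J then lam t else 0) * (h t * \<psi> n t * cnj (g t))) \<longlonglongrightarrow> of_real (if t \<in> J then lam t else 0) * (h t * cnj (g t))"
      using rho_AE
    proof eventually_elim
      case (elim t)
      have "(\<lambda>n. of_real (if t \<in> J then lam t else 0) * (h t * \<psi> n t * cnj (g t))) \<longlonglongrightarrow> of_real (if t \<in> J then lam t else 0) * (h t * 1 * cnj (g t))"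
        by (intro tendsto_intros \<psi>lim elim)
      then show ?case by simp
    qed
    show "AE t in circle_measure. norm (of_real (if t \<in> J then lam t else 0) * (h t * \<psi> n t * cnj (g t))) \<le> \<bar>B\<bar> * \<bar>if t \<in> J then lam t else 0\<bar>" for n
      using AE_circle_norm g1 hB
    proof eventually_elim
      case (elim t)
      show ?case
      proof (cases "t \<in> J")
        case True
        then have "norm (h t) * norm (\<psi> n t) * norm (g t) \<le> \<bar>B\<bar> * 1 * 1"
          using elim by (intro mult_mono \<psi>1) auto
        from mult_left_mono[OF this, of "\<bar>lam t\<bar>"] show ?thesis using True by (simp add: norm_mult mult.commute)
      qed simp
    qed
  qed measurable
  ultimately show ?thesis unfolding eq using LIMSEQ_unique by blast
qed

end

section \<open>Endpoints of arcs and the main theorem\<close>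

lemma norm_cis_diff: "norm (cis x - cis y) = 2 * \<bar>sin ((x - y) / 2)\<bar>"
proof -
  have "cis x - cis y = cis y * (exp (\<i> * of_real (x - y)) - 1)"
    by (simp add: cis_conv_exp algebra_simps flip: exp_add)
  then show ?thesis by (simp only: norm_mult norm_cis dist_exp_i_1 mult_1_left)
qed

lemma sin_ge_min:
  assumes "0 \<le> x" "x \<le> y" "y \<le> z" "z \<le> pi"
  shows "sin x \<le> sin y \<or> sin z \<le> sin y"
proof (cases "y \<le> pi / 2")
  case True
  then show ?thesis using assms by (intro disjI1 sin_monotone_2pi_le) auto
next
  case False
  then have "sin (pi - z) \<le> sin (pi - y)" using assms by (intro sin_monotone_2pi_le) auto
  then show ?thesis by simp
qed

text \<open>With \<open>t\<close> lifted to an angle in \<open>[a, a + 2 * pi)\<close>, the chords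
  are sines of half differences in \<open>[0, pi]\<close>. Sine rises and then falls there, so the
  middle value is at least one of the outer two.\<close>

lemma arc_endpoint_closer:
  assumes ab: "a < b" "b \<le> a + 2 * pi" and s: "s \<in> cis ` {a<..<b}" and t: "norm t = 1" "t \<notin> cis ` {a<..<b}"
  shows "norm (t - cis a) \<le> norm (t - s) \<or> norm (t - cis b) \<le> norm (t - s)"
proof -
  obtain \<sigma> where \<sigma>: "a < \<sigma>" "\<sigma> < b" "s = cis \<sigma>" using s by auto
  define \<tau> where "\<tau> = a + Arg2pi (t / cis a)"
  have "t / cis a = cis (Arg2pi (t / cis a))"
    using Arg2pi_eq[of "t / cis a"] t by (simp add: norm_divide cis_conv_exp)
  then have t\<tau>: "t = cis \<tau>" by (simp add: \<tau>_def field_simps cis_mult)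
  have \<tau>: "a \<le> \<tau>" "\<tau> < a + 2 * pi" using Arg2pi_ge_0[of "t / cis a"] Arg2pi_lt_2pi[of "t / cis a"] by (auto simp: \<tau>_def)
  show ?thesis
  proof (cases "\<tau> = a")
    case True
    then show ?thesis using t\<tau> by simp
  next
    case False
    then have "b \<le> \<tau>" using t\<tau> t(2) \<tau> by (force simp: not_less)
    then have o: "0 \<le> (\<tau> - b) / 2" "(\<tau> - b) / 2 \<le> (\<tau> - \<sigma>) / 2" "(\<tau> - \<sigma>) / 2 \<le> (\<tau> - a) / 2" "(\<tau> - a) / 2 \<le> pi"
      using \<sigma> \<tau> by auto
    then have "sin ((\<tau> - b) / 2) \<ge> 0" "sin ((\<tau> - \<sigma>) / 2) \<ge> 0" "sin ((\<tau> - a) / 2) \<ge> 0"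
      by (auto intro!: sin_ge_zero)
    then show ?thesis using sin_ge_min[OF o] unfolding t\<tau> \<sigma>(3) norm_cis_diff by auto
  qed
qed

text \<open>An arc is not open in the plane, so it is exhausted by countably many compact
  arcs.\<close>

lemma open_arc_borel:
  assumes "open_arc A" shows "A \<in> sets borel" "A \<subseteq> unit_circle"
proof -
  obtain a b where A: "A = cis ` {a<..<b}" using assms by (auto simp: open_arc_def)
  let ?C = "\<lambda>n. cis ` {a + inverse (real (Suc n)) .. b - inverse (real (Suc n))}"
  have "A = (\<Union>n. ?C n)"
  proof
    show "A \<subseteq> (\<Union>n. ?C n)"
    proof
      fix z assume "z \<in> A"
      then obtain x where x: "a < x" "x < b" "z = cis x" using A by auto
      then obtain n where "inverse (real (Suc n)) < min (x - a) (b - x)" using reals_Archimedean[of "min (x - a) (b - x)"] by auto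
      then have "x \<in> {a + inverse (real (Suc n)) .. b - inverse (real (Suc n))}" by auto
      then show "z \<in> (\<Union>n. ?C n)" using x by blast
    qed
    have "{a + inverse (real (Suc n)) .. b - inverse (real (Suc n))} \<subseteq> {a<..<b}" for n
    proof
      fix x assume x: "x \<in> {a + inverse (real (Suc n)) .. b - inverse (real (Suc n))}"
      have "0 < inverse (real (Suc n))" by simp
      then show "x \<in> {a<..<b}" using x unfolding atLeastAtMost_iff greaterThanLessThan_iff by linarith
    qed
    then show "(\<Union>n. ?C n) \<subseteq> A" unfolding A by blast
  qed
  moreover have "closed (?C n)" for n
    by (intro compact_imp_closed compact_continuous_image) (auto intro!: continuous_intros)
  then have "(\<Union>n. ?C n) \<in> sets borel" by (intro sets.countable_UN) auto
  ultimately show "A \<in> sets borel" by simp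
  show "A \<subseteq> unit_circle" by (auto simp: A)
qed

text \<open>For \<open>s\<close> in an arc and \<open>t\<close> off \<open>I\<close>, an endpoint of
  that arc is at least as close to \<open>t\<close> as \<open>s\<close> is, and each other factor is
  at most 2. Endpoints lying inside other arcs do no harm.\<close>

lemma finite_union_of_arcs_endpoints:
  assumes "finite_union_of_arcs I"
  obtains P :: "complex set" and K :: real where "I \<in> sets circle_measure" "finite P" "P \<subseteq> unit_circle"
    "\<And>t s. t \<in> unit_circle - I \<Longrightarrow> s \<in> I \<Longrightarrow> (\<Prod>p\<in>P. norm (t - p)) \<le> K * norm (t - s)"
proof -
  obtain \<A> where \<A>: "finite \<A>" "\<forall>A\<in>\<A>. open_arc A" "I = \<Union>\<A>"
    using assms by (auto simp: finite_union_of_arcs_def)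
  have "\<forall>A\<in>\<A>. \<exists>a b. a < b \<and> b \<le> a + 2 * pi \<and> A = cis ` {a<..<b}" using \<A>(2) by (simp add: open_arc_def)
  then obtain a b where ab: "\<And>A. A \<in> \<A> \<Longrightarrow> a A < b A \<and> b A \<le> a A + 2 * pi \<and> A = cis ` {a A<..<b A}" by metis
  define P where "P = (\<lambda>A. cis (a A)) ` \<A> \<union> (\<lambda>A. cis (b A)) ` \<A>"
  have P: "finite P" "P \<subseteq> unit_circle" using \<A> by (auto simp: P_def)
  show thesis
  proof (rule that[OF _ P])
    show "I \<in> sets circle_measure" unfolding \<A>(3)
      using \<A> open_arc_borel by (intro sets.finite_Union) (auto intro!: sets_circle_measureI)
    fix t s assume t: "t \<in> unit_circle - I" and s: "s \<in> I"
    then obtain A where A: "A \<in> \<A>" "s \<in> A" using \<A> by auto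
    then have "norm (t - cis (a A)) \<le> norm (t - s) \<or> norm (t - cis (b A)) \<le> norm (t - s)"
      using arc_endpoint_closer[of "a A" "b A" s t] ab[OF A(1)] t \<A>(3) by auto
    then obtain p where p: "p \<in> P" "norm (t - p) \<le> norm (t - s)" using A(1) unfolding P_def by blast
    have "(\<Prod>q\<in>P - {p}. norm (t - q)) \<le> (\<Prod>q\<in>P - {p}. 2)"
    proof (intro prod_mono conjI)
      fix q assume "q \<in> P - {p}"
      then have "norm q = 1" using P by auto
      then show "norm (t - q) \<le> 2" using norm_triangle_ineq4[of t q] t by simp
    qed auto
    then have "(\<Prod>q\<in>P - {p}. norm (t - q)) \<le> 2 ^ card (P - {p})" by simp
    also have "\<dots> \<le> 2 ^ card P" using P by (intro power_increasing card_mono) auto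
    finally have "norm (t - p) * (\<Prod>q\<in>P - {p}. norm (t - q)) \<le> norm (t - s) * 2 ^ card P"
      using p by (intro mult_mono prod_nonneg) auto
    then show "(\<Prod>p\<in>P. norm (t - p)) \<le> 2 ^ card P * norm (t - s)"
      using prod.remove[OF P(1) p(1), of "\<lambda>q. norm (t - q)"] by (simp add: mult.commute)
  qed
qed

section \<open>Bounded Hardy functions and sufficiency\<close>

lemma H2_inf_bounded:
  assumes J: "J \<in> sets circle_measure" and h: "h \<in> H2_inf J"
  obtains B where "AE z in circle_measure. z \<in> J \<longrightarrow> cmod (h z) \<le> B"
proof -
  define S where "S = esssup (restrict_space circle_measure J) (\<lambda>z. ereal (cmod (h z)))"
  have "S \<noteq> \<infinity>" using h by (simp add: H2_inf_def Linf_norm_on_def S_def)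
  \<comment> \<open>The essential supremum over a null set is minus infinity, so a natural number is
    taken as the bound.\<close>
  then obtain n :: nat where n: "S < ereal (real n)" by (auto simp: less_PInf_Ex_of_nat)
  have "AE z in restrict_space circle_measure J. ereal (cmod (h z)) \<le> S" unfolding S_def by (rule esssup_AE)
  then have "AE z in restrict_space circle_measure J. cmod (h z) \<le> real n"
  proof eventually_elim
    case (elim z)
    then have "ereal (cmod (h z)) \<le> ereal (real n)" using n by (meson less_imp_le order_trans)
    then show ?case by simp
  qed
  then have "AE z in circle_measure. z \<in> J \<longrightarrow> cmod (h z) \<le> real n"
    using J sets.sets_into_space[OF J] by (subst (asm) AE_restrict_space_iff) (auto simp: Int_absorb2)
  then show thesis by (rule that)
qed

lemma H2_infI:
  assumes J: "J \<in> sets circle_measure" and h: "h \<in> H2" and B: "AE z in circle_measure. z \<in> J \<longrightarrow> cmod (h z) \<le> B"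
  shows "h \<in> H2_inf J"
proof -
  have [measurable]: "h \<in> borel_measurable circle_measure" using h by (simp add: H2_iff)
  have "esssup (restrict_space circle_measure J) (\<lambda>z. ereal (cmod (h z))) \<le> ereal B"
  proof (rule esssup_I)
    show "(\<lambda>z. ereal (cmod (h z))) \<in> borel_measurable (restrict_space circle_measure J)"
      by (intro measurable_restrict_space1) measurable
    show "AE z in restrict_space circle_measure J. ereal (cmod (h z)) \<le> ereal B"
      using J B sets.sets_into_space[OF J] by (subst AE_restrict_space_iff) (auto simp: Int_absorb2)
  qed
  then show ?thesis using h by (auto simp: H2_inf_def Linf_norm_on_def intro: le_less_trans)
qed

lemma orthogonality_imp_ABEP_solution:
  assumes I: "I \<in> sets circle_measure" and J: "J \<in> sets circle_measure" and f: "f \<in> L2_on I" and g: "g \<in> H2"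
    and g1: "AE z in circle_measure. z \<in> J \<longrightarrow> cmod (g z) = 1"
    and lam: "set_integrable circle_measure J lam" "AE z in circle_measure. z \<in> J \<longrightarrow> lam z \<ge> 0"
    and orth: "\<And>h. h \<in> H2_inf J \<Longrightarrow>
      inner_on I (\<lambda>z. g z - f z) h + inner_on J (\<lambda>z. complex_of_real (lam z) * g z) h = 0"
  shows "ABEP_solution I J f g"
  unfolding ABEP_solution_iff
proof
  show "g \<in> admissible J" using g g1 by (auto simp: admissible_def elim!: eventually_mono)
  show "\<forall>k\<in>admissible J. L2_norm_on I (\<lambda>z. f z - g z) \<le> L2_norm_on I (\<lambda>z. f z - k z)"
  proof
    fix k assume "k \<in> admissible J"
    then have k: "k \<in> H2" "AE z in circle_measure. z \<in> J \<longrightarrow> cmod (k z) \<le> 1" by (auto simp: admissible_def)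
    define h where "h z = k z - g z" for z
    have h: "h \<in> H2" unfolding h_def using k g by (intro H2_diff)
    have [measurable]: "g \<in> borel_measurable circle_measure" "k \<in> borel_measurable circle_measure" "h \<in> borel_measurable circle_measure"
      using g k h by (auto simp: H2_iff)
    have h2: "AE z in circle_measure. z \<in> J \<longrightarrow> cmod (h z) \<le> 2"
      using k(2) g1
    proof eventually_elim
      case (elim z)
      then show ?case using norm_triangle_ineq4[of "k z" "g z"] by (auto simp: h_def)
    qed
    define e where "e z = (if z \<in> I then f z - g z else 0)" for z
    define d where "d z = (if z \<in> I then h z else 0)" for z
    have "L2 (\<lambda>z. (if z \<in> I then f z else 0) - (if z \<in> I then g z else 0))"
      using f g by (intro L2_diff[OF _ L2_restrict[OF I]]) (auto simp: L2_on_L2[OF I] H2_L2)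
    also have "(\<lambda>z. (if z \<in> I then f z else 0) - (if z \<in> I then g z else 0)) = e" by (auto simp: e_def)
    finally have e: "L2 e" .
    have d: "L2 d" unfolding d_def using h by (intro L2_restrict I) (simp add: H2_L2)
    define l where "l z = (if z \<in> J then lam z else 0)" for z
    have li: "integrable circle_measure l"
    proof -
      have "(\<lambda>z. indicator J z *\<^sub>R lam z) = l" by (auto simp: l_def indicator_def)
      then show ?thesis using lam(1) by (simp add: set_integrable_def)
    qed
    have "inner_on I (\<lambda>z. g z - f z) h = - (LINT z|circle_measure. e z * cnj (h z))"
      unfolding inner_on_eq integral_minus[symmetric]
      by (intro Bochner_Integration.integral_cong) (auto simp: e_def algebra_simps)
    moreover have "(LINT z|circle_measure. e z * cnj (h z)) = cnj (LINT z|circle_measure. d z * cnj (e z))"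
      unfolding Bochner_Integration.integral_cnj[symmetric]
      by (intro Bochner_Integration.integral_cong) (auto simp: e_def d_def mult.commute)
    moreover have "inner_on J (\<lambda>z. complex_of_real (lam z) * g z) h = (LINT z|circle_measure. of_real (l z) * (g z * cnj (h z)))"
      unfolding inner_on_eq by (intro Bochner_Integration.integral_cong) (auto simp: l_def)
    ultimately have "cnj (LINT z|circle_measure. d z * cnj (e z)) = (LINT z|circle_measure. of_real (l z) * (g z * cnj (h z)))"
      using orth[OF H2_infI[OF J h h2]] by simp
    then have "Re (LINT z|circle_measure. d z * cnj (e z)) = Re (LINT z|circle_measure. of_real (l z) * (g z * cnj (h z)))"
      by (metis cnj.simps(1))
    also have "\<dots> = (LINT z|circle_measure. Re (of_real (l z) * (g z * cnj (h z))))"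
    proof (rule integral_Re[symmetric])
      have B: "AE z in circle_measure. complex_of_real (l z) = 0 \<or> norm (g z * cnj (h z)) \<le> 2"
        using g1 h2 by eventually_elim (auto simp: l_def norm_mult)
      show "integrable circle_measure (\<lambda>z. complex_of_real (l z) * (g z * cnj (h z)))"
        using integrable_of_real[OF li, where ?'a = complex]
        by (rule integrable_mult_bounded_support[OF _ _ B]) (intro borel_measurable_times measurable_circle_cnj; measurable)
    qed
    also have "\<dots> \<le> (LINT z|circle_measure. 0)"
    proof (rule integral_mono_AE')
      show "AE z in circle_measure. Re (of_real (l z) * (g z * cnj (h z))) \<le> 0"
        using g1 k(2) lam(2)
      proof eventually_elim
        case (elim z)
        show ?case
        proof (cases "z \<in> J")
          case True
          have "Re (g z * cnj (h z)) = Re (g z * cnj (k z)) - (cmod (g z))\<^sup>2"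
            unfolding h_def cmod_power2 by (simp add: power2_eq_square algebra_simps)
          also have "\<dots> \<le> 0" using complex_Re_le_cmod[of "g z * cnj (k z)"] elim True by (simp add: norm_mult del: complex_cnj_mult times_complex.simps)
          finally have "l z * Re (g z * cnj (h z)) \<le> 0" using elim True by (intro mult_nonneg_nonpos) (auto simp: l_def)
          then show ?thesis by (simp only: times_complex.simps(1) Re_complex_of_real Im_complex_of_real mult_zero_left diff_zero)
        qed (simp add: l_def)
      qed
    qed auto
    finally have R: "Re (LINT z|circle_measure. d z * cnj (e z)) \<le> 0" by simp
    \<comment> \<open>In the expansion with parameter 1 the linear term is favourable by
      \<open>R\<close>, and the quadratic term only helps.\<close>
    have "0 \<le> (LINT z|circle_measure. (cmod (d z))\<^sup>2)" by simp
    with R have "2 * Re (LINT z|circle_measure. d z * cnj (e z)) \<le> (LINT z|circle_measure. (cmod (d z))\<^sup>2)" by linarith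
    then have le: "(LINT z|circle_measure. (cmod (e z))\<^sup>2) \<le> (LINT z|circle_measure. (cmod (e z - of_real 1 * d z))\<^sup>2)"
      unfolding L2_norm_expand[OF e d] by simp
    have eg: "(\<lambda>z. if z \<in> I then f z - g z else 0) = e" by (auto simp: e_def)
    have ek: "(\<lambda>z. if z \<in> I then f z - k z else 0) = (\<lambda>z. e z - of_real 1 * d z)"
      by (auto simp: e_def d_def h_def)
    have "L2_norm_on I (\<lambda>z. f z - g z) = sqrt (LINT z|circle_measure. (cmod (e z))\<^sup>2)"
      unfolding L2_norm_on_eq using fun_cong[OF eg] by simp
    moreover have "L2_norm_on I (\<lambda>z. f z - k z) = sqrt (LINT z|circle_measure. (cmod (e z - of_real 1 * d z))\<^sup>2)"
      unfolding L2_norm_on_eq using fun_cong[OF ek] by simp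
    ultimately show "L2_norm_on I (\<lambda>z. f z - g z) \<le> L2_norm_on I (\<lambda>z. f z - k z)"
      using le by simp
  qed
qed

theorem theorem4:
  fixes I J :: "complex set" and f g :: "complex \<Rightarrow> complex"
  assumes "finite_union_of_arcs I"
    and "J = unit_circle - I"
    and "(top_of_set unit_circle) interior_of J \<noteq> {}"
    and "f \<in> L2_on I"
    and "\<not> (\<exists>h\<in>admissible J. AE z in circle_measure. z \<in> I \<longrightarrow> f z = h z)"
    and "g \<in> H2"
  shows "ABEP_solution I J f g \<longleftrightarrow>
    (AE z in circle_measure. z \<in> J \<longrightarrow> cmod (g z) = 1) \<and>
    (\<exists>lam :: complex \<Rightarrow> real.
       set_integrable circle_measure J lam \<and>
       (AE z in circle_measure. z \<in> J \<longrightarrow> lam z \<ge> 0) \<and>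
       (\<forall>h\<in>H2_inf J.
          inner_on I (\<lambda>z. g z - f z) h + inner_on J (\<lambda>z. complex_of_real (lam z) * g z) h = 0))"
    (is "?sol \<longleftrightarrow> ?i \<and> ?ii")
proof -
  obtain P K where I: "I \<in> sets circle_measure" and P: "finite P" "P \<subseteq> unit_circle"
    and K: "\<And>t s. t \<in> unit_circle - I \<Longrightarrow> s \<in> I \<Longrightarrow> (\<Prod>p\<in>P. norm (t - p)) \<le> K * norm (t - s)"
    by (rule finite_union_of_arcs_endpoints[OF assms(1)]) blast
  have Jm: "J \<in> sets circle_measure" using I sets.compl_sets[OF I] assms(2) by simp
  show ?thesis
  proof
    assume sol: ?sol
    interpret extremal I J P K f g
    proof
      show "(\<Prod>p\<in>P. norm (t - p)) \<le> K * norm (t - s)" if "t \<in> J" "s \<in> I" for t s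
        using K that assms(2) by blast
    qed (fact I assms(2,4) P sol)+
    have g1: ?i by (rule modulus_one[OF assms(5)])
    moreover have ?ii
    proof (intro exI conjI ballI)
      have "(\<lambda>t. indicator J t *\<^sub>R lam t) = (\<lambda>t. if t \<in> J then lam t else 0)" by (auto simp: indicator_def)
      then show "set_integrable circle_measure J lam" using lam_integrable by (simp add: set_integrable_def)
      show "AE z in circle_measure. z \<in> J \<longrightarrow> 0 \<le> lam z" by (rule lam_nonneg)
      fix h assume h: "h \<in> H2_inf J"
      then obtain B where B: "AE z in circle_measure. z \<in> J \<longrightarrow> cmod (h z) \<le> B" by (rule H2_inf_bounded[OF Jm])
      have hH: "h \<in> H2" using h by (simp add: H2_inf_def)
      \<comment> \<open>\<open>inner_on\<close> conjugates \<open>h\<close>, whereas the variational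
        identity is linear in \<open>h\<close>; hence the conjugates.\<close>
      have "inner_on I (\<lambda>z. g z - f z) h = - cnj (LINT s|circle_measure. h s * cnj (e s))"
        unfolding inner_on_eq Bochner_Integration.integral_cnj[symmetric] integral_minus[symmetric]
        by (intro Bochner_Integration.integral_cong) (auto simp: e_def algebra_simps)
      moreover have "inner_on J (\<lambda>z. complex_of_real (lam z) * g z) h
          = cnj (LINT t|circle_measure. of_real (if t \<in> J then lam t else 0) * (h t * cnj (g t)))"
        unfolding inner_on_eq Bochner_Integration.integral_cnj[symmetric]
        by (intro Bochner_Integration.integral_cong) (auto simp: algebra_simps)
      ultimately show "inner_on I (\<lambda>z. g z - f z) h + inner_on J (\<lambda>z. complex_of_real (lam z) * g z) h = 0"
        using orthogonality[OF g1 hH B] by simp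
    qed
    ultimately show "?i \<and> ?ii" ..
  next
    assume "?i \<and> ?ii"
    then obtain lam :: "complex \<Rightarrow> real" where i: ?i and lam: "set_integrable circle_measure J lam"
        "AE z in circle_measure. z \<in> J \<longrightarrow> lam z \<ge> 0"
      and orth: "\<forall>h\<in>H2_inf J. inner_on I (\<lambda>z. g z - f z) h + inner_on J (\<lambda>z. complex_of_real (lam z) * g z) h = 0"
      by (elim conjE exE)
    show ?sol
      by (rule orthogonality_imp_ABEP_solution[OF I Jm assms(4,6) i lam bspec[OF orth]])
  qed
qed

end
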